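(* Consider the monotone-follower game with data $(\Omega,\mathcal F,\mathbb P)$, $T$, $N$, $k$, $d$, $L$, $f$, $h^i$, $g^i$, strategy spaces $\mathcal A$ and $\mathcal A^N$ and cost functionals $\mathcal J^i$, as described in the context. Assume that for each $i=1,\dots,N$ and for $\phi^i\in\{h^i,g^i\}$: (1) for each $(l,a^{-i})\in\mathbb R^k\times\mathbb R^{(N-1)d}$, the function $\phi^i(l,\cdot,a^{-i})$ is lower semi-continuous and strictly convex; (2) for each $l\in\mathbb R^k$, the function $\phi^i(l,\cdot,\cdot)$ has decreasing differences in $(a^i,a^{-i})$, i.e. $\phi^i(l,\bar a^i,a^{-i})-\phi^i(l,a^i,a^{-i})\ge \phi^i(l,\bar a^i,\bar a^{-i})-\phi^i(l,a^i,\bar a^{-i})$ for all $a,\bar a\in\mathbb R^{Nd}$ with $\bar a\ge a$; (3) for each $(l,a^{-i})\in\mathbb R^k\times\mathbb R^{(N-1)d}$, the function $\phi^i(l,\cdot,a^{-i})$ is submodular, i.e. $\phi^i(l,\bar a^i,a^{-i})+\phi^i(l,a^i,a^{-i})\ge\phi^i(l,\bar a^i\wedge a^i,a^{-i})+\phi^i(l,\bar a^i\vee a^i,a^{-i})$ for all $a,\bar a\in\mathbb R^{Nd}$. Assume that there exist two constants $K,\kappa>0$ such that, for each $i=1,\dots,N$, $$\mathcal J^i(A^i,A^{-i})\ge\kappa\,\mathbb E[|A^i_T|]\quad\text{for all }\mathbf A\in\mathcal A^N\text{ with }\mathbb E[|A^i_T|]\ge K .$$ Suppose, moreover, that there exists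 a constant $M>0$ such that, for each $i=1,\dots,N$ and for all $\mathbf A\in\mathcal A^N$, there exists $r^i(\mathbf A)\in\mathcal A$ such that $\mathcal J^i(r^i(\mathbf A),A^{-i})\le M$. Then the set of Nash equilibria $F\subset\mathcal A^N$ is non-empty, and the partially ordered set $(F,\preccurlyeq^N)$ is a complete lattice.
   Context: Notation: for $x,y\in\mathbb R^m$, $xy$ is the scalar product, $|\cdot|$ the Euclidean norm, $x\le y$ means $x^\ell\le y^\ell$ for all components $\ell$, and $x\wedge y$, $x\vee y$ are the componentwise minimum and maximum. For $a=(a^1,\dots,a^N)\in\mathbb R^{Nd}$ with $a^i\in\mathbb R^d$, $a^{-i}:=(a^j)_{j\ne i}\in\mathbb R^{(N-1)d}$, and for $v\in\mathbb R^d$, $(v,a^{-i})$ is $a$ with its $i$-th block replaced by $v$. Setting: $(\Omega,\mathcal F,\mathbb P)$ is a complete probability space, $T\in(0,\infty)$, $N\ge2$ an integer, $k,d\in\mathbb N$. $L:\Omega\times[0,T]\to\mathbb R^k$ is a càdlàg process; $f=(f^1,\dots,f^N)$ where $f^i:\Omega\times[0,T]\to\mathbb R^d_+$ are continuous semimartingales with respect to $\bar{\mathbb F}^{f,L}_+$. Here $\bar{\mathbb F}^{f,L}_+$ is the right-continuous extension of the filtration generated by $f$ and $L$, augmented by the $\mathbb P$-null sets. For each $i=1,\dots,N$, $h^i,g^i:\mathbb R^k\times\mathbb R^{Nd}\to[0,\infty)$ are measurable. Admissible strategies: $\mathcal A$ is the set of $\bar{\mathbb F}^{f,L}_+$-adapted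 càdlàg processes $V:\Omega\times[0,T]\to\mathbb R^d$ with nondecreasing and nonnegative components; $\mathcal A^N$ is the $N$-fold Cartesian product of $\mathcal{A}$ (profile strategies $\mathbf A=(A^1,\dots,A^N)$, $A^{-i}:=(A^j)_{j\ne i}$). Costs: player $i$ chooses $A^i\in\mathcal A$ to minimize $$\mathcal J^i(A^i,A^{-i}):=\mathbb E\Big[\int_0^Th^i(L_t,\mathbf A_t)\,dt+g^i(L_T,\mathbf A_T)+\int_{[0,T]}f^i_t\,dA^i_t\Big],$$ where $\int_{[0,T]}f^i_t\,dA^i_t:=f^i_0A^i_0+\int_0^Tf^i_t\,dA^i_t$, the last integral being the (sum over components of the) Lebesgue–Stieltjes integral on $(0,T]$. Nash equilibrium: $\bar{\mathbf A}\in\mathcal A^N$ such that for every $i=1,\dots,N$, $\mathcal J^i(\bar{\mathbf A})<\infty$ and $\mathcal J^i(\bar A^i,\bar A^{-i})\le\mathcal J^i(V^i,\bar A^{-i})$ for every $V^i\in\mathcal A$. Order: for processes $V,U$ in $\mathcal{A}$, $V\preccurlyeq U$ iff $V_t\le U_t$ for all $t\in[0,T]$, $\mathbb P$-a.s.; for profiles, $\mathbf A\preccurlyeq^N\mathbf B$ iff $A^i\preccurlyeq B^i$ for all $i$. (Processes that agree for all $t$, $\mathbb{P}$-a.s., are identified.) A complete lattice is a partially ordered set in which every subset has a least upper bound and a greatest lower bound. *)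

theory Defs
  imports "HOL-Probability.Probability" "HOL-Algebra.Complete_Lattice"
begin

text \<open>
  Processes on \<open>\<Omega> \<times> [0,T]\<close> are functions \<open>real \<Rightarrow> 'w \<Rightarrow> _\<close> of which only
  the values at times in \<open>{0..T}\<close> and at points of \<open>space P\<close> matter. Players, and the coordinates
  of \<open>\<real>\<^sup>k\<close> and \<open>\<real>\<^sup>d\<close>, are indexed by the finite types \<open>'n\<close>, \<open>'k\<close>, \<open>'d\<close>. The order,
  \<open>inf\<close> and \<open>sup\<close> on vectors (and on vectors of vectors) are the componentwise ones.
\<close>

type_synonym ('w, 'd) proc = "real \<Rightarrow> 'w \<Rightarrow> real ^ 'd"
type_synonym ('w, 'd, 'n) profile = "'n \<Rightarrow> ('w, 'd) proc"


subsection \<open>Assumptions on the cost functions\<close>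

definition replace_block :: "('a ^ 'n) \<Rightarrow> 'n \<Rightarrow> 'a \<Rightarrow> 'a ^ ('n::finite)" where
  "replace_block a i v = (\<chi> j. if j = i then v else a $ j)"

definition lower_semicont :: "('a::topological_space \<Rightarrow> real) \<Rightarrow> bool" where
  "lower_semicont \<phi> \<longleftrightarrow> (\<forall>x. \<forall>c < \<phi> x. \<forall>\<^sub>F y in nhds x. c < \<phi> y)"

definition strictly_convex :: "('a::real_vector \<Rightarrow> real) \<Rightarrow> bool" where
  "strictly_convex \<phi> \<longleftrightarrow>
    (\<forall>x y u. x \<noteq> y \<longrightarrow> 0 < u \<longrightarrow> u < 1 \<longrightarrow>
      \<phi> ((1 - u) *\<^sub>R x + u *\<^sub>R y) < (1 - u) * \<phi> x + u * \<phi> y)"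

definition decreasing_differences ::
  "'n::finite \<Rightarrow> ((real ^ 'd::finite) ^ 'n \<Rightarrow> real) \<Rightarrow> bool" where
  "decreasing_differences i \<phi> \<longleftrightarrow>
    (\<forall>a b. a \<le> b \<longrightarrow>
      \<phi> (replace_block a i (b $ i)) - \<phi> a \<ge> \<phi> b - \<phi> (replace_block b i (a $ i)))"

definition submodular_in ::
  "'n::finite \<Rightarrow> ((real ^ 'd::finite) ^ 'n \<Rightarrow> real) \<Rightarrow> bool" where
  "submodular_in i \<phi> \<longleftrightarrow>
    (\<forall>a b. \<phi> (replace_block a i (b $ i)) + \<phi> a
         \<ge> \<phi> (replace_block a i (inf (b $ i) (a $ i)))
          + \<phi> (replace_block a i (sup (b $ i) (a $ i))))"


subsection \<open>Filtration and semimartingales\<close>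

definition cadlag_on :: "real \<Rightarrow> (real \<Rightarrow> 'a::topological_space) \<Rightarrow> bool" where
  "cadlag_on T x \<longleftrightarrow>
    (\<forall>t\<in>{0..<T}. (x \<longlongrightarrow> x t) (at_right t)) \<and>
    (\<forall>t\<in>{0<..T}. \<exists>l. (x \<longlongrightarrow> l) (at_left t))"

definition bounded_variation :: "real \<Rightarrow> (real \<Rightarrow> real) \<Rightarrow> bool" where
  "bounded_variation T x \<longleftrightarrow>
    (\<exists>C. \<forall>n s. mono s \<longrightarrow> range s \<subseteq> {0..T} \<longrightarrow>
      (\<Sum>j<(n::nat). \<bar>x (s (Suc j)) - x (s j)\<bar>) \<le> C)"

definition augmented_sets ::
  "'w measure \<Rightarrow> real \<Rightarrow> (real \<Rightarrow> 'w \<Rightarrow> 'a::topological_space) \<Rightarrow> real \<Rightarrow> 'w set set" where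
  "augmented_sets P T Z t = sigma_sets (space P)
    ({Z s -` B \<inter> space P | s B. 0 \<le> s \<and> s \<le> t \<and> s \<le> T \<and> B \<in> sets borel} \<union> null_sets P)"

text \<open>
  For \<open>t \<ge> T\<close> all the augmented sigma-algebras coincide, so the right-continuous extension is
  the usual one on \<open>[0,T)\<close> and leaves the sigma-algebra at time \<open>T\<close> unchanged.
\<close>

definition rc_filtration ::
  "'w measure \<Rightarrow> real \<Rightarrow> (real \<Rightarrow> 'w \<Rightarrow> 'a::topological_space) \<Rightarrow> real \<Rightarrow> 'w measure" where
  "rc_filtration P T Z t = sigma (space P) (\<Inter>u\<in>{t<..}. augmented_sets P T Z u)"

text \<open>The filtration generated by \<open>f\<close> and \<open>L\<close>: that of the joint process \<open>(L, f)\<close>.\<close>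

definition game_filtration ::
  "'w measure \<Rightarrow> real \<Rightarrow> ('w, 'k::finite) proc \<Rightarrow> ('w, 'd::finite, 'n::finite) profile \<Rightarrow>
   real \<Rightarrow> 'w measure" where
  "game_filtration P T L f = rc_filtration P T (\<lambda>t \<omega>. (L t \<omega>, \<chi> j. f j t \<omega>))"

definition adapted_on ::
  "real \<Rightarrow> (real \<Rightarrow> 'w measure) \<Rightarrow> (real \<Rightarrow> 'w \<Rightarrow> 'a::topological_space) \<Rightarrow> bool" where
  "adapted_on T F X \<longleftrightarrow> (\<forall>t\<in>{0..T}. X t \<in> borel_measurable (F t))"

definition martingale_on ::
  "'w measure \<Rightarrow> real \<Rightarrow> (real \<Rightarrow> 'w measure) \<Rightarrow> (real \<Rightarrow> 'w \<Rightarrow> real) \<Rightarrow> bool" where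
  "martingale_on P T F X \<longleftrightarrow>
    adapted_on T F X \<and>
    (\<forall>t\<in>{0..T}. integrable P (X t)) \<and>
    (\<forall>t\<in>{0..T}. \<forall>s\<in>{0..t}. AE \<omega> in P. real_cond_exp P (F s) (X t) \<omega> = X s \<omega>)"

definition continuous_local_martingale ::
  "'w measure \<Rightarrow> real \<Rightarrow> (real \<Rightarrow> 'w measure) \<Rightarrow> (real \<Rightarrow> 'w \<Rightarrow> real) \<Rightarrow> bool" where
  "continuous_local_martingale P T F X \<longleftrightarrow>
    adapted_on T F X \<and>
    (\<forall>\<omega>\<in>space P. continuous_on {0..T} (\<lambda>t. X t \<omega>)) \<and>
    (\<exists>\<tau>. (\<forall>n::nat. stopping_time F (\<tau> n)) \<and>
      (\<forall>n. \<forall>\<omega>\<in>space P. 0 \<le> \<tau> n \<omega> \<and> \<tau> n \<omega> \<le> \<tau> (Suc n) \<omega> \<and> \<tau> n \<omega> \<le> T) \<and>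
      (AE \<omega> in P. \<exists>n. \<tau> n \<omega> = T) \<and>
      (\<forall>n. martingale_on P T F (\<lambda>t \<omega>. X (min t (\<tau> n \<omega>)) \<omega> - X 0 \<omega>)))"

definition continuous_semimartingale ::
  "'w measure \<Rightarrow> real \<Rightarrow> (real \<Rightarrow> 'w measure) \<Rightarrow> (real \<Rightarrow> 'w \<Rightarrow> real) \<Rightarrow> bool" where
  "continuous_semimartingale P T F X \<longleftrightarrow>
    adapted_on T F X \<and>
    (\<forall>\<omega>\<in>space P. continuous_on {0..T} (\<lambda>t. X t \<omega>)) \<and>
    (\<exists>Y B. continuous_local_martingale P T F Y \<and>
      adapted_on T F B \<and>
      (\<forall>\<omega>\<in>space P. continuous_on {0..T} (\<lambda>t. B t \<omega>) \<and> bounded_variation T (\<lambda>t. B t \<omega>)) \<and>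
      (AE \<omega> in P. \<forall>t\<in>{0..T}. X t \<omega> = Y t \<omega> + B t \<omega>))"


subsection \<open>The game\<close>

definition admissible ::
  "'w measure \<Rightarrow> real \<Rightarrow> (real \<Rightarrow> 'w measure) \<Rightarrow> ('w, 'd::finite) proc set" where
  "admissible P T F = {V. adapted_on T F V \<and>
    (\<forall>\<omega>\<in>space P. cadlag_on T (\<lambda>t. V t \<omega>) \<and> mono_on {0..T} (\<lambda>t. V t \<omega>) \<and>
      (\<forall>t\<in>{0..T}. 0 \<le> V t \<omega>))}"

definition admissible_profiles ::
  "'w measure \<Rightarrow> real \<Rightarrow> (real \<Rightarrow> 'w measure) \<Rightarrow> ('w, 'd::finite, 'n::finite) profile set" where
  "admissible_profiles P T F = {A. \<forall>i. A i \<in> admissible P T F}"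

text \<open>
  The integral over \<open>[0,T]\<close> of a path \<open>x \<ge> 0\<close> against a nondecreasing right-continuous path \<open>v \<ge> 0\<close>,
  including the initial jump term \<open>x 0 \<bullet> v 0\<close>. The integrator is frozen outside \<open>[0,T]\<close>, because
  \<^const>\<open>interval_measure\<close> expects a nondecreasing right-continuous function on all reals.
\<close>

definition stieltjes :: "real \<Rightarrow> (real \<Rightarrow> real ^ 'd::finite) \<Rightarrow> (real \<Rightarrow> real ^ 'd) \<Rightarrow> ennreal" where
  "stieltjes T x v = ennreal (x 0 \<bullet> v 0) +
    (\<Sum>l\<in>UNIV. \<integral>\<^sup>+t\<in>{0<..T}. ennreal (x t $ l) \<partial>interval_measure (\<lambda>t. v (max 0 (min t T)) $ l))"

definition cost ::
  "'w measure \<Rightarrow> real \<Rightarrow> ('w, 'k::finite) proc \<Rightarrow> ('w, 'd::finite, 'n::finite) profile \<Rightarrow>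
   ('n \<Rightarrow> real ^ 'k \<Rightarrow> (real ^ 'd) ^ 'n \<Rightarrow> real) \<Rightarrow>
   ('n \<Rightarrow> real ^ 'k \<Rightarrow> (real ^ 'd) ^ 'n \<Rightarrow> real) \<Rightarrow>
   'n \<Rightarrow> ('w, 'd, 'n) profile \<Rightarrow> ennreal" where
  "cost P T L f h g i A =
    (\<integral>\<^sup>+\<omega>. (\<integral>\<^sup>+t\<in>{0..T}. ennreal (h i (L t \<omega>) (\<chi> j. A j t \<omega>)) \<partial>lborel)
        + ennreal (g i (L T \<omega>) (\<chi> j. A j T \<omega>))
        + stieltjes T (\<lambda>t. f i t \<omega>) (\<lambda>t. A i t \<omega>) \<partial>P)"

definition nash_equilibria ::
  "'w measure \<Rightarrow> real \<Rightarrow> ('w, 'k::finite) proc \<Rightarrow> ('w, 'd::finite, 'n::finite) profile \<Rightarrow>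
   ('n \<Rightarrow> real ^ 'k \<Rightarrow> (real ^ 'd) ^ 'n \<Rightarrow> real) \<Rightarrow>
   ('n \<Rightarrow> real ^ 'k \<Rightarrow> (real ^ 'd) ^ 'n \<Rightarrow> real) \<Rightarrow> ('w, 'd, 'n) profile set" where
  "nash_equilibria P T L f h g =
    {A \<in> admissible_profiles P T (game_filtration P T L f).
      \<forall>i. cost P T L f h g i A < \<infinity> \<and>
        (\<forall>V \<in> admissible P T (game_filtration P T L f).
          cost P T L f h g i A \<le> cost P T L f h g i (A(i := V)))}"


subsection \<open>The order on profiles\<close>

definition proc_le :: "'w measure \<Rightarrow> real \<Rightarrow> ('w, 'd::finite) proc \<Rightarrow> ('w, 'd) proc \<Rightarrow> bool" where
  "proc_le P T V U \<longleftrightarrow> (AE \<omega> in P. \<forall>t\<in>{0..T}. V t \<omega> \<le> U t \<omega>)"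

definition profile_le ::
  "'w measure \<Rightarrow> real \<Rightarrow> ('w, 'd::finite, 'n::finite) profile \<Rightarrow> ('w, 'd, 'n) profile \<Rightarrow> bool" where
  "profile_le P T A B \<longleftrightarrow> (\<forall>i. proc_le P T (A i) (B i))"

definition indistinguishable ::
  "'w measure \<Rightarrow> real \<Rightarrow> (real \<Rightarrow> 'w measure) \<Rightarrow>
   (('w, 'd::finite, 'n::finite) profile \<times> ('w, 'd, 'n) profile) set" where
  "indistinguishable P T F =
    {(A, B). A \<in> admissible_profiles P T F \<and> B \<in> admissible_profiles P T F \<and>
      (\<forall>i. AE \<omega> in P. \<forall>t\<in>{0..T}. A i t \<omega> = B i t \<omega>)}"

text \<open>
  A set \<open>S\<close> of profiles modulo indistinguishability, with the order induced on classes (which does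
  not depend on the representatives).
\<close>

definition profile_order ::
  "'w measure \<Rightarrow> real \<Rightarrow> (real \<Rightarrow> 'w measure) \<Rightarrow> ('w, 'd::finite, 'n::finite) profile set \<Rightarrow>
   ('w, 'd, 'n) profile set gorder" where
  "profile_order P T F S =
    \<lparr> carrier = S // indistinguishable P T F,
      eq = (=),
      le = (\<lambda>X Y. \<exists>A\<in>X. \<exists>B\<in>Y. profile_le P T A B) \<rparr>"

end

theory Submission
  imports Defs
begin

text \<open>
  Nash equilibria are the fixed points of the map that sends a profile to the profile of best replies,
  and the theorem is Tarski's fixed point theorem for this map. The work lies in showing that
  best replies exist, are unique and increase with the opponents' strategies, and in finding a
  replacement for the top element that the space of strategies does not have.

  One pointwise inequality drives the argument. If the opponents play \<open>A\<close> or the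
  larger \<open>B\<close>, then for two strategies \<open>V\<close>, \<open>U\<close> the cost of \<open>V \<or> U\<close> against \<open>B\<close> plus the cost of
  \<open>V \<and> U\<close> against \<open>A\<close> is at most the cost of \<open>U\<close> against \<open>B\<close> plus the cost of \<open>V\<close> against \<open>A\<close>
  (\<open>J_cross_submodular\<close>). It combines decreasing differences and submodularity; the control cost
  is additive in the control and so contributes equally to both sides.

  Existence of best replies (\<open>best_reply_exists\<close>) follows without weak compactness. For
  \<open>A = B\<close> the inequality shows that the infimum of two almost optimal strategies is almost
  optimal. So the infima of the tails of a fast minimizing sequence have almost minimal cost, and
  they increase to a limit, which coercivity keeps finite. Since all limits are monotone, they
  exist pathwise, up to a right-continuous modification at countably many times, and
  the cost is lower semicontinuous along them (\<open>J_lower_semicontinuous\<close>). Uniqueness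
  (\<open>best_reply_unique\<close>) is strict convexity, and then the inequality shows that the reply map
  is increasing (\<open>reply_mono\<close>).

  Nonempty sets of strategies have greatest lower bounds, given by essential infima
  (\<open>admissible_glb\<close>). The profiles below their own replies are closed under binary suprema, and
  their expected total controls are bounded by a common constant, so together they have an upper
  bound (\<open>improvable_upper_bound\<close>). This is all that Tarski's argument needs
  (\<open>fixed_points_have_lubs\<close>); suprema of sets of fixed points give the complete lattice after
  passing to classes of indistinguishable profiles.
\<close>

section \<open>Fixed points of monotone maps on preordered sets\<close>

definition lub_in :: "('a \<Rightarrow> 'a \<Rightarrow> bool) \<Rightarrow> 'a set \<Rightarrow> 'a set \<Rightarrow> 'a \<Rightarrow> bool" where
  "lub_in leq S B x \<longleftrightarrow> x \<in> S \<and> (\<forall>b\<in>B. leq b x) \<and> (\<forall>y\<in>S. (\<forall>b\<in>B. leq b y) \<longrightarrow> leq x y)"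

text \<open>
  Tarski's argument on a preorder without greatest element: the bound \<open>u\<close> on the
  elements with \<open>leq x (R x)\<close> takes the place of the top. Such elements then
  have a least upper bound \<open>p\<close>, which is the greatest fixed point. As every fixed
  point lies below \<open>p\<close>, the elements above \<open>S\<close> that \<open>R\<close>
  does not increase form a nonempty set, and their greatest lower bound is the least fixed
  point above \<open>S\<close>.
\<close>

lemma fixed_points_have_lubs:
  fixes leq :: "'a \<Rightarrow> 'a \<Rightarrow> bool"
  assumes refl: "\<And>x. leq x x" and trans: "\<And>x y z. leq x y \<Longrightarrow> leq y z \<Longrightarrow> leq x z"
    and R_in: "\<And>x. x \<in> X \<Longrightarrow> R x \<in> X"
    and R_mono: "\<And>x y. x \<in> X \<Longrightarrow> y \<in> X \<Longrightarrow> leq x y \<Longrightarrow> leq (R x) (R y)"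
    and glb: "\<And>B. B \<subseteq> X \<Longrightarrow> B \<noteq> {} \<Longrightarrow>
      \<exists>m\<in>X. (\<forall>b\<in>B. leq m b) \<and> (\<forall>y\<in>X. (\<forall>b\<in>B. leq y b) \<longrightarrow> leq y m)"
    and u: "u \<in> X" "\<And>x. x \<in> X \<Longrightarrow> leq x (R x) \<Longrightarrow> leq x u"
    and S: "S \<subseteq> {x\<in>X. leq x (R x) \<and> leq (R x) x}"
  shows "\<exists>x. lub_in leq {x\<in>X. leq x (R x) \<and> leq (R x) x} S x"
proof -
  define U where "U = {y\<in>X. \<forall>x\<in>X. leq x (R x) \<longrightarrow> leq x y}"
  have "U \<subseteq> X" "U \<noteq> {}" using u by (auto simp: U_def)
  from glb[OF this] obtain p where p: "p \<in> X" "\<And>b. b \<in> U \<Longrightarrow> leq p b"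
      "\<And>y. y \<in> X \<Longrightarrow> (\<And>b. b \<in> U \<Longrightarrow> leq y b) \<Longrightarrow> leq y p"
    by metis
  have p_ub: "leq x p" if "x \<in> X" "leq x (R x)" for x
    using that by (intro p(3)) (auto simp: U_def)
  have "leq x (R p)" if "x \<in> X" "leq x (R x)" for x
    using trans[OF that(2) R_mono[OF that(1) p(1) p_ub[OF that]]] .
  hence "R p \<in> U" using R_in[OF p(1)] unfolding U_def by blast
  hence p_post: "leq p (R p)" using p(2) by blast
  hence "leq (R p) p" using p_ub[OF R_in[OF p(1)] R_mono[OF p(1) R_in[OF p(1)]]] by blast
  define D where "D = {x\<in>X. (\<forall>s\<in>S. leq s x) \<and> leq (R x) x}"
  have "D \<subseteq> X" "p \<in> D" using \<open>leq (R p) p\<close> p_ub p(1) S by (auto simp: D_def)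
  hence "D \<noteq> {}" by blast
  from glb[OF \<open>D \<subseteq> X\<close> this] obtain m where m: "m \<in> X" "\<And>b. b \<in> D \<Longrightarrow> leq m b"
      "\<And>y. y \<in> X \<Longrightarrow> (\<And>b. b \<in> D \<Longrightarrow> leq y b) \<Longrightarrow> leq y m"
    by metis
  have m_ub: "leq s m" if "s \<in> S" for s
    using that S by (intro m(3)) (auto simp: D_def)
  have pre: "leq (R m) m"
  proof (rule m(3))
    show "R m \<in> X" using m(1) R_in by blast
    fix b assume "b \<in> D"
    hence "leq (R m) (R b)" "leq (R b) b" using m R_mono by (auto simp: D_def)
    thus "leq (R m) b" by (rule trans)
  qed
  have "R m \<in> D"
    unfolding D_def
  proof (safe)
    show "R m \<in> X" using m(1) R_in by blast
    show "leq (R (R m)) (R m)" using R_mono R_in m(1) pre by blast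
    fix s assume "s \<in> S"
    hence "leq s (R s)" "leq (R s) (R m)" using S m_ub m(1) R_mono by auto
    thus "leq s (R m)" by (rule trans)
  qed
  hence "leq m (R m)" by (rule m(2))
  hence "lub_in leq {x\<in>X. leq x (R x) \<and> leq (R x) x} S m"
    using pre m(1) m_ub m(2) by (auto simp: lub_in_def D_def)
  thus ?thesis by blast
qed

text \<open>
  Passing to classes makes the preorder antisymmetric, and least upper bounds of
  representatives are representatives of least upper bounds. Suprema suffice: an infimum is
  the supremum of the lower bounds.
\<close>

lemma quotient_complete_lattice:
  fixes leq :: "'a \<Rightarrow> 'a \<Rightarrow> bool"
  assumes refl: "\<And>x. leq x x" and trans: "\<And>x y z. leq x y \<Longrightarrow> leq y z \<Longrightarrow> leq x z"
    and r: "r = {(a, b). a \<in> X \<and> b \<in> X \<and> leq a b \<and> leq b a}" and S: "S \<subseteq> X"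
    and lub: "\<And>B. B \<subseteq> S \<Longrightarrow> \<exists>x. lub_in leq S B x"
  shows "complete_lattice
    \<lparr> carrier = S // r, eq = (=), le = (\<lambda>Y Z. \<exists>a\<in>Y. \<exists>b\<in>Z. leq a b) \<rparr>" (is "complete_lattice ?Q")
proof -
  define cl where "cl a = r `` {a}" for a
  have carrier: "carrier ?Q = cl ` S" by (auto simp: quotient_def cl_def)
  have self: "a \<in> cl a" if "a \<in> S" for a using that S refl by (auto simp: cl_def r)
  have cl_le: "(cl a \<sqsubseteq>\<^bsub>?Q\<^esub> cl b) = leq a b" if "a \<in> S" "b \<in> S" for a b
  proof
    assume "cl a \<sqsubseteq>\<^bsub>?Q\<^esub> cl b"
    then obtain a' b' where "leq a a'" "leq a' b'" "leq b' b" by (auto simp: cl_def r)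
    thus "leq a b" by (meson trans)
  next
    assume "leq a b" thus "cl a \<sqsubseteq>\<^bsub>?Q\<^esub> cl b" using self that by auto
  qed
  have cl_eq: "cl a = cl b" if "a \<in> S" "b \<in> S" "leq a b" "leq b a" for a b
  proof -
    have "(leq a c \<and> leq c a) = (leq b c \<and> leq c b)" for c
      using that(3,4) trans[of a b c] trans[of b a c] trans[of c a b] trans[of c b a] by blast
    thus ?thesis using that(1,2) S unfolding cl_def r by auto
  qed
  interpret Q: partial_order ?Q
  proof
    fix x assume "x \<in> carrier ?Q"
    then obtain a where "a \<in> S" "x = cl a" unfolding carrier by blast
    thus "x \<sqsubseteq>\<^bsub>?Q\<^esub> x" using cl_le[of a a] refl by blast
  next
    fix x y assume "x \<sqsubseteq>\<^bsub>?Q\<^esub> y" "y \<sqsubseteq>\<^bsub>?Q\<^esub> x" "x \<in> carrier ?Q" "y \<in> carrier ?Q"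
    moreover from this obtain a b where ab: "a \<in> S" "x = cl a" "b \<in> S" "y = cl b"
      unfolding carrier by blast
    ultimately have "leq a b" "leq b a" using cl_le[of a b] cl_le[of b a] by blast+
    hence "x = y" unfolding ab(2,4) by (rule cl_eq[OF ab(1,3)])
    thus "x .=\<^bsub>?Q\<^esub> y" by simp
  next
    fix x y z assume xyz: "x \<sqsubseteq>\<^bsub>?Q\<^esub> y" "y \<sqsubseteq>\<^bsub>?Q\<^esub> z"
      and "x \<in> carrier ?Q" "y \<in> carrier ?Q" "z \<in> carrier ?Q"
    then obtain a b c where abc: "a \<in> S" "x = cl a" "b \<in> S" "y = cl b" "c \<in> S" "z = cl c"
      unfolding carrier by blast
    have "leq a b" "leq b c" using xyz cl_le abc by blast+
    hence "leq a c" by (rule trans)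
    thus "x \<sqsubseteq>\<^bsub>?Q\<^esub> z" using cl_le abc by blast
  qed auto
  have sup_exists: "\<exists>s. least ?Q s (Upper ?Q A)" if A: "A \<subseteq> carrier ?Q" for A
  proof -
    define B where "B = {a\<in>S. cl a \<in> A}"
    have AB: "A = cl ` B" using A unfolding carrier B_def by auto
    obtain x where x: "lub_in leq S B x" using lub[of B] by (auto simp: B_def)
    have "x \<in> S" using x by (auto simp: lub_in_def)
    have "cl x \<in> Upper ?Q A"
    proof -
      have "cl b \<sqsubseteq>\<^bsub>?Q\<^esub> cl x" if "b \<in> B" for b
        using that x \<open>x \<in> S\<close> cl_le[of b x] by (auto simp: lub_in_def B_def)
      thus ?thesis using \<open>x \<in> S\<close> unfolding Upper_def carrier AB by auto
    qed
    moreover have "cl x \<sqsubseteq>\<^bsub>?Q\<^esub> v" if v: "v \<in> Upper ?Q A" for v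
    proof -
      from v obtain y where y: "y \<in> S" "v = cl y" unfolding Upper_def carrier by blast
      have "leq b y" if b: "b \<in> B" for b
      proof -
        have "cl b \<in> A \<inter> carrier ?Q" using b unfolding carrier B_def by blast
        hence "cl b \<sqsubseteq>\<^bsub>?Q\<^esub> cl y" using v unfolding Upper_def y(2) by blast
        thus ?thesis using cl_le[of b y] b y(1) unfolding B_def by blast
      qed
      hence "leq x y" using x y(1) unfolding lub_in_def by blast
      thus ?thesis using cl_le[OF \<open>x \<in> S\<close> y(1)] unfolding y(2) by blast
    qed
    moreover have "Upper ?Q A \<subseteq> carrier ?Q" by (auto simp: Upper_def)
    ultimately show ?thesis unfolding least_def by blast
  qed
  have inf_exists: "\<exists>i. greatest ?Q i (Lower ?Q A)" if A: "A \<subseteq> carrier ?Q" for A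
  proof -
    have LQ: "Lower ?Q A \<subseteq> carrier ?Q" by (auto simp: Lower_def)
    from sup_exists[OF this] obtain s where s: "least ?Q s (Upper ?Q (Lower ?Q A))" by blast
    have sc: "s \<in> carrier ?Q" using s by (auto simp: least_def Upper_def)
    have "s \<sqsubseteq>\<^bsub>?Q\<^esub> a" if "a \<in> A" for a
    proof -
      have "a \<in> Upper ?Q (Lower ?Q A)" using that A by (auto simp: Upper_def Lower_def)
      thus ?thesis using s unfolding least_def by blast
    qed
    hence "s \<in> Lower ?Q A" using sc unfolding Lower_def by blast
    moreover have "x \<sqsubseteq>\<^bsub>?Q\<^esub> s" if "x \<in> Lower ?Q A" for x
      using s that LQ unfolding least_def Upper_def by blast
    ultimately show ?thesis using LQ unfolding greatest_def by blast
  qed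
  show ?thesis by (rule Q.complete_latticeI[OF sup_exists inf_exists])
qed

section \<open>Essential suprema\<close>

lemma nn_integral_eq_imp_AE_eq:
  assumes [measurable]: "u \<in> borel_measurable M" "v \<in> borel_measurable M"
    and AE_le: "AE x in M. u x \<le> v x"
    and int: "(\<integral>\<^sup>+x. v x \<partial>M) \<le> (\<integral>\<^sup>+x. u x \<partial>M)" "(\<integral>\<^sup>+x. u x \<partial>M) < \<infinity>"
  shows "AE x in M. u x = v x"
proof -
  have "(\<integral>\<^sup>+x. v x - u x \<partial>M) = (\<integral>\<^sup>+x. v x \<partial>M) - (\<integral>\<^sup>+x. u x \<partial>M)"
    using int(2) AE_le by (intro nn_integral_diff) auto
  also have "\<dots> = 0" using int by (simp add: diff_eq_0_iff_ennreal)
  finally have "AE x in M. v x - u x = 0" by (subst (asm) nn_integral_0_iff_AE) auto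
  thus ?thesis using AE_le by eventually_elim (auto dest: ennreal_minus_eq_0)
qed

text \<open>
  Among the countable subfamilies, take one for which the integral of the supremum is largest;
  it exists because a union of countably many countable subfamilies is countable. Adding a
  further member \<open>u\<close> cannot enlarge this integral, so \<open>u\<close> lies
  almost surely below the supremum. Passing to \<open>arctan\<close> makes all integrals
  finite. The supremum of a real family may be infinite, so the conclusion speaks of upper
  bounds \<open>b\<close> instead.
\<close>

lemma essential_upper_bound_single:
  fixes F :: "'b \<Rightarrow> 'w \<Rightarrow> real"
  assumes "finite_measure P" and meas: "\<And>s. s \<in> S \<Longrightarrow> F s \<in> borel_measurable P"
  shows "\<exists>C. countable C \<and> C \<subseteq> S \<and>
    (\<forall>u\<in>S. AE \<omega> in P. \<forall>b. (\<forall>c\<in>C. F c \<omega> \<le> b) \<longrightarrow> F u \<omega> \<le> b)"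
proof -
  interpret finite_measure P by fact
  define G where "G c \<omega> = ennreal (arctan (F c \<omega>) + pi / 2)" for c \<omega>
  have G_meas: "G s \<in> borel_measurable P" if "s \<in> S" for s
    using meas[OF that] unfolding G_def by measurable
  have G_le: "G c \<omega> \<le> ennreal pi" for c \<omega>
    unfolding G_def using arctan_ubound[of "F c \<omega>"] by (intro ennreal_leI) linarith
  define e where "e C = (\<integral>\<^sup>+\<omega>. (SUP c\<in>C. G c \<omega>) \<partial>P)" for C
  define \<C> where "\<C> = {C. countable C \<and> C \<subseteq> S}"
  have "{} \<in> \<C>" by (auto simp: \<C>_def)
  then obtain a where a: "range a \<subseteq> e ` \<C>" "(SUP C\<in>\<C>. e C) = (SUP n::nat. a n)"
    using ennreal_SUP_countable_SUP[of \<C> e] by auto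
  have "\<forall>n. \<exists>C\<in>\<C>. a n = e C" using a(1) by blast
  then obtain Cs where Cs: "\<And>n. Cs n \<in> \<C>" "\<And>n. a n = e (Cs n)" by metis
  define C where "C = (\<Union>n. Cs n)"
  have C: "countable C" "C \<subseteq> S" using Cs(1) by (auto simp: \<C>_def C_def)
  have "e (Cs n) \<le> e C" for n
    unfolding e_def C_def by (intro nn_integral_mono SUP_subset_mono) auto
  hence sup_le: "(SUP C\<in>\<C>. e C) \<le> e C" unfolding a(2) Cs(2) by (intro SUP_least)
  have fin: "e C < \<infinity>"
  proof -
    have "e C \<le> (\<integral>\<^sup>+\<omega>. ennreal pi \<partial>P)"
      unfolding e_def by (intro nn_integral_mono SUP_least G_le)
    also have "\<dots> < \<infinity>"
      by (simp add: ennreal_mult_less_top emeasure_eq_measure)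
    finally show ?thesis .
  qed
  have "AE \<omega> in P. \<forall>b. (\<forall>c\<in>C. F c \<omega> \<le> b) \<longrightarrow> F u \<omega> \<le> b" if u: "u \<in> S" for u
  proof -
    have iC: "insert u C \<in> \<C>" using C u by (auto simp: \<C>_def)
    have "AE \<omega> in P. (SUP c\<in>C. G c \<omega>) = (SUP c\<in>insert u C. G c \<omega>)"
    proof (rule nn_integral_eq_imp_AE_eq)
      show "(\<lambda>\<omega>. SUP c\<in>C. G c \<omega>) \<in> borel_measurable P"
        using C G_meas by (intro borel_measurable_SUP) auto
      show "(\<lambda>\<omega>. SUP c\<in>insert u C. G c \<omega>) \<in> borel_measurable P"
        using C u G_meas by (intro borel_measurable_SUP) auto
      show "AE \<omega> in P. (SUP c\<in>C. G c \<omega>) \<le> (SUP c\<in>insert u C. G c \<omega>)"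
        by (intro AE_I2 SUP_subset_mono) auto
      have "e (insert u C) \<le> e C" using SUP_upper[OF iC, of e] sup_le by (rule order_trans)
      thus "(\<integral>\<^sup>+\<omega>. (SUP c\<in>insert u C. G c \<omega>) \<partial>P) \<le> (\<integral>\<^sup>+\<omega>. (SUP c\<in>C. G c \<omega>) \<partial>P)"
        unfolding e_def .
      show "(\<integral>\<^sup>+\<omega>. (SUP c\<in>C. G c \<omega>) \<partial>P) < \<infinity>" using fin unfolding e_def .
    qed
    thus ?thesis
    proof eventually_elim
      case (elim \<omega>)
      show ?case
      proof (intro allI impI)
        fix b assume b: "\<forall>c\<in>C. F c \<omega> \<le> b"
        have "G u \<omega> \<le> (SUP c\<in>C. G c \<omega>)" unfolding elim by (rule SUP_upper) simp
        also have "\<dots> \<le> ennreal (arctan b + pi / 2)"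
          using b by (intro SUP_least) (auto simp: G_def arctan_le_iff intro!: ennreal_leI)
        finally have "arctan (F u \<omega>) \<le> arctan b"
          using arctan_lbound[of "F u \<omega>"] arctan_lbound[of b] unfolding G_def
          by (subst (asm) ennreal_le_iff) auto
        thus "F u \<omega> \<le> b" by (simp add: arctan_le_iff)
      qed
    qed
  qed
  thus ?thesis using C by (intro exI[of _ C]) simp
qed

lemma essential_upper_bound:
  fixes F :: "'i \<Rightarrow> 'b \<Rightarrow> 'w \<Rightarrow> real"
  assumes "finite_measure P" and "countable I" and "S \<noteq> {}"
    and meas: "\<And>i s. i \<in> I \<Longrightarrow> s \<in> S \<Longrightarrow> F i s \<in> borel_measurable P"
  shows "\<exists>V::nat \<Rightarrow> 'b. range V \<subseteq> S \<and>
    (\<forall>u\<in>S. AE \<omega> in P. \<forall>i\<in>I. \<forall>b. (\<forall>n. F i (V n) \<omega> \<le> b) \<longrightarrow> F i u \<omega> \<le> b)"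
proof -
  have "\<forall>i\<in>I. \<exists>C. countable C \<and> C \<subseteq> S \<and>
      (\<forall>u\<in>S. AE \<omega> in P. \<forall>b. (\<forall>c\<in>C. F i c \<omega> \<le> b) \<longrightarrow> F i u \<omega> \<le> b)"
  proof
    fix i assume "i \<in> I"
    thus "\<exists>C. countable C \<and> C \<subseteq> S \<and>
        (\<forall>u\<in>S. AE \<omega> in P. \<forall>b. (\<forall>c\<in>C. F i c \<omega> \<le> b) \<longrightarrow> F i u \<omega> \<le> b)"
      by (intro essential_upper_bound_single[OF assms(1)] meas)
  qed
  from bchoice[OF this] obtain C where "\<forall>i\<in>I. countable (C i) \<and> C i \<subseteq> S \<and>
      (\<forall>u\<in>S. AE \<omega> in P. \<forall>b. (\<forall>c\<in>C i. F i c \<omega> \<le> b) \<longrightarrow> F i u \<omega> \<le> b)" ..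
  hence C: "\<And>i. i \<in> I \<Longrightarrow> countable (C i)" "\<And>i. i \<in> I \<Longrightarrow> C i \<subseteq> S"
    "\<And>i u. i \<in> I \<Longrightarrow> u \<in> S \<Longrightarrow>
      AE \<omega> in P. \<forall>b. (\<forall>c\<in>C i. F i c \<omega> \<le> b) \<longrightarrow> F i u \<omega> \<le> b" by simp_all
  obtain s where s: "s \<in> S" using \<open>S \<noteq> {}\<close> by blast
  define D where "D = insert s (\<Union>i\<in>I. C i)"
  have D: "countable D" "D \<noteq> {}" "D \<subseteq> S" using C(1,2) \<open>countable I\<close> s by (auto simp: D_def)
  define V where "V = from_nat_into D"
  have rV: "range V = D" unfolding V_def using D by (simp add: range_from_nat_into)
  have "AE \<omega> in P. \<forall>i\<in>I. \<forall>b. (\<forall>n. F i (V n) \<omega> \<le> b) \<longrightarrow> F i u \<omega> \<le> b" if u: "u \<in> S" for u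
  proof -
    have "AE \<omega> in P. \<forall>i\<in>I. \<forall>b. (\<forall>c\<in>C i. F i c \<omega> \<le> b) \<longrightarrow> F i u \<omega> \<le> b"
      using C(3) u \<open>countable I\<close> by (simp add: AE_ball_countable)
    thus ?thesis
    proof eventually_elim
      case (elim \<omega>)
      show ?case
      proof (intro ballI allI impI)
        fix i b assume i: "i \<in> I" and b: "\<forall>n. F i (V n) \<omega> \<le> b"
        have "F i c \<omega> \<le> b" if "c \<in> C i" for c
        proof -
          have "c \<in> range V" using that i unfolding rV D_def by blast
          thus ?thesis using b by blast
        qed
        thus "F i u \<omega> \<le> b" using elim i by blast
      qed
    qed
  qed
  thus ?thesis using rV D(3) by (intro exI[of _ V]) simp
qed

section \<open>Stieltjes integrals of continuous functions\<close>

text \<open>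
  These are the nonnegative increasing cadlag paths, since left limits exist for every
  increasing path.
\<close>

definition rc_increasing :: "real \<Rightarrow> (real \<Rightarrow> real) \<Rightarrow> bool" where
  "rc_increasing T v \<longleftrightarrow> mono_on {0..T} v \<and> (\<forall>t\<in>{0..<T}. (v \<longlongrightarrow> v t) (at_right t)) \<and> 0 \<le> v 0"

text \<open>
  One coordinate of the control cost as a real number. Nothing is lost by
  \<open>enn2real\<close>: for a continuous integrand the integral is finite.
\<close>

definition stieltjes1 :: "real \<Rightarrow> (real \<Rightarrow> real) \<Rightarrow> (real \<Rightarrow> real) \<Rightarrow> real" where
  "stieltjes1 T x v = x 0 * v 0 +
    enn2real (\<integral>\<^sup>+t\<in>{0<..T}. ennreal (x t) \<partial>interval_measure (\<lambda>t. v (max 0 (min t T))))"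

text \<open>
  The first point need not be \<open>0\<close>: the cell \<open>[0, s 0]\<close> carries the
  mass \<open>v (s 0)\<close>, including the initial jump. This leaves the freedom to keep
  all points but the last outside a given countable set, which may contain \<open>0\<close>.
\<close>

definition partition_of :: "real \<Rightarrow> real \<Rightarrow> (nat \<Rightarrow> real) \<Rightarrow> nat \<Rightarrow> bool" where
  "partition_of T \<delta> s n \<longleftrightarrow> 0 \<le> s 0 \<and> s 0 < \<delta> \<and> s n = T \<and>
    (\<forall>j<n. s j \<le> s (Suc j) \<and> s (Suc j) - s j < \<delta>)"

definition riemann_sum :: "(nat \<Rightarrow> real) \<Rightarrow> nat \<Rightarrow> (real \<Rightarrow> real) \<Rightarrow> (real \<Rightarrow> real) \<Rightarrow> real" where
  "riemann_sum s n x v = x (s 0) * v (s 0) + (\<Sum>j<n. x (s (Suc j)) * (v (s (Suc j)) - v (s j)))"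

lemma rc_increasingD:
  assumes "rc_increasing T v"
  shows "\<And>s t. 0 \<le> s \<Longrightarrow> s \<le> t \<Longrightarrow> t \<le> T \<Longrightarrow> v s \<le> v t"
    and "\<And>t. 0 \<le> t \<Longrightarrow> t \<le> T \<Longrightarrow> 0 \<le> v t"
    and "\<And>t. 0 \<le> t \<Longrightarrow> t < T \<Longrightarrow> (v \<longlongrightarrow> v t) (at_right t)"
proof -
  show 1: "\<And>s t. 0 \<le> s \<Longrightarrow> s \<le> t \<Longrightarrow> t \<le> T \<Longrightarrow> v s \<le> v t"
    using assms by (auto simp: rc_increasing_def mono_on_def)
  show "0 \<le> v t" if "0 \<le> t" "t \<le> T" for t
    using 1[of 0 t] that assms by (auto simp: rc_increasing_def)
  show "\<And>t. 0 \<le> t \<Longrightarrow> t < T \<Longrightarrow> (v \<longlongrightarrow> v t) (at_right t)"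
    using assms by (auto simp: rc_increasing_def)
qed

lemma partition_of_mono:
  assumes "partition_of T \<delta> s n" and "i \<le> j" and "j \<le> n"
  shows "s i \<le> s j"
  using assms(2,3)
proof (induction j rule: dec_induct)
  case (step k)
  hence "s k \<le> s (Suc k)" using assms(1) by (simp add: partition_of_def)
  thus ?case using step by simp
qed simp

lemma partition_of_in:
  assumes "partition_of T \<delta> s n" and "j \<le> n"
  shows "0 \<le> s j" "s j \<le> T"
  using partition_of_mono[OF assms(1), of 0 j] partition_of_mono[OF assms(1), of j n] assms
  by (auto simp: partition_of_def)

text \<open>
  One point of \<open>D\<close> is taken in the interior of each of \<open>N\<close> equal
  cells, so that neighbours are at most two cell lengths apart.
\<close>

lemma exists_partition:
  fixes D :: "real set"
  assumes "T > 0" and "\<delta> > 0" and dense: "\<And>a b. 0 \<le> a \<Longrightarrow> a < b \<Longrightarrow> b \<le> T \<Longrightarrow> \<exists>r\<in>D. a < r \<and> r < b"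
  shows "\<exists>s n. partition_of T \<delta> s n \<and> (\<forall>j<n. s j \<in> D)"
proof -
  obtain N :: nat where N: "2 * T / \<delta> < real N" using reals_Archimedean2 by blast
  have "N > 0" using N \<open>T > 0\<close> \<open>\<delta> > 0\<close> by (cases N) (auto simp: field_simps)
  define m where "m = T / real N"
  have m: "m > 0" "2 * m < \<delta>" "real N * m = T"
    using N \<open>N > 0\<close> \<open>T > 0\<close> \<open>\<delta> > 0\<close> by (auto simp: m_def field_simps)
  have "\<exists>r\<in>D. real j * m < r \<and> r < real (Suc j) * m" if "j < N" for j
  proof (rule dense)
    have "real (Suc j) * m \<le> real N * m" using that m by (intro mult_right_mono) auto
    thus "real (Suc j) * m \<le> T" using m by simp
  qed (use m in \<open>auto simp: field_simps\<close>)
  then obtain r where r: "\<And>j. j < N \<Longrightarrow> r j \<in> D \<and> real j * m < r j \<and> r j < real (Suc j) * m"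
    by metis
  define s where "s j = (if j < N then r j else T)" for j
  have lo: "real j * m \<le> s j" if "j \<le> N" for j
    using r[of j] that m by (cases "j = N") (auto simp: s_def)
  have hi: "s j \<le> real (Suc j) * m" if "j \<le> N" for j
    using r[of j] that m by (cases "j = N") (auto simp: s_def field_simps)
  have "partition_of T \<delta> s N"
    unfolding partition_of_def
  proof (intro conjI allI impI)
    show "0 \<le> s 0" using lo[of 0] by simp
    show "s 0 < \<delta>" using hi[of 0] m by simp
    show "s N = T" by (simp add: s_def)
    fix j assume j: "j < N"
    have "s j \<le> real (Suc j) * m" "real (Suc j) * m \<le> s (Suc j)"
      using lo[of "Suc j"] hi[of j] j by auto
    thus "s j \<le> s (Suc j)" by linarith
    have "s (Suc j) \<le> real (Suc (Suc j)) * m" "real j * m \<le> s j"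
      using hi[of "Suc j"] lo[of j] j by auto
    thus "s (Suc j) - s j < \<delta>" using m by (simp add: algebra_simps)
  qed
  thus ?thesis using r by (intro exI[of _ s] exI[of _ N]) (auto simp: s_def)
qed

context
  fixes T :: real and v :: "real \<Rightarrow> real"
  assumes T: "T > 0" and v: "rc_increasing T v"
begin

lemma emeasure_frozen_Ioc:
  assumes "0 \<le> a" "a \<le> b" "b \<le> T"
  shows "emeasure (interval_measure (\<lambda>t. v (max 0 (min t T)))) {a<..b} = ennreal (v b - v a)"
proof -
  let ?F = "\<lambda>t. v (max 0 (min t T))"
  have mono: "?F s \<le> ?F t" if "s \<le> t" for s t
    using that T by (intro rc_increasingD(1)[OF v]) auto
  have "continuous (at_right t) ?F" for t
  proof -
    consider "t < 0" | "0 \<le> t" "t < T" | "T \<le> t" by linarith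
    hence "(?F \<longlongrightarrow> ?F t) (at_right t)"
    proof cases
      case 1
      have "eventually (\<lambda>r. r \<in> {t<..<0}) (at_right t)" using 1 by (rule eventually_at_right_real)
      hence "eventually (\<lambda>r. ?F r = ?F t) (at_right t)"
        using T 1 by (auto elim!: eventually_mono)
      thus ?thesis by (rule tendsto_eventually)
    next
      case 2
      have "eventually (\<lambda>r. r \<in> {t<..<T}) (at_right t)" using 2 by (intro eventually_at_right_real)
      hence "eventually (\<lambda>r. v r = ?F r) (at_right t)"
        using 2 by (auto elim!: eventually_mono)
      moreover have "(v \<longlongrightarrow> ?F t) (at_right t)" using rc_increasingD(3)[OF v, of t] 2 by simp
      ultimately show ?thesis by (rule Lim_transform_eventually[rotated])
    next
      case 3
      have "eventually (\<lambda>r. r \<in> {t<..<t+1}) (at_right t)" by (rule eventually_at_right_real) simp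
      hence "eventually (\<lambda>r. ?F r = ?F t) (at_right t)"
        using T 3 by (auto elim!: eventually_mono)
      thus ?thesis by (rule tendsto_eventually)
    qed
    thus ?thesis by (simp add: continuous_within)
  qed
  hence "emeasure (interval_measure ?F) {a<..b} = ennreal (?F b - ?F a)"
    using mono assms by (intro emeasure_interval_measure_Ioc) auto
  thus ?thesis using assms by simp
qed

context
  fixes x :: "real \<Rightarrow> real"
  assumes x: "continuous_on {0..T} x" and x_nn: "\<And>t. t \<in> {0..T} \<Longrightarrow> 0 \<le> x t"
begin

private abbreviation "\<mu> \<equiv> interval_measure (\<lambda>t. v (max 0 (min t T)))"
private definition "cell_integral a b = (\<integral>\<^sup>+t\<in>{a<..b}. ennreal (x t) \<partial>\<mu>)" for a b

private lemma x_meas: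
  assumes "0 \<le> a" "b \<le> T"
  shows "(\<lambda>t. ennreal (x t) * indicator {a<..b} t) \<in> borel_measurable \<mu>"
proof -
  have "(\<lambda>t. indicator {a<..b} t *\<^sub>R x t) \<in> borel_measurable borel"
    using assms by (intro borel_measurable_continuous_on_indicator continuous_on_subset[OF x]) auto
  hence "(\<lambda>t. ennreal (indicator {a<..b} t *\<^sub>R x t)) \<in> borel_measurable borel" by measurable
  also have "(\<lambda>t. ennreal (indicator {a<..b} t *\<^sub>R x t)) = (\<lambda>t. ennreal (x t) * indicator {a<..b} t)"
    by (auto simp: indicator_def)
  finally show ?thesis by simp
qed

text \<open>
  On a cell the integrand is \<open>\<epsilon>\<close>-close to its value at the right end,
  and the cell has mass \<open>v b - v a\<close>.
\<close>

private lemma cell_integral_bounds: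
  assumes ab: "0 \<le> a" "a \<le> b" "b \<le> T"
    and osc: "\<And>r. r \<in> {a..b} \<Longrightarrow> \<bar>x r - x b\<bar> \<le> \<epsilon>"
  shows "cell_integral a b < \<infinity>" "\<bar>enn2real (cell_integral a b) - x b * (v b - v a)\<bar> \<le> \<epsilon> * (v b - v a)"
proof -
  have \<epsilon>: "0 \<le> \<epsilon>" using osc[of b] ab by auto
  have vab: "0 \<le> v b - v a" using rc_increasingD(1)[OF v ab] by simp
  have xb: "0 \<le> x b" using x_nn ab by auto
  have up: "cell_integral a b \<le> ennreal ((x b + \<epsilon>) * (v b - v a))"
  proof -
    have "cell_integral a b \<le> (\<integral>\<^sup>+t. ennreal (x b + \<epsilon>) * indicator {a<..b} t \<partial>\<mu>)"
      unfolding cell_integral_def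
    proof (intro nn_integral_mono)
      fix t show "ennreal (x t) * indicator {a<..b} t \<le> ennreal (x b + \<epsilon>) * indicator {a<..b} t"
        using osc[of t] by (auto simp: indicator_def intro!: ennreal_leI)
    qed
    also have "\<dots> = ennreal ((x b + \<epsilon>) * (v b - v a))"
      using emeasure_frozen_Ioc[OF ab] xb \<epsilon> vab by (simp add: nn_integral_cmult_indicator ennreal_mult)
    finally show ?thesis .
  qed
  thus fin: "cell_integral a b < \<infinity>" by (rule le_less_trans) simp
  have "ennreal (x b * (v b - v a)) = (\<integral>\<^sup>+t. ennreal (x b) * indicator {a<..b} t \<partial>\<mu>)"
    using emeasure_frozen_Ioc[OF ab] xb \<epsilon> vab by (simp add: nn_integral_cmult_indicator ennreal_mult)
  also have "\<dots> \<le> (\<integral>\<^sup>+t. ennreal (x t) * indicator {a<..b} t + ennreal \<epsilon> * indicator {a<..b} t \<partial>\<mu>)"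
  proof (intro nn_integral_mono)
    fix t
    have "ennreal (x b) \<le> ennreal (x t) + ennreal \<epsilon>" if t: "t \<in> {a<..b}"
    proof -
      have "ennreal (x b) \<le> ennreal (x t + \<epsilon>)" using osc[of t] t by (intro ennreal_leI) auto
      thus ?thesis using x_nn[of t] t ab \<epsilon> by simp
    qed
    thus "ennreal (x b) * indicator {a<..b} t \<le>
        ennreal (x t) * indicator {a<..b} t + ennreal \<epsilon> * indicator {a<..b} t"
      by (auto simp: indicator_def)
  qed
  also have "\<dots> = cell_integral a b + ennreal (\<epsilon> * (v b - v a))"
    unfolding cell_integral_def using x_meas[OF ab(1,3)] emeasure_frozen_Ioc[OF ab] \<epsilon> vab
    by (subst nn_integral_add) (auto simp: nn_integral_cmult_indicator ennreal_mult)
  finally have low: "ennreal (x b * (v b - v a)) \<le> cell_integral a b + ennreal (\<epsilon> * (v b - v a))" .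
  obtain c where c: "cell_integral a b = ennreal c" "0 \<le> c"
    using fin by (cases "cell_integral a b") auto
  have "c \<le> (x b + \<epsilon>) * (v b - v a)"
    using up xb \<epsilon> vab unfolding c(1) by (subst (asm) ennreal_le_iff) auto
  moreover have "x b * (v b - v a) \<le> c + \<epsilon> * (v b - v a)"
    using low c(2) \<epsilon> vab unfolding c(1)
    by (subst (asm) ennreal_plus[symmetric]) (auto simp del: ennreal_plus)
  ultimately show "\<bar>enn2real (cell_integral a b) - x b * (v b - v a)\<bar> \<le> \<epsilon> * (v b - v a)"
    using c by (simp add: algebra_simps abs_le_iff)
qed

private lemma cell_integral_split:
  assumes "0 \<le> a" "a \<le> b" "b \<le> T"
  shows "cell_integral 0 b = cell_integral 0 a + cell_integral a b"
proof -
  have "cell_integral 0 b = (\<integral>\<^sup>+t. ennreal (x t) * indicator {0<..a} t + ennreal (x t) * indicator {a<..b} t \<partial>\<mu>)"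
    unfolding cell_integral_def using assms by (intro nn_integral_cong) (auto simp: indicator_def)
  also have "\<dots> = cell_integral 0 a + cell_integral a b"
    unfolding cell_integral_def using x_meas[of 0 a] x_meas[of a b] assms by (intro nn_integral_add) auto
  finally show ?thesis .
qed

private lemma cell_integral_finite: "0 \<le> b \<Longrightarrow> b \<le> T \<Longrightarrow> cell_integral 0 b < \<infinity>"
proof -
  assume b: "0 \<le> b" "b \<le> T"
  have "compact (x ` {0..b})"
    using b by (intro compact_continuous_image continuous_on_subset[OF x]) auto
  then obtain C where "\<And>r. r \<in> {0..b} \<Longrightarrow> \<bar>x r\<bar> \<le> C"
    using compact_imp_bounded bounded_iff by (metis imageI real_norm_def)
  hence "\<bar>x r - x b\<bar> \<le> 2 * C" if "r \<in> {0..b}" for r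
    using b that by (smt (verit) atLeastAtMost_iff)
  thus ?thesis using cell_integral_bounds(1)[of 0 b "2 * C"] b by auto
qed

lemma stieltjes1_enn:
  "ennreal (stieltjes1 T x v) = ennreal (x 0 * v 0) + (\<integral>\<^sup>+t\<in>{0<..T}. ennreal (x t) \<partial>\<mu>)"
  "0 \<le> stieltjes1 T x v"
proof -
  have 0: "0 \<le> x 0 * v 0" using x_nn[of 0] rc_increasingD(2)[OF v, of 0] T by auto
  have "ennreal (enn2real (cell_integral 0 T)) = cell_integral 0 T" using cell_integral_finite[of T] T by (simp add: less_top)
  thus "ennreal (stieltjes1 T x v) = ennreal (x 0 * v 0) + (\<integral>\<^sup>+t\<in>{0<..T}. ennreal (x t) \<partial>\<mu>)"
    using 0 by (simp add: stieltjes1_def cell_integral_def ennreal_plus)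
  show "0 \<le> stieltjes1 T x v" using 0 by (simp add: stieltjes1_def)
qed

text \<open>
  The error depends on the path \<open>v\<close> only through \<open>v T\<close>. By this
  estimate, additivity, measurability and convergence pass from finite sums to the integral.
\<close>

lemma riemann_sum_approx:
  assumes part: "partition_of T \<delta> s n"
    and osc: "\<And>r r'. r \<in> {0..T} \<Longrightarrow> r' \<in> {0..T} \<Longrightarrow> \<bar>r - r'\<bar> < \<delta> \<Longrightarrow> \<bar>x r - x r'\<bar> \<le> \<epsilon>"
  shows "\<bar>stieltjes1 T x v - riemann_sum s n x v\<bar> \<le> \<epsilon> * v T"
proof -
  have "\<bar>x 0 * v 0 + enn2real (cell_integral 0 (s j)) - riemann_sum s j x v\<bar> \<le> \<epsilon> * v (s j)" if "j \<le> n" for j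
    using that
  proof (induction j)
    case 0
    have s0: "0 \<le> s 0" "s 0 \<le> T" "s 0 < \<delta>"
      using partition_of_in[OF part, of 0] part by (auto simp: partition_of_def)
    have 1: "\<bar>enn2real (cell_integral 0 (s 0)) - x (s 0) * (v (s 0) - v 0)\<bar> \<le> \<epsilon> * (v (s 0) - v 0)"
      using s0 by (intro cell_integral_bounds(2) osc) auto
    have 2: "\<bar>x 0 - x (s 0)\<bar> * v 0 \<le> \<epsilon> * v 0"
      using s0 rc_increasingD(2)[OF v, of 0] by (intro mult_right_mono osc) auto
    have 3: "\<bar>x 0 * v 0 - x (s 0) * v 0\<bar> = \<bar>x 0 - x (s 0)\<bar> * v 0"
      using rc_increasingD(2)[OF v, of 0] T
      by (metis abs_mult abs_of_nonneg left_diff_distrib less_imp_le order_refl)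
    have "x 0 * v 0 + enn2real (cell_integral 0 (s 0)) - riemann_sum s 0 x v =
        (enn2real (cell_integral 0 (s 0)) - x (s 0) * (v (s 0) - v 0)) + (x 0 * v 0 - x (s 0) * v 0)"
      by (simp add: riemann_sum_def algebra_simps)
    also have "\<bar>\<dots>\<bar> \<le> \<epsilon> * (v (s 0) - v 0) + \<epsilon> * v 0"
      using 1 2 3 by linarith
    finally show ?case by (simp add: algebra_simps)
  next
    case (Suc j)
    have sj: "0 \<le> s j" "s j \<le> s (Suc j)" "s (Suc j) \<le> T" "s (Suc j) - s j < \<delta>"
      using partition_of_in[OF part, of j] partition_of_in[OF part, of "Suc j"] part Suc.prems
      by (auto simp: partition_of_def)
    have 1: "\<bar>enn2real (cell_integral (s j) (s (Suc j))) - x (s (Suc j)) * (v (s (Suc j)) - v (s j))\<bar>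
        \<le> \<epsilon> * (v (s (Suc j)) - v (s j))"
      using sj by (intro cell_integral_bounds(2) osc) auto
    have 2: "cell_integral 0 (s (Suc j)) = cell_integral 0 (s j) + cell_integral (s j) (s (Suc j))" using sj by (intro cell_integral_split)
    hence "cell_integral (s j) (s (Suc j)) \<le> cell_integral 0 (s (Suc j))" by simp
    hence 3: "cell_integral (s j) (s (Suc j)) < \<infinity>" using cell_integral_finite[of "s (Suc j)"] sj by (auto intro: le_less_trans)
    have "enn2real (cell_integral 0 (s (Suc j))) = enn2real (cell_integral 0 (s j)) + enn2real (cell_integral (s j) (s (Suc j)))"
      unfolding 2 using 3 cell_integral_finite[of "s j"] sj by (intro enn2real_plus) auto
    hence "x 0 * v 0 + enn2real (cell_integral 0 (s (Suc j))) - riemann_sum s (Suc j) x v =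
       (x 0 * v 0 + enn2real (cell_integral 0 (s j)) - riemann_sum s j x v) +
       (enn2real (cell_integral (s j) (s (Suc j))) - x (s (Suc j)) * (v (s (Suc j)) - v (s j)))"
      by (simp add: riemann_sum_def)
    also have "\<bar>\<dots>\<bar> \<le> \<epsilon> * v (s j) + \<epsilon> * (v (s (Suc j)) - v (s j))"
      using Suc 1 by linarith
    finally show ?case by (simp add: algebra_simps)
  qed
  from this[of n] show ?thesis using part by (simp add: partition_of_def stieltjes1_def cell_integral_def)
qed

end

end

lemma uniform_modulus:
  fixes x :: "real \<Rightarrow> real"
  assumes "continuous_on {0..T} x" and "\<epsilon> > 0"
  shows "\<exists>\<delta>>0. \<forall>r\<in>{0..T}. \<forall>r'\<in>{0..T}. \<bar>r - r'\<bar> < \<delta> \<longrightarrow> \<bar>x r - x r'\<bar> \<le> \<epsilon>"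
proof -
  have "uniformly_continuous_on {0..T} x" using assms(1) by (intro compact_uniformly_continuous) auto
  then obtain \<delta> where "\<delta> > 0"
    "\<And>r r'. r \<in> {0..T} \<Longrightarrow> r' \<in> {0..T} \<Longrightarrow> dist r' r < \<delta> \<Longrightarrow> dist (x r') (x r) < \<epsilon>"
    using \<open>\<epsilon> > 0\<close> unfolding uniformly_continuous_on_def by metis
  thus ?thesis by (intro exI[of _ \<delta>]) (auto simp: dist_real_def abs_minus_commute less_imp_le)
qed

text \<open>
  The partitions depend neither on \<open>x\<close> nor on \<open>v\<close>; hence one
  sequence of finite sums serves several paths, and all outcomes \<open>\<omega>\<close>, at
  once.
\<close>

lemma riemann_sums_converge:
  assumes "T > 0" and "continuous_on {0..T} x" and "\<And>t. t \<in> {0..T} \<Longrightarrow> 0 \<le> x t"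
    and "rc_increasing T v" and part: "\<And>m. partition_of T (1 / real (Suc m)) (s m) (n m)"
  shows "(\<lambda>m. riemann_sum (s m) (n m) x v) \<longlonglongrightarrow> stieltjes1 T x v"
proof (rule LIMSEQ_I)
  fix e :: real assume "e > 0"
  have vT: "0 \<le> v T" using rc_increasingD(2)[OF assms(4), of T] \<open>T > 0\<close> by simp
  define \<epsilon> where "\<epsilon> = e / (v T + 1)"
  have "\<epsilon> > 0" "\<epsilon> * v T < e" using \<open>e > 0\<close> vT by (auto simp: \<epsilon>_def field_simps)
  from uniform_modulus[OF assms(2) \<open>\<epsilon> > 0\<close>] obtain \<delta> where \<delta>: "\<delta> > 0"
    "\<And>r r'. r \<in> {0..T} \<Longrightarrow> r' \<in> {0..T} \<Longrightarrow> \<bar>r - r'\<bar> < \<delta> \<Longrightarrow> \<bar>x r - x r'\<bar> \<le> \<epsilon>" by blast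
  obtain M where M: "1 / real (Suc M) < \<delta>" using \<delta>(1) nat_approx_posE by blast
  show "\<exists>no. \<forall>m\<ge>no. norm (riemann_sum (s m) (n m) x v - stieltjes1 T x v) < e"
  proof (intro exI[of _ M] allI impI)
    fix m assume "m \<ge> M"
    hence "1 / real (Suc m) \<le> 1 / real (Suc M)" by (intro divide_left_mono) auto
    hence "\<bar>stieltjes1 T x v - riemann_sum (s m) (n m) x v\<bar> \<le> \<epsilon> * v T"
      using M by (intro riemann_sum_approx[OF assms(1) assms(4) assms(2,3) part[of m]] \<delta>(2)) auto
    thus "norm (riemann_sum (s m) (n m) x v - stieltjes1 T x v) < e"
      using \<open>\<epsilon> * v T < e\<close> by (simp add: abs_minus_commute)
  qed
qed

lemma exists_partitions:
  assumes "T > 0"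
  shows "\<exists>s n. \<forall>m. partition_of T (1 / real (Suc m)) (s m) (n m)"
proof -
  have "\<forall>m. \<exists>s n. partition_of T (1 / real (Suc m)) s n"
    using exists_partition[OF assms, of _ UNIV] dense by (metis UNIV_I of_nat_0_less_iff zero_less_Suc zero_less_divide_1_iff)
  thus ?thesis by metis
qed

lemma rc_increasing_add:
  assumes "rc_increasing T u" "rc_increasing T v"
  shows "rc_increasing T (\<lambda>t. u t + v t)"
  using assms unfolding rc_increasing_def by (auto simp: mono_on_def intro!: tendsto_add add_mono)

lemma stieltjes1_add:
  assumes "T > 0" and "continuous_on {0..T} x" and "\<And>t. t \<in> {0..T} \<Longrightarrow> 0 \<le> x t"
    and "rc_increasing T u" "rc_increasing T v"
  shows "stieltjes1 T x (\<lambda>t. u t + v t) = stieltjes1 T x u + stieltjes1 T x v"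
proof -
  obtain s n where sn: "\<And>m. partition_of T (1 / real (Suc m)) (s m) (n m)"
    using exists_partitions[OF \<open>T > 0\<close>] by blast
  have conv: "(\<lambda>m. riemann_sum (s m) (n m) x w) \<longlonglongrightarrow> stieltjes1 T x w" if "rc_increasing T w" for w
    using assms(1-3) that sn by (rule riemann_sums_converge)
  have "riemann_sum (s m) (n m) x (\<lambda>t. u t + v t) =
      riemann_sum (s m) (n m) x u + riemann_sum (s m) (n m) x v" for m
    by (simp add: riemann_sum_def algebra_simps sum.distrib sum_subtractf)
  hence "(\<lambda>m. riemann_sum (s m) (n m) x (\<lambda>t. u t + v t)) \<longlonglongrightarrow> stieltjes1 T x u + stieltjes1 T x v"
    using tendsto_add[OF conv[OF assms(4)] conv[OF assms(5)]] by simp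
  thus ?thesis using conv[OF rc_increasing_add[OF assms(4,5)]] LIMSEQ_unique by blast
qed

lemma stieltjes1_measurable:
  assumes "T > 0"
    and "\<And>t. t \<in> {0..T} \<Longrightarrow> X t \<in> borel_measurable P" "\<And>t. t \<in> {0..T} \<Longrightarrow> V t \<in> borel_measurable P"
    and "\<And>\<omega>. \<omega> \<in> space P \<Longrightarrow> continuous_on {0..T} (\<lambda>t. X t \<omega>)"
    and "\<And>t \<omega>. \<omega> \<in> space P \<Longrightarrow> t \<in> {0..T} \<Longrightarrow> 0 \<le> X t \<omega>"
    and "\<And>\<omega>. \<omega> \<in> space P \<Longrightarrow> rc_increasing T (\<lambda>t. V t \<omega>)"
  shows "(\<lambda>\<omega>. stieltjes1 T (\<lambda>t. X t \<omega>) (\<lambda>t. V t \<omega>)) \<in> borel_measurable P"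
proof -
  obtain s n where sn: "\<And>m. partition_of T (1 / real (Suc m)) (s m) (n m)"
    using exists_partitions[OF \<open>T > 0\<close>] by blast
  show ?thesis
  proof (rule borel_measurable_LIMSEQ_real)
    show "(\<lambda>m. riemann_sum (s m) (n m) (\<lambda>t. X t \<omega>) (\<lambda>t. V t \<omega>))
        \<longlonglongrightarrow> stieltjes1 T (\<lambda>t. X t \<omega>) (\<lambda>t. V t \<omega>)" if "\<omega> \<in> space P" for \<omega>
      using that assms sn by (intro riemann_sums_converge) auto
    fix m
    have [measurable]: "X (s m j) \<in> borel_measurable P" "V (s m j) \<in> borel_measurable P"
      if "j \<le> n m" for j
      using partition_of_in[OF sn that] assms(2,3) by auto
    show "(\<lambda>\<omega>. riemann_sum (s m) (n m) (\<lambda>t. X t \<omega>) (\<lambda>t. V t \<omega>)) \<in> borel_measurable P"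
      unfolding riemann_sum_def
      by (intro borel_measurable_add borel_measurable_sum borel_measurable_times borel_measurable_diff) auto
  qed
qed

text \<open>
  Weak convergence of the measures \<open>dv\<close>: convergence outside a countable set and
  at \<open>T\<close> is enough, because a partition may be chosen among the points of
  convergence.
\<close>

lemma stieltjes1_tendsto:
  assumes "T > 0" and x: "continuous_on {0..T} x" "\<And>t. t \<in> {0..T} \<Longrightarrow> 0 \<le> x t"
    and v: "rc_increasing T v" and vn: "\<And>k. rc_increasing T (vn k)"
    and E: "countable E" and lim: "\<And>t. t \<in> {0..T} - E \<Longrightarrow> (\<lambda>k. vn k t) \<longlonglongrightarrow> v t"
    and limT: "(\<lambda>k. vn k T) \<longlonglongrightarrow> v T"
  shows "(\<lambda>k. stieltjes1 T x (vn k)) \<longlonglongrightarrow> stieltjes1 T x v"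
proof (rule LIMSEQ_I)
  fix e :: real assume "e > 0"
  have vT: "0 \<le> v T" using rc_increasingD(2)[OF v, of T] \<open>T > 0\<close> by simp
  define \<epsilon> where "\<epsilon> = e / (4 * (v T + 1))"
  have \<epsilon>: "\<epsilon> > 0" "\<epsilon> * (v T + 1) = e / 4" using \<open>e > 0\<close> vT by (auto simp: \<epsilon>_def field_simps)
  from uniform_modulus[OF x(1) \<epsilon>(1)] obtain \<delta> where \<delta>: "\<delta> > 0"
    "\<And>r r'. r \<in> {0..T} \<Longrightarrow> r' \<in> {0..T} \<Longrightarrow> \<bar>r - r'\<bar> < \<delta> \<Longrightarrow> \<bar>x r - x r'\<bar> \<le> \<epsilon>" by blast
  have "\<exists>r\<in>{0..T} - E. a < r \<and> r < b" if "0 \<le> a" "a < b" "b \<le> T" for a b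
  proof -
    have "uncountable ({a<..<b} - E)"
      using that E by (intro uncountable_minus_countable) (auto simp: uncountable_open_interval)
    then obtain r where "r \<in> {a<..<b} - E" by (metis countable_empty ex_in_conv)
    thus ?thesis using that by (intro bexI[of _ r]) auto
  qed
  from exists_partition[OF \<open>T > 0\<close> \<delta>(1) this] obtain s n where
    part: "partition_of T \<delta> s n" and s: "\<And>j. j < n \<Longrightarrow> s j \<in> {0..T} - E" by blast
  have ls: "(\<lambda>k. vn k (s j)) \<longlonglongrightarrow> v (s j)" if "j \<le> n" for j
    using that s[of j] lim limT part by (cases "j = n") (auto simp: partition_of_def)
  have "(\<lambda>k. riemann_sum s n x (vn k)) \<longlonglongrightarrow> riemann_sum s n x v"
    unfolding riemann_sum_def by (intro tendsto_intros ls) auto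
  hence 1: "eventually (\<lambda>k. \<bar>riemann_sum s n x (vn k) - riemann_sum s n x v\<bar> < e / 4) sequentially"
    using \<open>e > 0\<close> unfolding tendsto_iff dist_real_def by (metis divide_pos_pos zero_less_numeral)
  have 2: "eventually (\<lambda>k. vn k T < v T + 1) sequentially"
    using order_tendstoD(2)[OF limT, of "v T + 1"] by simp
  have "eventually (\<lambda>k. norm (stieltjes1 T x (vn k) - stieltjes1 T x v) < e) sequentially"
    using 1 2
  proof eventually_elim
    case (elim k)
    have "\<bar>stieltjes1 T x (vn k) - riemann_sum s n x (vn k)\<bar> \<le> \<epsilon> * vn k T"
      by (intro riemann_sum_approx[OF \<open>T > 0\<close> vn x part] \<delta>(2))
    moreover have "\<bar>stieltjes1 T x v - riemann_sum s n x v\<bar> \<le> \<epsilon> * v T"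
      by (intro riemann_sum_approx[OF \<open>T > 0\<close> v x part] \<delta>(2))
    moreover have "\<epsilon> * vn k T \<le> \<epsilon> * (v T + 1)" "\<epsilon> * v T \<le> \<epsilon> * (v T + 1)"
      using elim \<epsilon>(1) by (auto intro!: mult_left_mono)
    ultimately show ?case using elim(1) \<epsilon>(2) \<open>e > 0\<close> unfolding real_norm_def by linarith
  qed
  thus "\<exists>no. \<forall>k\<ge>no. norm (stieltjes1 T x (vn k) - stieltjes1 T x v) < e"
    by (simp add: eventually_sequentially)
qed

section \<open>Increasing right-continuous paths\<close>

lemma rc_le_from_dense:
  assumes u: "rc_increasing T u" and v: "rc_increasing T v"
    and dense: "\<And>a b. 0 \<le> a \<Longrightarrow> a < b \<Longrightarrow> b \<le> T \<Longrightarrow> \<exists>r\<in>D. a < r \<and> r < b"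
    and le: "\<And>r. r \<in> D \<Longrightarrow> u r \<le> v r" "u T \<le> v T" and t: "t \<in> {0..T}"
  shows "u t \<le> v t"
proof (cases "t = T")
  case False
  hence tT: "0 \<le> t" "t < T" using t by auto
  show ?thesis
  proof (rule ccontr)
    assume "\<not> u t \<le> v t"
    then obtain c where c: "v t < c" "c < u t" using dense_order_class.dense[of "v t" "u t"] by auto
    have "eventually (\<lambda>s. v s < c) (at_right t)" "eventually (\<lambda>s. c < u s) (at_right t)"
      using order_tendstoD[OF rc_increasingD(3)[OF v tT]] order_tendstoD[OF rc_increasingD(3)[OF u tT]] c
      by auto
    hence "eventually (\<lambda>s. v s < u s) (at_right t)" by eventually_elim simp
    then obtain b where b: "b > t" "\<And>s. t < s \<Longrightarrow> s < b \<Longrightarrow> v s < u s"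
      by (auto simp: eventually_at_right_field)
    obtain r where "r \<in> D" "t < r" "r < min b T" using dense[of t "min b T"] tT b by auto
    thus False using b(2)[of r] le(1)[of r] by auto
  qed
qed (use le in simp)

text \<open>
  An infimum of right-continuous increasing functions is upper semicontinuous and increasing,
  hence right-continuous. This fails for suprema.
\<close>

lemma rc_increasing_INF:
  fixes v :: "nat \<Rightarrow> real \<Rightarrow> real"
  assumes T: "T > 0" and v: "\<And>n. rc_increasing T (v n)"
  shows "rc_increasing T (\<lambda>t. INF n. v n t)"
proof -
  have bdd: "bdd_below (range (\<lambda>n. v n t))" if "0 \<le> t" "t \<le> T" for t
    using rc_increasingD(2)[OF v that] by (intro bdd_belowI2[of _ 0]) auto
  have mono: "(INF n. v n s) \<le> (INF n. v n t)" if "0 \<le> s" "s \<le> t" "t \<le> T" for s t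
    using rc_increasingD(1)[OF v that] bdd[of s] that by (intro cINF_mono) auto
  show ?thesis
    unfolding rc_increasing_def
  proof (intro conjI ballI)
    show "mono_on {0..T} (\<lambda>t. INF n. v n t)" using mono by (auto intro: mono_onI)
    show "0 \<le> (INF n. v n 0)" using rc_increasingD(2)[OF v, of 0] T by (intro cINF_greatest) auto
    fix t assume "t \<in> {0..<T}"
    hence t: "0 \<le> t" "t < T" by auto
    have ev: "eventually (\<lambda>s. s \<in> {t<..<T}) (at_right t)" using t by (intro eventually_at_right_real)
    show "((\<lambda>t. INF n. v n t) \<longlongrightarrow> (INF n. v n t)) (at_right t)"
    proof (rule order_tendstoI)
      fix a assume a: "a < (INF n. v n t)"
      show "eventually (\<lambda>s. a < (INF n. v n s)) (at_right t)"
        using ev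
      proof eventually_elim
        case (elim s)
        have "(INF n. v n t) \<le> (INF n. v n s)" using elim t by (intro mono) auto
        thus ?case using a by simp
      qed
    next
      fix a assume "(INF n. v n t) < a"
      then obtain n where "v n t < a" using bdd[of t] t by (auto simp: cINF_less_iff)
      hence "eventually (\<lambda>s. v n s < a) (at_right t)"
        using rc_increasingD(3)[OF v t, of n] by (intro order_tendstoD(2))
      thus "eventually (\<lambda>s. (INF n. v n s) < a) (at_right t)"
        using ev
      proof eventually_elim
        case (elim s)
        have "(INF n. v n s) \<le> v n s" using elim t bdd[of s] by (intro cINF_lower) auto
        thus ?case using elim by simp
      qed
    qed
  qed
qed

lemma rc_increasing_min:
  assumes "rc_increasing T u" "rc_increasing T v"
  shows "rc_increasing T (\<lambda>t. min (u t) (v t))"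
  unfolding rc_increasing_def
proof (intro conjI ballI)
  show "mono_on {0..T} (\<lambda>t. min (u t) (v t))"
  proof (rule mono_onI)
    fix s t assume "s \<in> {0..T}" "t \<in> {0..T}" "s \<le> t"
    hence "u s \<le> u t" "v s \<le> v t"
      using rc_increasingD(1)[OF assms(1), of s t] rc_increasingD(1)[OF assms(2), of s t] by auto
    thus "min (u s) (v s) \<le> min (u t) (v t)" by linarith
  qed
qed (use assms in \<open>simp_all add: rc_increasing_def tendsto_min\<close>)

lemma rc_increasing_max:
  assumes "rc_increasing T u" "rc_increasing T v"
  shows "rc_increasing T (\<lambda>t. max (u t) (v t))"
  unfolding rc_increasing_def
proof (intro conjI ballI)
  show "mono_on {0..T} (\<lambda>t. max (u t) (v t))"
  proof (rule mono_onI)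
    fix s t assume "s \<in> {0..T}" "t \<in> {0..T}" "s \<le> t"
    hence "u s \<le> u t" "v s \<le> v t"
      using rc_increasingD(1)[OF assms(1), of s t] rc_increasingD(1)[OF assms(2), of s t] by auto
    thus "max (u s) (v s) \<le> max (u t) (v t)" by linarith
  qed
  show "0 \<le> max (u 0) (v 0)" using assms by (simp add: rc_increasing_def le_max_iff_disj)
qed (use assms in \<open>simp add: rc_increasing_def tendsto_max\<close>)

lemma rc_increasing_cmult:
  assumes "rc_increasing T v" and "0 \<le> c"
  shows "rc_increasing T (\<lambda>t. c * v t)"
  unfolding rc_increasing_def
proof (intro conjI ballI)
  show "mono_on {0..T} (\<lambda>t. c * v t)"
    using assms rc_increasingD(1)[OF assms(1)] by (intro mono_onI mult_left_mono) auto
qed (use assms in \<open>simp_all add: rc_increasing_def tendsto_mult_left\<close>)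

text \<open>
  A supremum of increasing right-continuous paths need not be right-continuous: consider the
  indicators of \<open>[1/n, T]\<close> at time \<open>0\<close>. Its envelope, the infimum
  over later times, is the smallest increasing right-continuous majorant. Only rational times
  are used, to keep measurability. The time \<open>T\<close> always belongs to the index set,
  so that the set is nonempty and the value at \<open>T\<close> is unchanged.
\<close>

definition later_times :: "real \<Rightarrow> real \<Rightarrow> real set" where
  "later_times T t = {q \<in> insert T \<rat>. q \<le> T \<and> (t < q \<or> q = T)}"

definition right_envelope :: "real \<Rightarrow> (real \<Rightarrow> real) \<Rightarrow> real \<Rightarrow> real" where
  "right_envelope T G t = (INF q\<in>later_times T t. G q)"

context
  fixes T :: real and G :: "real \<Rightarrow> real"
  assumes T: "T > 0" and G: "\<And>s t. 0 \<le> s \<Longrightarrow> s \<le> t \<Longrightarrow> t \<le> T \<Longrightarrow> G s \<le> G t" and G0: "0 \<le> G 0"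
begin

private lemma later: "T \<in> later_times T t" "q \<in> later_times T t \<Longrightarrow> t \<le> T \<Longrightarrow> t \<le> q \<and> q \<le> T"
  by (auto simp: later_times_def)

private lemma bdd: "0 \<le> t \<Longrightarrow> t \<le> T \<Longrightarrow> bdd_below (G ` later_times T t)"
  using G later by (intro bdd_belowI2[of _ "G t"]) auto

lemma right_envelope_ge:
  assumes "0 \<le> t" "t \<le> T" shows "G t \<le> right_envelope T G t"
  unfolding right_envelope_def
proof (rule cINF_greatest)
  show "later_times T t \<noteq> {}" using later(1) by blast
  show "G t \<le> G q" if "q \<in> later_times T t" for q
    using later(2)[OF that] assms by (intro G) auto
qed

lemma right_envelope_le:
  assumes "0 \<le> t" "t \<le> T" "q \<in> later_times T t" shows "right_envelope T G t \<le> G q"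
  unfolding right_envelope_def using assms bdd by (intro cINF_lower) auto

lemma right_envelope_end: "right_envelope T G T = G T"
  using right_envelope_ge[of T] right_envelope_le[of T T] later(1)[of T] T by simp

text \<open>
  Since the envelope at \<open>t\<close> depends only on times before an arbitrary
  \<open>u > t\<close>, it inherits measurability from a right-continuous filtration.
\<close>

lemma right_envelope_restrict:
  assumes t: "0 \<le> t" "t < u" "u < T"
  shows "right_envelope T G t = (INF q\<in>later_times T t \<inter> {..<u}. G q)"
proof (rule antisym)
  obtain q0 where q0: "q0 \<in> \<rat>" "t < q0" "q0 < u" using Rats_dense_in_real[OF t(2)] by blast
  hence q0_in: "q0 \<in> later_times T t \<inter> {..<u}" using t by (auto simp: later_times_def)
  have bdd': "bdd_below (G ` (later_times T t \<inter> {..<u}))"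
    by (rule bdd_below_mono[OF bdd[of t]]) (use t in auto)
  show "right_envelope T G t \<le> (INF q\<in>later_times T t \<inter> {..<u}. G q)"
  proof (rule cINF_greatest)
    show "later_times T t \<inter> {..<u} \<noteq> {}" using q0_in by blast
    show "right_envelope T G t \<le> G q" if "q \<in> later_times T t \<inter> {..<u}" for q
      using right_envelope_le[of t q] t that by simp
  qed
  show "(INF q\<in>later_times T t \<inter> {..<u}. G q) \<le> right_envelope T G t"
    unfolding right_envelope_def
  proof (intro cINF_greatest)
    show "later_times T t \<noteq> {}" using later(1) by blast
    fix q assume q: "q \<in> later_times T t"
    show "(INF q\<in>later_times T t \<inter> {..<u}. G q) \<le> G q"
    proof (cases "q < u")
      case True
      thus ?thesis using q bdd' by (intro cINF_lower) auto
    next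
      case False
      have "(INF q\<in>later_times T t \<inter> {..<u}. G q) \<le> G q0" using q0_in bdd' by (intro cINF_lower)
      also have "\<dots> \<le> G q" using False q0 t later(2)[OF q] by (intro G) auto
      finally show ?thesis .
    qed
  qed
qed

lemma rc_increasing_right_envelope: "rc_increasing T (right_envelope T G)"
proof -
  have mono: "right_envelope T G s \<le> right_envelope T G t" if "0 \<le> s" "s \<le> t" "t \<le> T" for s t
    unfolding right_envelope_def
  proof (intro cINF_superset_mono)
    show "later_times T t \<noteq> {}" using later(1) by blast
    show "bdd_below (G ` later_times T s)" using bdd that by simp
    show "later_times T t \<subseteq> later_times T s" using that by (auto simp: later_times_def)
  qed simp
  show ?thesis
    unfolding rc_increasing_def
  proof (intro conjI ballI)
    show "mono_on {0..T} (right_envelope T G)" using mono by (auto intro: mono_onI)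
    show "0 \<le> right_envelope T G 0" using right_envelope_ge[of 0] G0 T by simp
    fix t assume "t \<in> {0..<T}"
    hence t: "0 \<le> t" "t < T" by auto
    show "(right_envelope T G \<longlongrightarrow> right_envelope T G t) (at_right t)"
    proof (rule order_tendstoI)
      fix a assume a: "a < right_envelope T G t"
      have "eventually (\<lambda>s. s \<in> {t<..<T}) (at_right t)" using t by (intro eventually_at_right_real)
      thus "eventually (\<lambda>s. a < right_envelope T G s) (at_right t)"
      proof eventually_elim
        case (elim s)
        thus ?case using mono[of t s] t a by auto
      qed
    next
      fix a assume "right_envelope T G t < a"
      then obtain q where q: "q \<in> later_times T t" "G q < a"
        unfolding right_envelope_def using bdd[of t] t later(1)[of t]
        by (subst (asm) cINF_less_iff) auto
      hence "t < q" using t by (auto simp: later_times_def)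
      hence "eventually (\<lambda>s. s \<in> {t<..<q}) (at_right t)" by (rule eventually_at_right_real)
      thus "eventually (\<lambda>s. right_envelope T G s < a) (at_right t)"
      proof eventually_elim
        case (elim s)
        have "q \<in> later_times T s" using q elim by (auto simp: later_times_def)
        hence "right_envelope T G s \<le> G q"
          using elim t later(2)[OF q(1)] by (intro right_envelope_le) auto
        thus ?case using q(2) by simp
      qed
    qed
  qed
qed

text \<open>
  At a continuity point \<open>t > 0\<close> of the envelope, values from the left squeeze
  \<open>G t\<close>. Time \<open>0\<close> has no left neighbourhood and may be exceptional.
\<close>

lemma right_envelope_countable: "countable {t\<in>{0..T}. right_envelope T G t \<noteq> G t}"
proof (rule countable_subset)
  let ?R = "right_envelope T G"
  have "mono_on {0<..<T} ?R"
    using rc_increasingD(1)[OF rc_increasing_right_envelope] by (auto intro: mono_onI)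
  hence "countable {t\<in>{0<..<T}. \<not> isCont ?R t}" by (intro mono_on_ctble_discont_open) auto
  thus "countable (insert 0 {t\<in>{0<..<T}. \<not> isCont ?R t})" by simp
  show "{t\<in>{0..T}. ?R t \<noteq> G t} \<subseteq> insert 0 {t\<in>{0<..<T}. \<not> isCont ?R t}"
  proof
    fix t assume t: "t \<in> {t\<in>{0..T}. ?R t \<noteq> G t}"
    have False if "t \<noteq> 0" "t = T \<or> isCont ?R t"
    proof -
      have "t \<noteq> T" using t right_envelope_end by auto
      hence cont: "isCont ?R t" and t': "0 < t" "t < T" using that t by auto
      have gt: "G t < ?R t" using t right_envelope_ge[of t] by auto
      have "(?R \<longlongrightarrow> ?R t) (at_left t)"
        using cont unfolding isCont_def by (rule filterlim_at_split[THEN iffD1, THEN conjunct1])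
      hence "eventually (\<lambda>s. G t < ?R s) (at_left t)" using gt by (rule order_tendstoD)
      then obtain b where b: "b < t" "\<And>s. b < s \<Longrightarrow> s < t \<Longrightarrow> G t < ?R s"
        by (auto simp: eventually_at_left_field)
      obtain s where s: "max 0 b < s" "s < t"
        using dense_order_class.dense[of "max 0 b" t] b t' by auto
      obtain q where q: "q \<in> \<rat>" "s < q" "q < t" using Rats_dense_in_real[OF s(2)] by blast
      have "?R s \<le> G q" using q s t' by (intro right_envelope_le) (auto simp: later_times_def)
      also have "\<dots> \<le> G t" using q s t' by (intro G) auto
      finally show False using b(2)[of s] s by simp
    qed
    thus "t \<in> insert 0 {t\<in>{0<..<T}. \<not> isCont ?R t}" using t by force
  qed
qed

end

section \<open>The lattice of admissible strategies\<close>

lemma vec_borel_measurable_iff: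
  fixes X :: "'w \<Rightarrow> ('a::euclidean_space) ^ 'n::finite"
  shows "X \<in> borel_measurable M \<longleftrightarrow> (\<forall>j. (\<lambda>\<omega>. X \<omega> $ j) \<in> borel_measurable M)"
proof -
  have "X \<in> borel_measurable M \<longleftrightarrow> (\<forall>i\<in>Basis. (\<lambda>\<omega>. X \<omega> \<bullet> i) \<in> borel_measurable M)"
    by (rule borel_measurable_euclidean_space)
  also have "\<dots> \<longleftrightarrow> (\<forall>j. \<forall>i\<in>Basis. (\<lambda>\<omega>. X \<omega> $ j \<bullet> i) \<in> borel_measurable M)"
    by (auto simp: Basis_vec_def inner_axis)
  also have "\<dots> \<longleftrightarrow> (\<forall>j. (\<lambda>\<omega>. X \<omega> $ j) \<in> borel_measurable M)"
    by (subst borel_measurable_euclidean_space) simp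
  finally show ?thesis .
qed

lemma rc_increasing_left_limit:
  assumes "rc_increasing T v" "t \<in> {0<..T}"
  shows "\<exists>l. (v \<longlongrightarrow> l) (at_left t)"
proof -
  have "(v \<longlongrightarrow> Sup (v ` ({..<t} \<inter> {0..<t}))) (at t within ({..<t} \<inter> {0..<t}))"
    using rc_increasingD(1)[OF assms(1)] assms(2)
    by (intro Lim_left_bound[where K = "v t"]) auto
  moreover have "{..<t} \<inter> {0..<t} = {0..<t}" by auto
  moreover have "at t within {0..<t} = at_left t"
    using assms(2) by (intro at_within_nhd[where S = "{0<..}"]) auto
  ultimately show ?thesis by auto
qed

lemma path_iff_rc_increasing:
  fixes v :: "real \<Rightarrow> real ^ 'd::finite"
  assumes "T > 0"
  shows "cadlag_on T v \<and> mono_on {0..T} v \<and> (\<forall>t\<in>{0..T}. 0 \<le> v t) \<longleftrightarrow>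
    (\<forall>l. rc_increasing T (\<lambda>t. v t $ l))"
proof (intro iffI allI)
  fix l assume "cadlag_on T v \<and> mono_on {0..T} v \<and> (\<forall>t\<in>{0..T}. 0 \<le> v t)"
  thus "rc_increasing T (\<lambda>t. v t $ l)"
    using assms unfolding rc_increasing_def cadlag_on_def
    by (auto simp: mono_on_def less_eq_vec_def intro!: tendsto_vec_nth)
next
  assume rc: "\<forall>l. rc_increasing T (\<lambda>t. v t $ l)"
  note D = rc_increasingD[OF rc[rule_format]]
  have "\<exists>l. (v \<longlongrightarrow> l) (at_left t)" if "t \<in> {0<..T}" for t
  proof -
    have "\<forall>i. \<exists>l. ((\<lambda>t. v t $ i) \<longlongrightarrow> l) (at_left t)"
      using rc_increasing_left_limit[OF rc[rule_format] that] by blast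
    then obtain L where "\<forall>i. ((\<lambda>t. v t $ i) \<longlongrightarrow> L i) (at_left t)" by metis
    hence "(v \<longlongrightarrow> (\<chi> i. L i)) (at_left t)" by (intro vec_tendstoI) auto
    thus ?thesis by blast
  qed
  moreover have "(v \<longlongrightarrow> v t) (at_right t)" if "t \<in> {0..<T}" for t
    using D(3)[of t] that by (intro vec_tendstoI) auto
  ultimately show "cadlag_on T v \<and> mono_on {0..T} v \<and> (\<forall>t\<in>{0..T}. 0 \<le> v t)"
    using D(1,2) unfolding cadlag_on_def by (auto simp: mono_on_def less_eq_vec_def)
qed

text \<open>
  The usual conditions on \<open>[0, T]\<close>, in the form in which they are used: null
  sets allow a process to be changed on a null set, and right-continuity makes right envelopes
  adapted.
\<close>

locale usual_filtration = prob_space P for P :: "'w measure" +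
  fixes T :: real and F :: "real \<Rightarrow> 'w measure"
  assumes T_pos: "T > 0"
    and space_F: "space (F t) = space P"
    and sets_F: "sets (F t) \<subseteq> sets P"
    and F_mono: "s \<le> t \<Longrightarrow> sets (F s) \<subseteq> sets (F t)"
    and null_F: "null_sets P \<subseteq> sets (F t)"
    and F_right: "t < T \<Longrightarrow> (\<Inter>u\<in>{t<..<T}. sets (F u)) \<subseteq> sets (F t)"
begin

lemma measurable_F_mono: "s \<le> t \<Longrightarrow> X \<in> borel_measurable (F s) \<Longrightarrow> X \<in> borel_measurable (F t)"
  using F_mono[of s t] by (auto simp: measurable_def space_F)

lemma measurable_F_P: "X \<in> borel_measurable (F t) \<Longrightarrow> X \<in> borel_measurable P"
  using sets_F[of t] by (auto simp: measurable_def space_F)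

lemma measurable_F_right:
  fixes X :: "'w \<Rightarrow> 'b::topological_space"
  assumes "t < T" and X: "\<And>u. t < u \<Longrightarrow> u < T \<Longrightarrow> X \<in> borel_measurable (F u)"
  shows "X \<in> borel_measurable (F t)"
proof (rule measurableI)
  fix B :: "'b set" assume "B \<in> sets borel"
  hence "X -` B \<inter> space (F u) \<in> sets (F u)" if "t < u" "u < T" for u
    using X[OF that] by (auto simp: measurable_sets)
  hence "X -` B \<inter> space P \<in> (\<Inter>u\<in>{t<..<T}. sets (F u))" by (auto simp: space_F)
  thus "X -` B \<inter> space (F t) \<in> sets (F t)" using F_right[OF \<open>t < T\<close>] by (auto simp: space_F)
qed simp

lemma admissible_iff:
  "V \<in> admissible P T F \<longleftrightarrow> (\<forall>l. (\<forall>t\<in>{0..T}. (\<lambda>\<omega>. V t \<omega> $ l) \<in> borel_measurable (F t)) \<and>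
    (\<forall>\<omega>\<in>space P. rc_increasing T (\<lambda>t. V t \<omega> $ l)))"
  unfolding admissible_def adapted_on_def vec_borel_measurable_iff mem_Collect_eq
    path_iff_rc_increasing[OF T_pos] by blast

lemma admissible_measurable:
  assumes "V \<in> admissible P T F" "t \<in> {0..T}"
  shows "V t \<in> borel_measurable P"
  using assms measurable_F_P[of "V t" t] by (auto simp: admissible_def adapted_on_def)

lemma admissible_rc:
  "V \<in> admissible P T F \<Longrightarrow> \<omega> \<in> space P \<Longrightarrow> rc_increasing T (\<lambda>t. V t \<omega> $ l)"
  by (simp add: admissible_iff)

lemma admissible_measurable_nth:
  "V \<in> admissible P T F \<Longrightarrow> t \<in> {0..T} \<Longrightarrow> (\<lambda>\<omega>. V t \<omega> $ l) \<in> borel_measurable (F t)"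
  by (simp add: admissible_iff)

lemma admissible_nonneg:
  assumes "V \<in> admissible P T F" "\<omega> \<in> space P" "t \<in> {0..T}"
  shows "0 \<le> V t \<omega> $ l"
  using rc_increasingD(2)[OF admissible_rc[OF assms(1,2)], of t l] assms(3) by simp

lemma admissible_zero: "(\<lambda>t \<omega>. 0) \<in> admissible P T F"
  by (simp add: admissible_iff rc_increasing_def mono_on_def)

lemma admissible_inf:
  assumes "U \<in> admissible P T F" "V \<in> admissible P T F"
  shows "(\<lambda>t \<omega>. inf (U t \<omega>) (V t \<omega>)) \<in> admissible P T F"
  unfolding admissible_iff
  using admissible_rc[OF assms(1)] admissible_rc[OF assms(2)]
    admissible_measurable_nth[OF assms(1)] admissible_measurable_nth[OF assms(2)]
  by (simp add: inf_vec_def inf_min rc_increasing_min borel_measurable_min)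

lemma admissible_sup:
  assumes "U \<in> admissible P T F" "V \<in> admissible P T F"
  shows "(\<lambda>t \<omega>. sup (U t \<omega>) (V t \<omega>)) \<in> admissible P T F"
  unfolding admissible_iff
  using admissible_rc[OF assms(1)] admissible_rc[OF assms(2)]
    admissible_measurable_nth[OF assms(1)] admissible_measurable_nth[OF assms(2)]
  by (simp add: sup_vec_def sup_max rc_increasing_max borel_measurable_max)

lemma admissible_midpoint:
  assumes "U \<in> admissible P T F" "V \<in> admissible P T F"
  shows "(\<lambda>t \<omega>. (1 / 2) *\<^sub>R (U t \<omega> + V t \<omega>)) \<in> admissible P T F"
  unfolding admissible_iff
proof (intro allI conjI ballI)
  fix l t assume "t \<in> {0..T}"
  thus "(\<lambda>\<omega>. ((1 / 2) *\<^sub>R (U t \<omega> + V t \<omega>)) $ l) \<in> borel_measurable (F t)"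
    using admissible_measurable_nth[OF assms(1)] admissible_measurable_nth[OF assms(2)] by simp
next
  fix l \<omega> assume "\<omega> \<in> space P"
  thus "rc_increasing T (\<lambda>t. ((1 / 2) *\<^sub>R (U t \<omega> + V t \<omega>)) $ l)"
    using rc_increasing_cmult[OF rc_increasing_add[OF admissible_rc[OF assms(1)] admissible_rc[OF assms(2)]],
        where c = "1 / 2"] by simp
qed

lemma admissible_INF:
  assumes "\<And>n::nat. V n \<in> admissible P T F"
  shows "(\<lambda>t \<omega>. \<chi> l. INF n. V n t \<omega> $ l) \<in> admissible P T F"
  unfolding admissible_iff
proof (intro allI conjI ballI)
  fix l t assume "t \<in> {0..T}"
  thus "(\<lambda>\<omega>. (\<chi> l. INF n. V n t \<omega> $ l) $ l) \<in> borel_measurable (F t)"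
    using admissible_measurable_nth[OF assms] by (simp add: borel_measurable_cINF_real)
next
  fix l \<omega> assume "\<omega> \<in> space P"
  thus "rc_increasing T (\<lambda>t. (\<chi> l. INF n. V n t \<omega> $ l) $ l)"
    using rc_increasing_INF[OF T_pos admissible_rc[OF assms]] by simp
qed

lemma proc_le_from_dense:
  assumes UV: "U \<in> admissible P T F" "V \<in> admissible P T F"
    and le: "AE \<omega> in P. \<forall>q\<in>insert T (\<rat> \<inter> {0..T}). \<forall>l. U q \<omega> $ l \<le> V q \<omega> $ l"
  shows "proc_le P T U V"
  unfolding proc_le_def using le AE_space
proof eventually_elim
  case (elim \<omega>)
  show ?case
  proof (intro ballI)
    fix t assume t: "t \<in> {0..T}"
    have "U t \<omega> $ l \<le> V t \<omega> $ l" for l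
    proof (rule rc_le_from_dense[OF _ _ _ _ _ t, where D = "\<rat> \<inter> {0..T}"])
      show "rc_increasing T (\<lambda>t. U t \<omega> $ l)" "rc_increasing T (\<lambda>t. V t \<omega> $ l)"
        using UV elim by (auto simp: admissible_iff)
      show "\<exists>r\<in>\<rat> \<inter> {0..T}. a < r \<and> r < b" if "0 \<le> a" "a < b" "b \<le> T" for a b
        using Rats_dense_in_real[OF that(2)] that by force
    qed (use elim in auto)
    thus "U t \<omega> \<le> V t \<omega>" by (simp add: less_eq_vec_def)
  qed
qed

text \<open>
  Essential infimum: a countable subfamily has, at every rational time and at
  \<open>T\<close>, the same essential lower bounds as the whole family, and its pointwise
  infimum is admissible.
\<close>

lemma admissible_glb:
  fixes S :: "('w, 'd::finite) proc set"
  assumes S: "S \<subseteq> admissible P T F" "S \<noteq> {}"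
  shows "\<exists>m\<in>admissible P T F. (\<forall>s\<in>S. proc_le P T m s) \<and>
    (\<forall>y\<in>admissible P T F. (\<forall>s\<in>S. proc_le P T y s) \<longrightarrow> proc_le P T y m)"
proof -
  define I where "I = insert T (\<rat> \<inter> {0..T}) \<times> (UNIV :: 'd set)"
  define G where "G i V \<omega> = - (V (fst i) \<omega> $ snd i)" for i :: "real \<times> 'd" and V :: "('w, 'd) proc" and \<omega> :: 'w
  have "countable I" 
    unfolding I_def by (intro countable_SIGMA countable_insert countable_Int1 countable_rat) simp
  moreover have "G i s \<in> borel_measurable P" if "i \<in> I" "s \<in> S" for i s
  proof -
    have "s (fst i) \<in> borel_measurable P"
      using that S T_pos by (intro admissible_measurable) (auto simp: I_def)
    thus ?thesis unfolding G_def vec_borel_measurable_iff by simp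
  qed
  ultimately obtain V :: "nat \<Rightarrow> _" where V: "range V \<subseteq> S"
    "\<And>u. u \<in> S \<Longrightarrow> AE \<omega> in P. \<forall>i\<in>I. \<forall>b. (\<forall>n. G i (V n) \<omega> \<le> b) \<longrightarrow> G i u \<omega> \<le> b"
    using essential_upper_bound[OF finite_measure_axioms, of I S G] S(2) by blast
  define m where "m t \<omega> = (\<chi> l. INF n. V n t \<omega> $ l)" for t \<omega>
  have Vadm: "V n \<in> admissible P T F" for n using V(1) S by auto
  have m: "m \<in> admissible P T F" unfolding m_def using Vadm by (rule admissible_INF)
  have bdd: "bdd_below (range (\<lambda>n. V n t \<omega> $ l))" if "\<omega> \<in> space P" "t \<in> {0..T}" for t \<omega> l
    using admissible_nonneg[OF Vadm that] by (intro bdd_belowI2[of _ 0]) auto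
  have "proc_le P T m s" if s: "s \<in> S" for s
  proof (rule proc_le_from_dense[OF m])
    show "s \<in> admissible P T F" using s S by blast
    show "AE \<omega> in P. \<forall>q\<in>insert T (\<rat> \<inter> {0..T}). \<forall>l. m q \<omega> $ l \<le> s q \<omega> $ l"
      using V(2)[OF s] AE_space
    proof eventually_elim
      case (elim \<omega>)
      show ?case
      proof (intro ballI allI)
        fix q :: real and l :: 'd assume q: "q \<in> insert T (\<rat> \<inter> {0..T})"
        have "G (q, l) (V n) \<omega> \<le> - m q \<omega> $ l" for n
        proof -
          have "(INF n. V n q \<omega> $ l) \<le> V n q \<omega> $ l"
            using bdd[OF elim(2), of q l] q T_pos by (intro cINF_lower) auto
          thus ?thesis by (simp add: G_def m_def)
        qed
        hence "G (q, l) s \<omega> \<le> - m q \<omega> $ l" using elim(1) q by (auto simp: I_def)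
        thus "m q \<omega> $ l \<le> s q \<omega> $ l" by (simp add: G_def)
      qed
    qed
  qed
  moreover have "proc_le P T y m" if "\<forall>s\<in>S. proc_le P T y s" for y
  proof -
    have "AE \<omega> in P. \<forall>n. \<forall>t\<in>{0..T}. y t \<omega> \<le> V n t \<omega>"
      using that V(1) unfolding proc_le_def by (subst AE_all_countable) auto
    thus ?thesis
      unfolding proc_le_def m_def
      by eventually_elim (auto simp: less_eq_vec_def intro!: cINF_greatest)
  qed
  ultimately show ?thesis using m by blast
qed

text \<open>
  A bound on the expectations makes the pointwise supremum finite almost surely. Its right
  envelope differs from it at countably many times only, and is set to zero on the exceptional
  null set.
\<close>

lemma increasing_limit:
  fixes V :: "nat \<Rightarrow> ('w, 'd::finite) proc"
  assumes V: "\<And>n. V n \<in> admissible P T F"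
    and inc: "AE \<omega> in P. \<forall>n. \<forall>t\<in>{0..T}. V n t \<omega> \<le> V (Suc n) t \<omega>"
    and bnd: "\<And>n. (\<integral>\<^sup>+\<omega>. ennreal (norm (V n T \<omega>)) \<partial>P) \<le> ennreal c"
  shows "\<exists>W\<in>admissible P T F. AE \<omega> in P. (\<forall>n. \<forall>t\<in>{0..T}. V n t \<omega> \<le> W t \<omega>) \<and>
    (\<lambda>n. V n T \<omega>) \<longlonglongrightarrow> W T \<omega> \<and>
    (\<exists>E. countable E \<and> (\<forall>t\<in>{0..T} - E. (\<lambda>n. V n t \<omega>) \<longlonglongrightarrow> W t \<omega>))"
proof -
  have [measurable]: "V n T \<in> borel_measurable P" for n
    using admissible_measurable[OF V] T_pos by simp
  have V_nn: "0 \<le> V n t \<omega> $ l" if "t \<in> {0..T}" "\<omega> \<in> space P" for n t \<omega> l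
    using admissible_nonneg[OF V that(2,1)] .
  have "AE \<omega> in P. (SUP n. ennreal (norm (V n T \<omega>))) \<noteq> \<infinity>"
  proof (rule nn_integral_noteq_infinite)
    have "(\<integral>\<^sup>+\<omega>. (SUP n. ennreal (norm (V n T \<omega>))) \<partial>P) = (SUP n. \<integral>\<^sup>+\<omega>. ennreal (norm (V n T \<omega>)) \<partial>P)"
    proof (rule nn_integral_monotone_convergence_SUP_AE)
      fix n show "AE \<omega> in P. ennreal (norm (V n T \<omega>)) \<le> ennreal (norm (V (Suc n) T \<omega>))"
        using inc AE_space
      proof eventually_elim
        case (elim \<omega>)
        have "norm (V n T \<omega>) \<le> norm (V (Suc n) T \<omega>)"
          using elim T_pos V_nn[of T \<omega>]
          by (intro norm_le_componentwise_cart) (auto simp: less_eq_vec_def)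
        thus ?case by (rule ennreal_leI)
      qed
    qed simp
    also have "\<dots> \<le> ennreal c" by (rule SUP_least) (rule bnd)
    finally show "(\<integral>\<^sup>+\<omega>. (SUP n. ennreal (norm (V n T \<omega>))) \<partial>P) \<noteq> \<infinity>"
      by (auto simp: top_unique)
  qed simp
  hence "AE \<omega> in P. \<exists>B. \<forall>n l. V n T \<omega> $ l \<le> B"
  proof eventually_elim
    case (elim \<omega>)
    then obtain B where B: "(SUP n. ennreal (norm (V n T \<omega>))) = ennreal B" "0 \<le> B"
      by (cases "SUP n. ennreal (norm (V n T \<omega>))") auto
    have "V n T \<omega> $ l \<le> B" for n l
    proof -
      have "ennreal (norm (V n T \<omega>)) \<le> ennreal B" unfolding B(1)[symmetric] by (rule SUP_upper) simp
      hence "norm (V n T \<omega>) \<le> B" using B(2) by simp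
      thus ?thesis using component_le_norm_cart[of "V n T \<omega>" l] by linarith
    qed
    thus ?case by blast
  qed
  hence "AE \<omega> in P. (\<exists>B. \<forall>n l. V n T \<omega> $ l \<le> B) \<and> (\<forall>n. \<forall>t\<in>{0..T}. V n t \<omega> \<le> V (Suc n) t \<omega>)"
    using inc by eventually_elim blast
  from AE_E3[OF this] obtain N where N0: "N \<in> null_sets P"
    "\<And>\<omega>. \<omega> \<in> space P - N \<Longrightarrow> (\<exists>B. \<forall>n l. V n T \<omega> $ l \<le> B) \<and>
        (\<forall>n. \<forall>t\<in>{0..T}. V n t \<omega> \<le> V (Suc n) t \<omega>)"
    by metis
  define G where "G l \<omega> q = (SUP n. V n q \<omega> $ l)" for l \<omega> q
  have mono: "V n t \<omega> $ l \<le> V n s \<omega> $ l" if "\<omega> \<in> space P" "0 \<le> t" "t \<le> s" "s \<le> T" for n s t \<omega> l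
    using rc_increasingD(1)[OF admissible_rc[OF V that(1)] that(2-4)] .
  have good: "\<exists>B. \<forall>n l. V n T \<omega> $ l \<le> B" "\<And>n t. t \<in> {0..T} \<Longrightarrow> V n t \<omega> \<le> V (Suc n) t \<omega>"
    if "\<omega> \<in> space P" "\<omega> \<notin> N" for \<omega>
    using N0(2)[of \<omega>] that by simp_all
  have bdd: "bdd_above (range (\<lambda>n. V n t \<omega> $ l))" if \<omega>: "\<omega> \<in> space P" "\<omega> \<notin> N" and t: "t \<in> {0..T}" for t \<omega> l
  proof -
    obtain B where "\<And>n. V n T \<omega> $ l \<le> B" using good(1)[OF \<omega>] by blast
    hence "V n t \<omega> $ l \<le> B" for n using mono[OF \<omega>(1), of t T n l] t by (auto intro: order_trans)
    thus ?thesis by (intro bdd_aboveI2)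
  qed
  have G_mono: "G l \<omega> s \<le> G l \<omega> t" if "\<omega> \<in> space P" "\<omega> \<notin> N" "0 \<le> s" "s \<le> t" "t \<le> T" for l \<omega> s t
    unfolding G_def using bdd[OF that(1,2), of t l] mono[OF that(1,3-5)] that by (intro cSUP_mono) auto
  have V_le_G: "V n t \<omega> $ l \<le> G l \<omega> t" if "\<omega> \<in> space P" "\<omega> \<notin> N" "t \<in> {0..T}" for l \<omega> n t
    unfolding G_def using bdd[OF that] by (intro cSUP_upper) auto
  have G0: "0 \<le> G l \<omega> 0" if "\<omega> \<in> space P" "\<omega> \<notin> N" for l \<omega>
    using V_le_G[OF that, of 0 0 l] V_nn[of 0 \<omega> 0 l] that T_pos by auto
  have G_lim: "(\<lambda>n. V n t \<omega> $ l) \<longlonglongrightarrow> G l \<omega> t" if "\<omega> \<in> space P" "\<omega> \<notin> N" "t \<in> {0..T}" for l \<omega> t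
    unfolding G_def using bdd[OF that] good(2)[OF that]
    by (intro LIMSEQ_incseq_SUP) (auto simp: incseq_Suc_iff less_eq_vec_def)
  have env_rc: "rc_increasing T (right_envelope T (G l \<omega>))"
    and env_ge: "\<And>t. t \<in> {0..T} \<Longrightarrow> G l \<omega> t \<le> right_envelope T (G l \<omega>) t"
    and env_end: "right_envelope T (G l \<omega>) T = G l \<omega> T"
    and env_restrict: "\<And>t u. 0 \<le> t \<Longrightarrow> t < u \<Longrightarrow> u < T \<Longrightarrow>
      right_envelope T (G l \<omega>) t = (INF q\<in>later_times T t \<inter> {..<u}. G l \<omega> q)"
    and env_countable: "countable {t\<in>{0..T}. right_envelope T (G l \<omega>) t \<noteq> G l \<omega> t}"
    if \<omega>: "\<omega> \<in> space P" "\<omega> \<notin> N" for l \<omega>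
  proof -
    note g = T_pos G_mono[OF \<omega>] G0[OF \<omega>]
    show "rc_increasing T (right_envelope T (G l \<omega>))" by (rule rc_increasing_right_envelope) (fact g)+
    show "G l \<omega> t \<le> right_envelope T (G l \<omega>) t" if "t \<in> {0..T}" for t
      by (rule right_envelope_ge) (use g that in auto)
    show "right_envelope T (G l \<omega>) T = G l \<omega> T" by (rule right_envelope_end) (fact g)+
    show "right_envelope T (G l \<omega>) t = (INF q\<in>later_times T t \<inter> {..<u}. G l \<omega> q)"
      if "0 \<le> t" "t < u" "u < T" for t u
      by (rule right_envelope_restrict) (fact g that)+
    show "countable {t\<in>{0..T}. right_envelope T (G l \<omega>) t \<noteq> G l \<omega> t}"
      by (rule right_envelope_countable) (fact g)+
  qed
  define W where "W t \<omega> = (if \<omega> \<in> N then 0 else (\<chi> l. right_envelope T (G l \<omega>) t))" for t \<omega>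
  have G_meas: "(\<lambda>\<omega>. G l \<omega> q) \<in> borel_measurable (F u)" if "q \<in> {0..T}" "q \<le> u" for l q u
  proof -
    have "(\<lambda>\<omega>. - (INF n. - (V n q \<omega> $ l))) \<in> borel_measurable (F u)"
    proof (intro borel_measurable_uminus borel_measurable_cINF_real)
      show "(\<lambda>\<omega>. V n q \<omega> $ l) \<in> borel_measurable (F u)" for n
        using V[of n] that by (intro measurable_F_mono[OF that(2)]) (auto simp: admissible_iff)
    qed auto
    also have "(\<lambda>\<omega>. - (INF n. - (V n q \<omega> $ l))) = (\<lambda>\<omega>. G l \<omega> q)"
      by (simp add: G_def Inf_real_def image_image)
    finally show ?thesis .
  qed
  have "W \<in> admissible P T F"
    unfolding admissible_iff
  proof (intro allI conjI ballI)
    fix l :: 'd and t assume t: "t \<in> {0..T}"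
    have N_in: "N \<in> sets (F u)" for u using N0(1) null_F by blast
    show "(\<lambda>\<omega>. W t \<omega> $ l) \<in> borel_measurable (F t)"
    proof (cases "t = T")
      case True
      have "(\<lambda>\<omega>. if \<omega> \<in> N then 0 else G l \<omega> T) \<in> borel_measurable (F T)"
        using N_in G_meas[of T T l] T_pos by (intro measurable_If_set) auto
      also have "?this \<longleftrightarrow> ?thesis"
        unfolding True
        by (intro measurable_cong) (auto simp: W_def space_F env_end)
      finally show ?thesis .
    next
      case False
      show ?thesis
      proof (rule measurable_F_right)
        show "t < T" using False t by auto
        fix u assume u: "t < u" "u < T"
        have "countable (later_times T t \<inter> {..<u})"
          by (rule countable_subset[of _ "insert T \<rat>"]) (auto simp: later_times_def countable_rat)
        hence "(\<lambda>\<omega>. INF q\<in>later_times T t \<inter> {..<u}. G l \<omega> q) \<in> borel_measurable (F u)"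
          using t by (intro borel_measurable_cINF_real G_meas) (auto simp: later_times_def)
        hence "(\<lambda>\<omega>. if \<omega> \<in> N then 0 else INF q\<in>later_times T t \<inter> {..<u}. G l \<omega> q)
            \<in> borel_measurable (F u)"
          using N_in by (intro measurable_If_set) auto
        also have "?this \<longleftrightarrow> (\<lambda>\<omega>. W t \<omega> $ l) \<in> borel_measurable (F u)"
          using t u
          by (intro measurable_cong) (auto simp: W_def space_F env_restrict)
        finally show "(\<lambda>\<omega>. W t \<omega> $ l) \<in> borel_measurable (F u)" .
      qed
    qed
  next
    fix l :: 'd and \<omega> assume "\<omega> \<in> space P"
    thus "rc_increasing T (\<lambda>t. W t \<omega> $ l)"
      using env_rc[of \<omega> l]
      by (cases "\<omega> \<in> N") (auto simp: W_def rc_increasing_def mono_on_def)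
  qed
  moreover have "AE \<omega> in P. (\<forall>n. \<forall>t\<in>{0..T}. V n t \<omega> \<le> W t \<omega>) \<and>
    (\<lambda>n. V n T \<omega>) \<longlonglongrightarrow> W T \<omega> \<and>
    (\<exists>E. countable E \<and> (\<forall>t\<in>{0..T} - E. (\<lambda>n. V n t \<omega>) \<longlonglongrightarrow> W t \<omega>))"
    using AE_not_in[OF N0(1)] AE_space
  proof eventually_elim
    case (elim \<omega>)
    hence \<omega>: "\<omega> \<in> space P" "\<omega> \<notin> N" by auto
    have W: "W t \<omega> $ l = right_envelope T (G l \<omega>) t" for t l using \<omega> by (simp add: W_def)
    have "V n t \<omega> \<le> W t \<omega>" if "t \<in> {0..T}" for n t
      unfolding less_eq_vec_def W
    proof
      fix l
      have "V n t \<omega> $ l \<le> G l \<omega> t" by (rule V_le_G[OF \<omega> that])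
      also have "\<dots> \<le> right_envelope T (G l \<omega>) t"
        using that by (intro env_ge[OF \<omega>]) auto
      finally show "V n t \<omega> $ l \<le> right_envelope T (G l \<omega>) t" .
    qed
    moreover have "(\<lambda>n. V n T \<omega>) \<longlonglongrightarrow> W T \<omega>"
    proof (rule vec_tendstoI)
      fix l show "(\<lambda>n. V n T \<omega> $ l) \<longlonglongrightarrow> W T \<omega> $ l"
        unfolding W env_end[OF \<omega>] using T_pos by (intro G_lim[OF \<omega>]) simp
    qed
    moreover define E where "E = (\<Union>l. {t\<in>{0..T}. right_envelope T (G l \<omega>) t \<noteq> G l \<omega> t})"
    have "countable E"
      unfolding E_def by (intro countable_UN env_countable[OF \<omega>]) auto
    moreover have "(\<lambda>n. V n t \<omega>) \<longlonglongrightarrow> W t \<omega>" if t: "t \<in> {0..T} - E" for t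
    proof (rule vec_tendstoI)
      fix l
      have "W t \<omega> $ l = G l \<omega> t" using t unfolding W E_def by blast
      thus "(\<lambda>n. V n t \<omega> $ l) \<longlonglongrightarrow> W t \<omega> $ l" using G_lim[OF \<omega>, of t l] t by simp
    qed
    ultimately show ?case by blast
  qed
  ultimately show ?thesis by blast
qed

text \<open>
  A countable subfamily that carries the essential suprema at rational times can be made
  increasing without leaving \<open>S\<close>, so that the limit of an increasing sequence
  with bounded expectations applies.
\<close>

lemma directed_upper_bound:
  fixes S :: "('w, 'd::finite) proc set"
  assumes S: "S \<subseteq> admissible P T F" "S \<noteq> {}"
    and sup: "\<And>U V. U \<in> S \<Longrightarrow> V \<in> S \<Longrightarrow> (\<lambda>t \<omega>. sup (U t \<omega>) (V t \<omega>)) \<in> S"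
    and bnd: "\<And>V. V \<in> S \<Longrightarrow> (\<integral>\<^sup>+\<omega>. ennreal (norm (V T \<omega>)) \<partial>P) \<le> ennreal c"
  shows "\<exists>W\<in>admissible P T F. \<forall>V\<in>S. proc_le P T V W"
proof -
  define I where "I = insert T (\<rat> \<inter> {0..T}) \<times> (UNIV :: 'd set)"
  define G where "G i V \<omega> = V (fst i) \<omega> $ snd i" for i :: "real \<times> 'd" and V :: "('w, 'd) proc" and \<omega> :: 'w
  have "countable I" 
    unfolding I_def by (intro countable_SIGMA countable_insert countable_Int1 countable_rat) simp
  moreover have "G i s \<in> borel_measurable P" if "i \<in> I" "s \<in> S" for i s
  proof -
    have "s (fst i) \<in> borel_measurable P"
      using that S T_pos by (intro admissible_measurable) (auto simp: I_def)
    thus ?thesis unfolding G_def vec_borel_measurable_iff by simp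
  qed
  ultimately obtain V :: "nat \<Rightarrow> _" where V: "range V \<subseteq> S"
    "\<And>u. u \<in> S \<Longrightarrow> AE \<omega> in P. \<forall>i\<in>I. \<forall>b. (\<forall>n. G i (V n) \<omega> \<le> b) \<longrightarrow> G i u \<omega> \<le> b"
    using essential_upper_bound[OF finite_measure_axioms, of I S G] S(2) by blast
  define X where "X = rec_nat (V 0) (\<lambda>n Y t \<omega>. sup (Y t \<omega>) (V (Suc n) t \<omega>))"
  have X0: "X 0 = V 0" and XS: "\<And>n. X (Suc n) = (\<lambda>t \<omega>. sup (X n t \<omega>) (V (Suc n) t \<omega>))"
    by (auto simp: X_def)
  have X_in: "X n \<in> S" for n
    using V(1) by (induction n) (auto simp: X0 XS intro!: sup)
  have VX: "V n t \<omega> \<le> X n t \<omega>" for n t \<omega>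
    by (cases n) (auto simp: X0 XS)
  obtain W where W: "W \<in> admissible P T F" "AE \<omega> in P. \<forall>n. \<forall>t\<in>{0..T}. X n t \<omega> \<le> W t \<omega>"
  proof -
    have "\<exists>W\<in>admissible P T F. AE \<omega> in P. (\<forall>n. \<forall>t\<in>{0..T}. X n t \<omega> \<le> W t \<omega>) \<and>
        (\<lambda>n. X n T \<omega>) \<longlonglongrightarrow> W T \<omega> \<and>
        (\<exists>E. countable E \<and> (\<forall>t\<in>{0..T} - E. (\<lambda>n. X n t \<omega>) \<longlonglongrightarrow> W t \<omega>))"
      using X_in S bnd by (intro increasing_limit) (auto simp: XS)
    then obtain W where "W \<in> admissible P T F" "AE \<omega> in P. (\<forall>n. \<forall>t\<in>{0..T}. X n t \<omega> \<le> W t \<omega>) \<and>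
        (\<lambda>n. X n T \<omega>) \<longlonglongrightarrow> W T \<omega> \<and>
        (\<exists>E. countable E \<and> (\<forall>t\<in>{0..T} - E. (\<lambda>n. X n t \<omega>) \<longlonglongrightarrow> W t \<omega>))" by blast
    thus ?thesis by (intro that[of W]) (auto elim: eventually_mono)
  qed
  have "proc_le P T u W" if u: "u \<in> S" for u
  proof (rule proc_le_from_dense[OF _ W(1)])
    show "u \<in> admissible P T F" using u S by blast
    show "AE \<omega> in P. \<forall>q\<in>insert T (\<rat> \<inter> {0..T}). \<forall>l. u q \<omega> $ l \<le> W q \<omega> $ l"
      using V(2)[OF u] W(2)
    proof eventually_elim
      case (elim \<omega>)
      show ?case
      proof (intro ballI allI)
        fix q :: real and l :: 'd assume q: "q \<in> insert T (\<rat> \<inter> {0..T})"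
        have "G (q, l) (V n) \<omega> \<le> W q \<omega> $ l" for n
        proof -
          have "V n q \<omega> \<le> W q \<omega>"
            using order_trans[OF VX[of n q \<omega>]] elim(2) q T_pos by auto
          thus ?thesis by (simp add: G_def less_eq_vec_def)
        qed
        hence "G (q, l) u \<omega> \<le> W q \<omega> $ l" using elim(1) q by (auto simp: I_def)
        thus "u q \<omega> $ l \<le> W q \<omega> $ l" by (simp add: G_def)
      qed
    qed
  qed
  thus ?thesis using W(1) by blast
qed

end

section \<open>The filtration of the game\<close>

text \<open>
  An event known at all times in \<open>(t, T)\<close> belongs to the augmented sigma-algebra
  of each time after \<open>t\<close>, because some time of \<open>(t, T)\<close> comes
  before it.
\<close>

lemma rc_filtration_usual:
  fixes Z :: "real \<Rightarrow> 'w \<Rightarrow> 'a::topological_space"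
  assumes P: "prob_space P" and T: "T > 0" and Z: "\<And>t. t \<in> {0..T} \<Longrightarrow> Z t \<in> borel_measurable P"
  shows "usual_filtration P T (rc_filtration P T Z)"
proof -
  define gen where "gen t = {Z s -` B \<inter> space P | s B. 0 \<le> s \<and> s \<le> t \<and> s \<le> T \<and> B \<in> sets borel} \<union> null_sets P" for t
  define aug where "aug t = augmented_sets P T Z t" for t
  have aug: "aug t = sigma_sets (space P) (gen t)" for t
    by (simp add: aug_def augmented_sets_def gen_def)
  have gen_P: "gen t \<subseteq> sets P" for t
    using Z by (auto simp: gen_def intro!: measurable_sets)
  hence gen_Pow: "gen t \<subseteq> Pow (space P)" for t using sets.space_closed by blast
  have sa: "sigma_algebra (space P) (aug t)" for t
    unfolding aug by (rule sigma_algebra_sigma_sets[OF gen_Pow])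
  have aug_P: "aug t \<subseteq> sets P" for t unfolding aug by (rule sets.sigma_sets_subset[OF gen_P])
  define F where "F = rc_filtration P T Z"
  have aug_Pow: "(\<Inter>u\<in>{t<..}. aug u) \<subseteq> Pow (space P)" for t
    using aug_P[of "t + 1"] sets.space_closed[of P] by fastforce
  have F_eq: "F t = sigma (space P) (\<Inter>u\<in>{t<..}. aug u)" for t
    by (simp add: F_def rc_filtration_def aug_def)
  have sets_F: "sets (F t) = (\<Inter>u\<in>{t<..}. aug u)" for t
  proof -
    have sub: "sigma_sets (space P) (\<Inter>u\<in>{t<..}. aug u) \<subseteq> aug v" if "v \<in> {t<..}" for v
      by (rule sigma_algebra.sigma_sets_subset[OF sa]) (use that in blast)
    have "sigma_sets (space P) (\<Inter>u\<in>{t<..}. aug u) = (\<Inter>u\<in>{t<..}. aug u)"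
      using sub by (intro antisym INF_greatest sigma_sets_superset_generator)
    thus ?thesis unfolding F_eq sets_measure_of[OF aug_Pow] .
  qed
  interpret prob_space P by (rule P)
  have "usual_filtration P T F"
  proof
    show "T > 0" by (rule T)
    show "space (F t) = space P" for t unfolding F_eq by (rule space_measure_of[OF aug_Pow])
    show "sets (F t) \<subseteq> sets P" for t unfolding sets_F using aug_P[of "t + 1"] by fastforce
    show "sets (F s) \<subseteq> sets (F t)" if "s \<le> t" for s t
      unfolding sets_F using that by (intro INF_superset_mono) auto
    show "null_sets P \<subseteq> sets (F t)" for t
    proof -
      have "null_sets P \<subseteq> aug u" for u unfolding aug gen_def by (auto intro: sigma_sets.Basic)
      thus ?thesis unfolding sets_F by blast
    qed
    show "(\<Inter>u\<in>{t<..<T}. sets (F u)) \<subseteq> sets (F t)" if "t < T" for t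
    proof
      fix X assume X: "X \<in> (\<Inter>u\<in>{t<..<T}. sets (F u))"
      show "X \<in> sets (F t)"
        unfolding sets_F
      proof
        fix v assume "v \<in> {t<..}"
        hence "t < min v T" using that by simp
        then obtain u where "t < u" "u < min v T" using dense_order_class.dense by blast
        thus "X \<in> aug v" using X unfolding sets_F by auto
      qed
    qed
  qed
  thus ?thesis by (simp add: F_def)
qed

section \<open>Costs\<close>

lemma replace_block_nth: "replace_block a i v $ j = (if j = i then v else a $ j)"
  by (simp add: replace_block_def)

text \<open>
  By decreasing differences, the increment from \<open>u\<close> to \<open>sup v u\<close>
  is no larger against the larger actions \<open>b\<close> of the opponents than against
  \<open>a\<close>; by submodularity, the latter is at most the increment from
  \<open>inf v u\<close> to \<open>v\<close>.
\<close>

lemma cross_submodular: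
  fixes \<phi> :: "(real ^ 'd::finite) ^ 'n::finite \<Rightarrow> real"
  assumes dd: "decreasing_differences i \<phi>" and sm: "submodular_in i \<phi>"
    and ab: "\<And>j. j \<noteq> i \<Longrightarrow> a $ j \<le> b $ j"
  shows "\<phi> (replace_block b i (sup v u)) + \<phi> (replace_block a i (inf v u)) \<le>
    \<phi> (replace_block b i u) + \<phi> (replace_block a i v)"
proof -
  let ?a = "replace_block a i u" and ?b = "replace_block b i (sup v u)"
  have r: "replace_block ?a i w = replace_block a i w" "replace_block ?b i w = replace_block b i w"
    "replace_block (replace_block a i v) i w = replace_block a i w" for w
    by (simp_all add: vec_eq_iff replace_block_nth)
  have "?a \<le> ?b" using ab by (simp add: less_eq_vec_def[of ?a] replace_block_nth)
  hence "\<phi> (replace_block ?a i (?b $ i)) - \<phi> ?a \<ge> \<phi> ?b - \<phi> (replace_block ?b i (?a $ i))"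
    using dd unfolding decreasing_differences_def by blast
  moreover have "\<phi> (replace_block ?a i (replace_block a i v $ i)) + \<phi> ?a \<ge>
      \<phi> (replace_block ?a i (inf (replace_block a i v $ i) (?a $ i))) +
      \<phi> (replace_block ?a i (sup (replace_block a i v $ i) (?a $ i)))"
    using sm unfolding submodular_in_def by blast
  ultimately show ?thesis unfolding r replace_block_nth by simp
qed

lemma strictly_convex_midpoint:
  assumes "strictly_convex \<phi>"
  shows "2 * \<phi> ((1 / 2) *\<^sub>R (u + v)) \<le> \<phi> u + \<phi> v"
    and "2 * \<phi> ((1 / 2) *\<^sub>R (u + v)) = \<phi> u + \<phi> v \<Longrightarrow> u = v"
proof -
  have lt: "2 * \<phi> ((1 / 2) *\<^sub>R (u + v)) < \<phi> u + \<phi> v" if "u \<noteq> v"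
  proof -
    have "\<phi> ((1 - 1 / 2) *\<^sub>R u + (1 / 2) *\<^sub>R v) < (1 - 1 / 2) * \<phi> u + (1 / 2) * \<phi> v"
      by (rule assms[unfolded strictly_convex_def, rule_format]) (use that in auto)
    moreover have "(1 - 1 / 2) *\<^sub>R u + (1 / 2) *\<^sub>R v = (1 / 2) *\<^sub>R (u + v)"
      by (simp add: scaleR_add_right)
    ultimately show ?thesis by simp
  qed
  have eq: "(1 / 2) *\<^sub>R (u + v) = u" if "u = v"
    using that by (simp add: scaleR_2[symmetric])
  show "2 * \<phi> ((1 / 2) *\<^sub>R (u + v)) \<le> \<phi> u + \<phi> v" using lt eq by fastforce
  show "2 * \<phi> ((1 / 2) *\<^sub>R (u + v)) = \<phi> u + \<phi> v \<Longrightarrow> u = v" using lt by force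
qed

lemma lower_semicont_liminf:
  assumes "lower_semicont \<phi>" and "x \<longlonglongrightarrow> y"
  shows "ennreal (\<phi> y) \<le> liminf (\<lambda>n. ennreal (\<phi> (x n)))"
  unfolding le_Liminf_iff
proof (intro allI impI)
  fix z assume z: "z < ennreal (\<phi> y)"
  then obtain c where c: "z = ennreal c" "0 \<le> c" by (cases z) auto
  have "c < \<phi> y" using z c by (simp add: ennreal_less_iff)
  hence "eventually (\<lambda>v. c < \<phi> v) (nhds y)" using assms(1) by (auto simp: lower_semicont_def)
  hence "eventually (\<lambda>n. c < \<phi> (x n)) sequentially"
    using assms(2) by (rule eventually_compose_filterlim)
  thus "eventually (\<lambda>n. z < ennreal (\<phi> (x n))) sequentially"
    using c by (auto simp: ennreal_less_iff elim!: eventually_mono)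
qed

lemma ennreal_liminf_add_le:
  fixes a b :: "nat \<Rightarrow> ennreal"
  shows "liminf a + liminf b \<le> liminf (\<lambda>n. a n + b n)"
proof -
  have "liminf a + liminf b = (SUP n. (INF m\<in>{n..}. a m) + (INF m\<in>{n..}. b m))"
    unfolding liminf_SUP_INF
    by (intro ennreal_SUP_add[symmetric]) (auto simp: incseq_def intro!: INF_superset_mono)
  also have "\<dots> \<le> liminf (\<lambda>n. a n + b n)"
    unfolding liminf_SUP_INF
    by (intro SUP_mono bexI[of _ "_ :: nat"]) (auto intro!: INF_greatest add_mono INF_lower)
  finally show ?thesis .
qed

lemma ennreal_cancel:
  fixes a b c :: ennreal
  assumes "c < \<infinity>"
  shows "a + c = b + c \<Longrightarrow> a = b" and "c + a \<le> c + b \<Longrightarrow> a \<le> b"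
  using assms by (auto simp: add.commute[of _ c] ennreal_add_left_cancel ennreal_add_left_cancel_le)

locale follower_game = usual_filtration P T F
  for P :: "'w measure" and T :: real and F :: "real \<Rightarrow> 'w measure" +
  fixes L :: "('w, 'k::finite) proc" and f :: "('w, 'd::finite, 'n::finite) profile"
    and h g :: "'n \<Rightarrow> real ^ 'k \<Rightarrow> (real ^ 'd) ^ 'n \<Rightarrow> real"
    and K \<kappa> M :: real
  assumes L_meas: "\<And>t. t \<in> {0..T} \<Longrightarrow> L t \<in> borel_measurable P"
    and L_cadlag: "\<And>\<omega>. \<omega> \<in> space P \<Longrightarrow> cadlag_on T (\<lambda>t. L t \<omega>)"
    and f_meas: "\<And>i t. t \<in> {0..T} \<Longrightarrow> f i t \<in> borel_measurable P"
    and f_nonneg: "\<And>i t \<omega>. t \<in> {0..T} \<Longrightarrow> \<omega> \<in> space P \<Longrightarrow> 0 \<le> f i t \<omega>"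
    and f_cont: "\<And>i l \<omega>. \<omega> \<in> space P \<Longrightarrow> continuous_on {0..T} (\<lambda>t. f i t \<omega> $ l)"
    and h_meas: "\<And>i. (\<lambda>(l, a). h i l a) \<in> borel_measurable borel"
    and g_meas: "\<And>i. (\<lambda>(l, a). g i l a) \<in> borel_measurable borel"
    and h_nonneg: "\<And>i l a. 0 \<le> h i l a"
    and g_nonneg: "\<And>i l a. 0 \<le> g i l a"
    and lsc: "\<And>i \<phi> l a. \<phi> \<in> {h i, g i} \<Longrightarrow> lower_semicont (\<lambda>v. \<phi> l (replace_block a i v))"
    and convex: "\<And>i \<phi> l a. \<phi> \<in> {h i, g i} \<Longrightarrow> strictly_convex (\<lambda>v. \<phi> l (replace_block a i v))"
    and decr_diff: "\<And>i \<phi> l. \<phi> \<in> {h i, g i} \<Longrightarrow> decreasing_differences i (\<phi> l)"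
    and submod: "\<And>i \<phi> l. \<phi> \<in> {h i, g i} \<Longrightarrow> submodular_in i (\<phi> l)"
    and \<kappa>_pos: "\<kappa> > 0"
    and coercive:
      "\<And>i A. A \<in> admissible_profiles P T F \<Longrightarrow>
        (\<integral>\<^sup>+\<omega>. ennreal (norm (A i T \<omega>)) \<partial>P) \<ge> ennreal K \<Longrightarrow>
        cost P T L f h g i A \<ge> ennreal \<kappa> * (\<integral>\<^sup>+\<omega>. ennreal (norm (A i T \<omega>)) \<partial>P)"
    and M_pos: "M > 0"
    and bounded_reply:
      "\<And>i A. A \<in> admissible_profiles P T F \<Longrightarrow>
        \<exists>r \<in> admissible P T F. cost P T L f h g i (A(i := r)) \<le> ennreal M"
begin

abbreviation "strategies \<equiv> admissible P T F"
abbreviation "profiles \<equiv> (admissible_profiles P T F :: ('w, 'd, 'n) profile set)"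
abbreviation "J \<equiv> cost P T L f h g"

definition "state A t \<omega> = (\<chi> j. A j t \<omega>)" for A :: "('w, 'd, 'n) profile"
definition "running i A \<omega> t = ennreal (h i (L t \<omega>) (state A t \<omega>)) * indicator {0..T} t"
definition "running_cost i A \<omega> = (\<integral>\<^sup>+t. running i A \<omega> t \<partial>lborel)"
definition "final_cost i A \<omega> = ennreal (g i (L T \<omega>) (state A T \<omega>))"
definition "control_cost i A \<omega> = stieltjes T (\<lambda>t. f i t \<omega>) (\<lambda>t. A i t \<omega>)" for A :: "('w, 'd, 'n) profile"
definition "pathwise_cost i A \<omega> = running_cost i A \<omega> + final_cost i A \<omega> + control_cost i A \<omega>"

lemma J_eq: "J i A = (\<integral>\<^sup>+\<omega>. pathwise_cost i A \<omega> \<partial>P)"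
  by (simp add: cost_def pathwise_cost_def running_cost_def running_def final_cost_def
      control_cost_def state_def)

lemma state_update: "state (A(i := V)) t \<omega> = replace_block (state A t \<omega>) i (V t \<omega>)"
  by (simp add: state_def vec_eq_iff replace_block_nth)

lemma profiles_update: "A \<in> profiles \<Longrightarrow> V \<in> strategies \<Longrightarrow> A(i := V) \<in> profiles"
  by (simp add: admissible_profiles_def)

lemma profilesD: "A \<in> profiles \<Longrightarrow> A i \<in> strategies"
  by (simp add: admissible_profiles_def)

lemma state_measurable:
  assumes "A \<in> profiles" "t \<in> {0..T}"
  shows "(\<lambda>\<omega>. (L t \<omega>, state A t \<omega>)) \<in> borel_measurable P"
proof -
  have "state A t \<in> borel_measurable P"
    unfolding state_def
    by (rule vec_borel_measurable_iff[THEN iffD2])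
      (use admissible_measurable[OF profilesD[OF assms(1)] assms(2)] in simp)
  thus ?thesis using L_meas[OF assms(2)] by (rule borel_measurable_Pair[rotated])
qed

lemma state_right_continuous:
  assumes "A \<in> profiles" "t \<in> {0..<T}" "\<omega> \<in> space P"
  shows "((\<lambda>t. (L t \<omega>, state A t \<omega>)) \<longlongrightarrow> (L t \<omega>, state A t \<omega>)) (at_right t)"
proof (rule tendsto_Pair)
  show "((\<lambda>t. L t \<omega>) \<longlongrightarrow> L t \<omega>) (at_right t)"
    using L_cadlag[OF assms(3)] assms(2) by (simp add: cadlag_on_def)
  show "((\<lambda>t. state A t \<omega>) \<longlongrightarrow> state A t \<omega>) (at_right t)"
  proof (rule vec_tendstoI)
    fix j show "((\<lambda>t. state A t \<omega> $ j) \<longlongrightarrow> state A t \<omega> $ j) (at_right t)"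
      using profilesD[OF assms(1), of j] assms(2,3) by (simp add: admissible_def cadlag_on_def state_def)
  qed
qed

text \<open>
  Discretisation in time from the right. The grid times are strictly later than
  \<open>t\<close>, except that \<open>T\<close> is kept, and converge to \<open>t\<close>;
  the paths are right-continuous.
\<close>

lemma state_jointly_measurable:
  assumes A: "A \<in> profiles"
  shows "(\<lambda>(\<omega>, t). (L (max 0 (min t T)) \<omega>, state A (max 0 (min t T)) \<omega>))
    \<in> borel_measurable (P \<Otimes>\<^sub>M lborel)"
proof (rule borel_measurable_LIMSEQ_metric)
  define c where "c t = max 0 (min t T)" for t
  define d where "d n i = max 0 (min ((real_of_int i + 1) / (real n + 1)) T)" for n :: nat and i :: int
  define X where "X t \<omega> = (L t \<omega>, state A t \<omega>)" for t \<omega>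
  have c: "c t \<in> {0..T}" "d n i \<in> {0..T}" for t n i using T_pos by (auto simp: c_def d_def)
  show "(\<lambda>(\<omega>, t). X (d n \<lfloor>c t * (real n + 1)\<rfloor>) \<omega>) \<in> borel_measurable (P \<Otimes>\<^sub>M lborel)" for n
  proof -
    have "(\<lambda>x. X (d n \<lfloor>c (snd x) * (real n + 1)\<rfloor>) (fst x)) \<in> borel_measurable (P \<Otimes>\<^sub>M lborel)"
    proof (rule measurable_compose_countable)
      fix i show "(\<lambda>x. X (d n i) (fst x)) \<in> borel_measurable (P \<Otimes>\<^sub>M lborel)"
        using state_measurable[OF A c(2)] unfolding X_def by (rule measurable_compose[OF measurable_fst])
    next
      show "(\<lambda>x. \<lfloor>c (snd x) * (real n + 1)\<rfloor>) \<in> measurable (P \<Otimes>\<^sub>M lborel) (count_space UNIV)"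
        unfolding c_def by measurable
    qed
    thus ?thesis by (simp add: case_prod_beta)
  qed
  fix x :: "'w \<times> real" assume "x \<in> space (P \<Otimes>\<^sub>M lborel)"
  then obtain \<omega> and t :: real where x: "x = (\<omega>, t)" "\<omega> \<in> space P" by (auto simp: space_pair_measure)
  have gt: "c t < (real_of_int \<lfloor>c t * (real n + 1)\<rfloor> + 1) / (real n + 1)"
    and le: "(real_of_int \<lfloor>c t * (real n + 1)\<rfloor> + 1) / (real n + 1) \<le> c t + 1 / (real n + 1)" for n :: nat
  proof -
    let ?z = "c t * (real n + 1)"
    have "?z / (real n + 1) < (real_of_int \<lfloor>?z\<rfloor> + 1) / (real n + 1)"
      by (intro divide_strict_right_mono) linarith+
    thus "c t < (real_of_int \<lfloor>?z\<rfloor> + 1) / (real n + 1)" by simp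
    have "(real_of_int \<lfloor>?z\<rfloor> + 1) / (real n + 1) \<le> (?z + 1) / (real n + 1)"
      by (intro divide_right_mono) linarith+
    also have "\<dots> = c t + 1 / (real n + 1)" by (simp add: add_divide_distrib)
    finally show "(real_of_int \<lfloor>?z\<rfloor> + 1) / (real n + 1) \<le> c t + 1 / (real n + 1)" .
  qed
  have "(\<lambda>n. X (d n \<lfloor>c t * (real n + 1)\<rfloor>) \<omega>) \<longlonglongrightarrow> X (c t) \<omega>"
  proof (cases "c t = T")
    case True
    have "d n \<lfloor>c t * (real n + 1)\<rfloor> = T" for n using gt[of n] True T_pos by (simp add: d_def)
    thus ?thesis using True by simp
  next
    case False
    hence ct: "c t \<in> {0..<T}" using c(1)[of t] by auto
    have "(\<lambda>n. d n \<lfloor>c t * (real n + 1)\<rfloor>) \<longlonglongrightarrow> c t"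
    proof (rule tendsto_sandwich)
      show "(\<lambda>n. c t) \<longlonglongrightarrow> c t" by simp
      show "(\<lambda>n. c t + 1 / (real n + 1)) \<longlonglongrightarrow> c t"
        using LIMSEQ_inverse_real_of_nat_add[of "c t"] by (simp add: inverse_eq_divide add.commute)
      show "eventually (\<lambda>n. c t \<le> d n \<lfloor>c t * (real n + 1)\<rfloor>) sequentially"
        using gt ct by (auto simp: d_def le_max_iff_disj less_imp_le)
      show "eventually (\<lambda>n. d n \<lfloor>c t * (real n + 1)\<rfloor> \<le> c t + 1 / (real n + 1)) sequentially"
      proof (intro always_eventually allI)
        fix n :: nat
        show "d n \<lfloor>c t * (real n + 1)\<rfloor> \<le> c t + 1 / (real n + 1)"
          using le[of n] ct unfolding d_def by (auto simp: min_le_iff_disj)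
      qed
    qed
    moreover have "d n \<lfloor>c t * (real n + 1)\<rfloor> > c t" for n
      using gt[of n] ct by (auto simp: d_def)
    ultimately have "filterlim (\<lambda>n. d n \<lfloor>c t * (real n + 1)\<rfloor>) (at_right (c t)) sequentially"
      by (intro tendsto_imp_filterlim_at_right always_eventually) auto
    thus ?thesis
      using state_right_continuous[OF A ct x(2)] unfolding X_def
      by (rule filterlim_compose[rotated])
  qed
  thus "(\<lambda>n. case x of (\<omega>, t) \<Rightarrow> X (d n \<lfloor>c t * (real n + 1)\<rfloor>) \<omega>) \<longlonglongrightarrow>
      (case x of (\<omega>, t) \<Rightarrow> (L (max 0 (min t T)) \<omega>, state A (max 0 (min t T)) \<omega>))"
    by (simp add: x X_def c_def)
qed

lemma running_jointly_measurable:
  assumes "A \<in> profiles"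
  shows "(\<lambda>(\<omega>, t). running i A \<omega> t) \<in> borel_measurable (P \<Otimes>\<^sub>M lborel)"
proof -
  have "(\<lambda>x. case (case x of (\<omega>, t) \<Rightarrow> (L (max 0 (min t T)) \<omega>, state A (max 0 (min t T)) \<omega>))
      of (l, a) \<Rightarrow> h i l a) \<in> borel_measurable (P \<Otimes>\<^sub>M lborel)"
    by (rule measurable_compose[OF state_jointly_measurable[OF assms] h_meas])
  hence "(\<lambda>x. ennreal (case (case x of (\<omega>, t) \<Rightarrow> (L (max 0 (min t T)) \<omega>, state A (max 0 (min t T)) \<omega>))
      of (l, a) \<Rightarrow> h i l a) * indicator {0..T} (snd x)) \<in> borel_measurable (P \<Otimes>\<^sub>M lborel)"
    by measurable
  also have "(\<lambda>x. ennreal (case (case x of (\<omega>, t) \<Rightarrow> (L (max 0 (min t T)) \<omega>, state A (max 0 (min t T)) \<omega>))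
      of (l, a) \<Rightarrow> h i l a) * indicator {0..T} (snd x)) = (\<lambda>(\<omega>, t). running i A \<omega> t)"
    by (rule ext) (auto simp: running_def split: prod.splits split_indicator)
  finally show ?thesis .
qed

lemma running_measurable:
  assumes "A \<in> profiles" "\<omega> \<in> space P"
  shows "running i A \<omega> \<in> borel_measurable lborel"
  using measurable_compose[OF measurable_Pair1'[OF assms(2)] running_jointly_measurable[OF assms(1)]]
  by simp

lemma running_cost_measurable: "A \<in> profiles \<Longrightarrow> running_cost i A \<in> borel_measurable P"
  unfolding running_cost_def
  by (intro lborel.borel_measurable_nn_integral) (rule running_jointly_measurable)

lemma final_cost_measurable: "A \<in> profiles \<Longrightarrow> final_cost i A \<in> borel_measurable P"
proof -
  assume "A \<in> profiles"
  hence "(\<lambda>\<omega>. case (L T \<omega>, state A T \<omega>) of (l, a) \<Rightarrow> g i l a) \<in> borel_measurable P"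
    using T_pos by (intro measurable_compose[OF state_measurable g_meas]) auto
  thus ?thesis unfolding final_cost_def by simp
qed

lemma f_path: "\<omega> \<in> space P \<Longrightarrow> t \<in> {0..T} \<Longrightarrow> 0 \<le> f i t \<omega> $ l"
  using f_nonneg[of t \<omega> i] by (simp add: less_eq_vec_def)

lemma control_cost_eq:
  assumes "A \<in> profiles" "\<omega> \<in> space P"
  shows "control_cost i A \<omega> = ennreal (\<Sum>l\<in>UNIV. stieltjes1 T (\<lambda>t. f i t \<omega> $ l) (\<lambda>t. A i t \<omega> $ l))"
proof -
  have rc: "rc_increasing T (\<lambda>t. A i t \<omega> $ l)" for l
    by (rule admissible_rc[OF profilesD[OF assms(1)] assms(2)])
  have nn: "0 \<le> f i 0 \<omega> $ l * A i 0 \<omega> $ l" for l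
    using f_path[OF assms(2), of 0] rc_increasingD(2)[OF rc, of 0] T_pos by simp
  have "control_cost i A \<omega> = (\<Sum>l\<in>UNIV. ennreal (f i 0 \<omega> $ l * A i 0 \<omega> $ l)) +
    (\<Sum>l\<in>UNIV. \<integral>\<^sup>+t\<in>{0<..T}. ennreal (f i t \<omega> $ l)
       \<partial>interval_measure (\<lambda>t. A i (max 0 (min t T)) \<omega> $ l))"
    using nn by (simp add: control_cost_def stieltjes_def inner_vec_def sum_ennreal)
  also have "\<dots> = (\<Sum>l\<in>UNIV. ennreal (stieltjes1 T (\<lambda>t. f i t \<omega> $ l) (\<lambda>t. A i t \<omega> $ l)))"
    unfolding sum.distrib[symmetric]
    by (intro sum.cong refl stieltjes1_enn(1)[symmetric] T_pos rc f_cont f_path assms)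
  also have "\<dots> = ennreal (\<Sum>l\<in>UNIV. stieltjes1 T (\<lambda>t. f i t \<omega> $ l) (\<lambda>t. A i t \<omega> $ l))"
    by (intro sum_ennreal stieltjes1_enn(2) T_pos rc f_cont f_path assms)
  finally show ?thesis .
qed

lemma stieltjes1_path_nonneg:
  assumes "A \<in> profiles" "\<omega> \<in> space P"
  shows "0 \<le> (\<Sum>l\<in>UNIV. stieltjes1 T (\<lambda>t. f i t \<omega> $ l) (\<lambda>t. A i t \<omega> $ l))"
  by (intro sum_nonneg stieltjes1_enn(2) T_pos admissible_rc[OF profilesD[OF assms(1)] assms(2)]
      f_cont f_path assms(2))

lemma control_cost_measurable:
  assumes "A \<in> profiles"
  shows "control_cost i A \<in> borel_measurable P"
proof -
  have "(\<lambda>\<omega>. stieltjes1 T (\<lambda>t. f i t \<omega> $ l) (\<lambda>t. A i t \<omega> $ l)) \<in> borel_measurable P" for l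
  proof (rule stieltjes1_measurable[OF T_pos])
    fix t assume t: "t \<in> {0..T}"
    show "(\<lambda>\<omega>. f i t \<omega> $ l) \<in> borel_measurable P" using f_meas[OF t] by (simp add: vec_borel_measurable_iff)
    show "(\<lambda>\<omega>. A i t \<omega> $ l) \<in> borel_measurable P"
      using admissible_measurable[OF profilesD[OF assms] t] by (simp add: vec_borel_measurable_iff)
  qed (intro f_cont f_path admissible_rc[OF profilesD[OF assms]]; assumption)+
  hence "(\<lambda>\<omega>. ennreal (\<Sum>l\<in>UNIV. stieltjes1 T (\<lambda>t. f i t \<omega> $ l) (\<lambda>t. A i t \<omega> $ l))) \<in> borel_measurable P"
    by simp
  also have "?this \<longleftrightarrow> ?thesis"
    by (intro measurable_cong) (simp add: control_cost_eq[OF assms])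
  finally show ?thesis .
qed

lemma pathwise_cost_measurable: "A \<in> profiles \<Longrightarrow> pathwise_cost i A \<in> borel_measurable P"
  unfolding pathwise_cost_def
  by (intro borel_measurable_add running_cost_measurable final_cost_measurable control_cost_measurable)

lemma control_cost_pair:
  assumes A: "A1 \<in> profiles" "A2 \<in> profiles" "A3 \<in> profiles" "A4 \<in> profiles" and \<omega>: "\<omega> \<in> space P"
    and eq: "\<And>t. A1 i t \<omega> + A2 i t \<omega> = A3 i t \<omega> + A4 i t \<omega>"
  shows "control_cost i A1 \<omega> + control_cost i A2 \<omega> = control_cost i A3 \<omega> + control_cost i A4 \<omega>"
proof -
  let ?S = "\<lambda>A l. stieltjes1 T (\<lambda>t. f i t \<omega> $ l) (\<lambda>t. A i t \<omega> $ l)"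
  have add: "?S A l + ?S B l = stieltjes1 T (\<lambda>t. f i t \<omega> $ l) (\<lambda>t. (A i t \<omega> + B i t \<omega>) $ l)"
    if "A \<in> profiles" "B \<in> profiles" for A B l
    unfolding vector_add_component
    by (rule stieltjes1_add[symmetric])
      (intro T_pos f_cont f_path admissible_rc[OF profilesD[OF that(1)]]
        admissible_rc[OF profilesD[OF that(2)]] \<omega>; assumption)+
  have "?S A1 l + ?S A2 l = ?S A3 l + ?S A4 l" for l
    unfolding add[OF A(1,2)] add[OF A(3,4)] eq ..
  hence "(\<Sum>l\<in>UNIV. ?S A1 l) + (\<Sum>l\<in>UNIV. ?S A2 l) = (\<Sum>l\<in>UNIV. ?S A3 l) + (\<Sum>l\<in>UNIV. ?S A4 l)"
    unfolding sum.distrib[symmetric] by simp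
  thus ?thesis
    unfolding control_cost_eq[OF A(1) \<omega>] control_cost_eq[OF A(2) \<omega>]
      control_cost_eq[OF A(3) \<omega>] control_cost_eq[OF A(4) \<omega>]
    using stieltjes1_path_nonneg[OF _ \<omega>] A by (simp flip: ennreal_plus)
qed

text \<open>
  Both uses of the cost inequalities compare the total cost of two pairs of profiles: sup and
  inf against two strategies, and the midpoint taken twice against two strategies. In both
  cases the sums of the controls coincide, hence so do the control costs, which are additive.
  As each remaining part satisfies the inequality, equality and finiteness of the totals force
  equality in each part.
\<close>

lemma pathwise_cost_pair:
  assumes A: "A1 \<in> profiles" "A2 \<in> profiles" "A3 \<in> profiles" "A4 \<in> profiles" and \<omega>: "\<omega> \<in> space P"
    and h: "\<And>t. t \<in> {0..T} \<Longrightarrow> h i (L t \<omega>) (state A1 t \<omega>) + h i (L t \<omega>) (state A2 t \<omega>) \<le>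
      h i (L t \<omega>) (state A3 t \<omega>) + h i (L t \<omega>) (state A4 t \<omega>)"
    and g: "g i (L T \<omega>) (state A1 T \<omega>) + g i (L T \<omega>) (state A2 T \<omega>) \<le>
      g i (L T \<omega>) (state A3 T \<omega>) + g i (L T \<omega>) (state A4 T \<omega>)"
    and eq: "\<And>t. A1 i t \<omega> + A2 i t \<omega> = A3 i t \<omega> + A4 i t \<omega>"
  shows pathwise_cost_pair_le:
      "pathwise_cost i A1 \<omega> + pathwise_cost i A2 \<omega> \<le> pathwise_cost i A3 \<omega> + pathwise_cost i A4 \<omega>"
    and pathwise_cost_pair_eq:
      "pathwise_cost i A1 \<omega> + pathwise_cost i A2 \<omega> = pathwise_cost i A3 \<omega> + pathwise_cost i A4 \<omega> \<Longrightarrow>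
       pathwise_cost i A1 \<omega> + pathwise_cost i A2 \<omega> < \<infinity> \<Longrightarrow>
       g i (L T \<omega>) (state A1 T \<omega>) + g i (L T \<omega>) (state A2 T \<omega>) =
         g i (L T \<omega>) (state A3 T \<omega>) + g i (L T \<omega>) (state A4 T \<omega>) \<and>
       (AE t in lborel. t \<in> {0..T} \<longrightarrow> h i (L t \<omega>) (state A1 t \<omega>) + h i (L t \<omega>) (state A2 t \<omega>) =
         h i (L t \<omega>) (state A3 t \<omega>) + h i (L t \<omega>) (state A4 t \<omega>))"
proof -
  let ?r = "\<lambda>A. running i A \<omega>" and ?R = "\<lambda>A. running_cost i A \<omega>"
  let ?G = "\<lambda>A. final_cost i A \<omega>" and ?C = "\<lambda>A. control_cost i A \<omega>"
  note rm[measurable] = running_measurable[OF A(1) \<omega>] running_measurable[OF A(2) \<omega>]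
    running_measurable[OF A(3) \<omega>] running_measurable[OF A(4) \<omega>]
  have r_le: "?r A1 t + ?r A2 t \<le> ?r A3 t + ?r A4 t" for t
    using h[of t] h_nonneg
    by (cases "t \<in> {0..T}") (simp_all add: running_def ennreal_leI flip: ennreal_plus)
  have R12: "?R A1 + ?R A2 = (\<integral>\<^sup>+t. ?r A1 t + ?r A2 t \<partial>lborel)"
    unfolding running_cost_def by (rule nn_integral_add[symmetric]) (rule rm)+
  have R34: "?R A3 + ?R A4 = (\<integral>\<^sup>+t. ?r A3 t + ?r A4 t \<partial>lborel)"
    unfolding running_cost_def by (rule nn_integral_add[symmetric]) (rule rm)+
  have R_le: "?R A1 + ?R A2 \<le> ?R A3 + ?R A4"
    unfolding R12 R34 using r_le by (intro nn_integral_mono)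
  have G_le: "?G A1 + ?G A2 \<le> ?G A3 + ?G A4"
    using g g_nonneg by (simp add: final_cost_def ennreal_leI flip: ennreal_plus)
  have C_eq: "?C A1 + ?C A2 = ?C A3 + ?C A4" by (rule control_cost_pair[OF A \<omega> eq])
  have split12: "pathwise_cost i A1 \<omega> + pathwise_cost i A2 \<omega> =
      (?R A1 + ?R A2) + (?G A1 + ?G A2) + (?C A1 + ?C A2)"
    unfolding pathwise_cost_def by (simp add: ac_simps)
  have split34: "pathwise_cost i A3 \<omega> + pathwise_cost i A4 \<omega> =
      (?R A3 + ?R A4) + (?G A3 + ?G A4) + (?C A1 + ?C A2)"
    unfolding pathwise_cost_def C_eq by (simp add: ac_simps)
  show "pathwise_cost i A1 \<omega> + pathwise_cost i A2 \<omega> \<le> pathwise_cost i A3 \<omega> + pathwise_cost i A4 \<omega>"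
    unfolding split12 split34 by (intro add_mono R_le G_le order_refl)
  assume same: "pathwise_cost i A1 \<omega> + pathwise_cost i A2 \<omega> = pathwise_cost i A3 \<omega> + pathwise_cost i A4 \<omega>"
    and fin: "pathwise_cost i A1 \<omega> + pathwise_cost i A2 \<omega> < \<infinity>"
  have sums: "(?R A1 + ?R A2) + (?G A1 + ?G A2) = (?R A3 + ?R A4) + (?G A3 + ?G A4)"
  proof -
    have "?C A1 + ?C A2 < \<infinity>" using fin unfolding split12 by (simp add: ennreal_add_less_top)
    thus ?thesis using same unfolding split12 split34 by (rule ennreal_cancel(1))
  qed
  have fin_R: "?R A1 + ?R A2 < \<infinity>" and fin_G: "?G A1 + ?G A2 < \<infinity>"
    using fin unfolding split12 by (simp_all add: ennreal_add_less_top)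
  have G_eq: "?G A1 + ?G A2 = ?G A3 + ?G A4"
  proof (rule antisym[OF G_le])
    have "(?R A1 + ?R A2) + (?G A3 + ?G A4) \<le> (?R A1 + ?R A2) + (?G A1 + ?G A2)"
      unfolding sums by (intro add_mono R_le order_refl)
    thus "?G A3 + ?G A4 \<le> ?G A1 + ?G A2" by (rule ennreal_cancel(2)[OF fin_R])
  qed
  have R_eq: "?R A1 + ?R A2 = ?R A3 + ?R A4"
    by (rule ennreal_cancel(1)[OF fin_G[unfolded G_eq] sums[unfolded G_eq]])
  have "AE t in lborel. ?r A1 t + ?r A2 t = ?r A3 t + ?r A4 t"
  proof (rule nn_integral_eq_imp_AE_eq)
    show "(\<integral>\<^sup>+t. ?r A3 t + ?r A4 t \<partial>lborel) \<le> (\<integral>\<^sup>+t. ?r A1 t + ?r A2 t \<partial>lborel)"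
      using R_eq unfolding R12 R34 by simp
    show "(\<integral>\<^sup>+t. ?r A1 t + ?r A2 t \<partial>lborel) < \<infinity>" using fin_R unfolding R12 .
  qed (use r_le in simp_all)
  hence "AE t in lborel. t \<in> {0..T} \<longrightarrow> h i (L t \<omega>) (state A1 t \<omega>) + h i (L t \<omega>) (state A2 t \<omega>) =
         h i (L t \<omega>) (state A3 t \<omega>) + h i (L t \<omega>) (state A4 t \<omega>)"
  proof eventually_elim
    case (elim t)
    have nn: "0 \<le> h i (L t \<omega>) (state B t \<omega>) + h i (L t \<omega>) (state C t \<omega>)" for B C
      by (intro add_nonneg_nonneg h_nonneg)
    show ?case
    proof
      assume "t \<in> {0..T}"
      hence "ennreal (h i (L t \<omega>) (state A1 t \<omega>) + h i (L t \<omega>) (state A2 t \<omega>)) =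
         ennreal (h i (L t \<omega>) (state A3 t \<omega>) + h i (L t \<omega>) (state A4 t \<omega>))"
        using elim by (simp add: running_def h_nonneg)
      thus "h i (L t \<omega>) (state A1 t \<omega>) + h i (L t \<omega>) (state A2 t \<omega>) =
         h i (L t \<omega>) (state A3 t \<omega>) + h i (L t \<omega>) (state A4 t \<omega>)"
        using nn by (subst (asm) ennreal_inj) auto
    qed
  qed
  moreover have "g i (L T \<omega>) (state A1 T \<omega>) + g i (L T \<omega>) (state A2 T \<omega>) =
         g i (L T \<omega>) (state A3 T \<omega>) + g i (L T \<omega>) (state A4 T \<omega>)"
  proof -
    have "ennreal (g i (L T \<omega>) (state A1 T \<omega>) + g i (L T \<omega>) (state A2 T \<omega>)) =
        ennreal (g i (L T \<omega>) (state A3 T \<omega>) + g i (L T \<omega>) (state A4 T \<omega>))"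
      using G_eq by (simp add: final_cost_def g_nonneg)
    thus ?thesis by (subst (asm) ennreal_inj) (auto intro!: add_nonneg_nonneg g_nonneg)
  qed
  ultimately show "g i (L T \<omega>) (state A1 T \<omega>) + g i (L T \<omega>) (state A2 T \<omega>) =
         g i (L T \<omega>) (state A3 T \<omega>) + g i (L T \<omega>) (state A4 T \<omega>) \<and>
       (AE t in lborel. t \<in> {0..T} \<longrightarrow> h i (L t \<omega>) (state A1 t \<omega>) + h i (L t \<omega>) (state A2 t \<omega>) =
         h i (L t \<omega>) (state A3 t \<omega>) + h i (L t \<omega>) (state A4 t \<omega>))" by blast
qed

lemma J_add:
  assumes "A \<in> profiles" "B \<in> profiles"
  shows "J i A + J i B = (\<integral>\<^sup>+\<omega>. pathwise_cost i A \<omega> + pathwise_cost i B \<omega> \<partial>P)"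
  unfolding J_eq by (rule nn_integral_add[symmetric]) (intro pathwise_cost_measurable assms)+

lemma J_cross_submodular:
  assumes A: "A \<in> profiles" and B: "B \<in> profiles" and U: "U \<in> strategies" and V: "V \<in> strategies"
    and le: "\<And>j. j \<noteq> i \<Longrightarrow> proc_le P T (A j) (B j)"
  shows "J i (B(i := \<lambda>t \<omega>. sup (V t \<omega>) (U t \<omega>))) + J i (A(i := \<lambda>t \<omega>. inf (V t \<omega>) (U t \<omega>))) \<le>
    J i (B(i := U)) + J i (A(i := V))"
proof -
  let ?A1 = "B(i := \<lambda>t \<omega>. sup (V t \<omega>) (U t \<omega>))" and ?A2 = "A(i := \<lambda>t \<omega>. inf (V t \<omega>) (U t \<omega>))"
  let ?A3 = "B(i := U)" and ?A4 = "A(i := V)"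
  have p: "?A1 \<in> profiles" "?A2 \<in> profiles" "?A3 \<in> profiles" "?A4 \<in> profiles"
    by (intro profiles_update A B U V admissible_sup admissible_inf)+
  have "AE \<omega> in P. \<forall>j. j \<noteq> i \<longrightarrow> (\<forall>t\<in>{0..T}. A j t \<omega> \<le> B j t \<omega>)"
    using le by (subst AE_all_countable) (auto simp: proc_le_def)
  hence "AE \<omega> in P. pathwise_cost i ?A1 \<omega> + pathwise_cost i ?A2 \<omega> \<le>
      pathwise_cost i ?A3 \<omega> + pathwise_cost i ?A4 \<omega>"
    using AE_space
  proof eventually_elim
    case (elim \<omega>)
    have cross: "\<phi> (L t \<omega>) (state ?A1 t \<omega>) + \<phi> (L t \<omega>) (state ?A2 t \<omega>) \<le>
        \<phi> (L t \<omega>) (state ?A3 t \<omega>) + \<phi> (L t \<omega>) (state ?A4 t \<omega>)"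
      if "\<phi> \<in> {h i, g i}" "t \<in> {0..T}" for \<phi> t
      unfolding state_update
      by (rule cross_submodular[OF decr_diff[OF that(1)] submod[OF that(1)]])
        (use elim(1) that(2) in \<open>simp add: state_def\<close>)
    show ?case
    proof (rule pathwise_cost_pair_le[OF p elim(2)])
      show "?A1 i t \<omega> + ?A2 i t \<omega> = ?A3 i t \<omega> + ?A4 i t \<omega>" for t
        by (simp add: vec_eq_iff sup_vec_def inf_vec_def sup_max inf_min max_def min_def)
    qed (use cross T_pos in auto)
  qed
  thus ?thesis unfolding J_add[OF p(1,2)] J_add[OF p(3,4)] by (rule nn_integral_mono_AE)
qed

text \<open>
  Fatou's lemma, once in time and once in the outcome; the control cost even converges.
\<close>

lemma J_lower_semicontinuous:
  assumes A: "A \<in> profiles" and V: "V \<in> strategies" and Vn: "\<And>n::nat. Vn n \<in> strategies"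
    and conv: "AE \<omega> in P. (\<lambda>n. Vn n T \<omega>) \<longlonglongrightarrow> V T \<omega> \<and>
      (\<exists>E. countable E \<and> (\<forall>t\<in>{0..T} - E. (\<lambda>n. Vn n t \<omega>) \<longlonglongrightarrow> V t \<omega>))"
  shows "J i (A(i := V)) \<le> liminf (\<lambda>n. J i (A(i := Vn n)))"
proof -
  have p: "A(i := V) \<in> profiles" and pn: "A(i := Vn n) \<in> profiles" for n
    by (intro profiles_update A V Vn)+
  have "AE \<omega> in P. pathwise_cost i (A(i := V)) \<omega> \<le> liminf (\<lambda>n. pathwise_cost i (A(i := Vn n)) \<omega>)"
    using conv AE_space
  proof eventually_elim
    case (elim \<omega>)
    then obtain E where E: "countable E" "\<And>t. t \<in> {0..T} - E \<Longrightarrow> (\<lambda>n. Vn n t \<omega>) \<longlonglongrightarrow> V t \<omega>"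
      and limT: "(\<lambda>n. Vn n T \<omega>) \<longlonglongrightarrow> V T \<omega>" and \<omega>: "\<omega> \<in> space P" by blast
    have lim_\<phi>: "ennreal (\<phi> (L t \<omega>) (state (A(i := V)) t \<omega>)) \<le>
        liminf (\<lambda>n. ennreal (\<phi> (L t \<omega>) (state (A(i := Vn n)) t \<omega>)))"
      if "\<phi> \<in> {h i, g i}" "(\<lambda>n. Vn n t \<omega>) \<longlonglongrightarrow> V t \<omega>" for \<phi> t
      unfolding state_update by (rule lower_semicont_liminf[OF lsc[OF that(1)] that(2)])
    have R: "running_cost i (A(i := V)) \<omega> \<le> liminf (\<lambda>n. running_cost i (A(i := Vn n)) \<omega>)"
    proof -
      have "AE t in lborel. t \<notin> E" using E(1) by (intro AE_not_in countable_imp_null_set_lborel)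
      hence "AE t in lborel. running i (A(i := V)) \<omega> t \<le> liminf (\<lambda>n. running i (A(i := Vn n)) \<omega> t)"
      proof eventually_elim
        case (elim t)
        thus ?case
          using lim_\<phi>[of "h i" t] E(2)[of t] by (cases "t \<in> {0..T}") (simp_all add: running_def)
      qed
      hence "running_cost i (A(i := V)) \<omega> \<le> (\<integral>\<^sup>+t. liminf (\<lambda>n. running i (A(i := Vn n)) \<omega> t) \<partial>lborel)"
        unfolding running_cost_def by (rule nn_integral_mono_AE)
      also have "\<dots> \<le> liminf (\<lambda>n. running_cost i (A(i := Vn n)) \<omega>)"
        unfolding running_cost_def by (intro nn_integral_liminf running_measurable pn \<omega>)
      finally show ?thesis .
    qed
    have G: "final_cost i (A(i := V)) \<omega> \<le> liminf (\<lambda>n. final_cost i (A(i := Vn n)) \<omega>)"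
      unfolding final_cost_def by (rule lim_\<phi>) (use limT in auto)
    have C: "control_cost i (A(i := V)) \<omega> \<le> liminf (\<lambda>n. control_cost i (A(i := Vn n)) \<omega>)"
    proof -
      have "(\<lambda>n. stieltjes1 T (\<lambda>t. f i t \<omega> $ l) (\<lambda>t. Vn n t \<omega> $ l)) \<longlonglongrightarrow>
          stieltjes1 T (\<lambda>t. f i t \<omega> $ l) (\<lambda>t. V t \<omega> $ l)" for l
        by (rule stieltjes1_tendsto[OF T_pos _ _ _ _ E(1)])
          (intro f_cont f_path admissible_rc[OF V] admissible_rc[OF Vn] \<omega> tendsto_vec_nth E(2) limT;
            assumption)+
      hence "(\<lambda>n. control_cost i (A(i := Vn n)) \<omega>) \<longlonglongrightarrow> control_cost i (A(i := V)) \<omega>"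
        unfolding control_cost_eq[OF p \<omega>] control_cost_eq[OF pn \<omega>] fun_upd_same
        by (intro tendsto_ennrealI tendsto_sum)
      hence "liminf (\<lambda>n. control_cost i (A(i := Vn n)) \<omega>) = control_cost i (A(i := V)) \<omega>"
        by (intro lim_imp_Liminf) auto
      thus ?thesis by simp
    qed
    have "pathwise_cost i (A(i := V)) \<omega> \<le> (liminf (\<lambda>n. running_cost i (A(i := Vn n)) \<omega>) +
        liminf (\<lambda>n. final_cost i (A(i := Vn n)) \<omega>)) + liminf (\<lambda>n. control_cost i (A(i := Vn n)) \<omega>)"
      unfolding pathwise_cost_def by (intro add_mono R G C)
    also have "\<dots> \<le> liminf (\<lambda>n. running_cost i (A(i := Vn n)) \<omega> + final_cost i (A(i := Vn n)) \<omega>) +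
        liminf (\<lambda>n. control_cost i (A(i := Vn n)) \<omega>)"
      by (intro add_right_mono ennreal_liminf_add_le)
    also have "\<dots> \<le> liminf (\<lambda>n. pathwise_cost i (A(i := Vn n)) \<omega>)"
      unfolding pathwise_cost_def by (rule ennreal_liminf_add_le)
    finally show ?case .
  qed
  hence "J i (A(i := V)) \<le> (\<integral>\<^sup>+\<omega>. liminf (\<lambda>n. pathwise_cost i (A(i := Vn n)) \<omega>) \<partial>P)"
    unfolding J_eq by (rule nn_integral_mono_AE)
  also have "\<dots> \<le> liminf (\<lambda>n. J i (A(i := Vn n)))"
    unfolding J_eq by (intro nn_integral_liminf pathwise_cost_measurable pn)
  finally show ?thesis .
qed

section \<open>Best replies\<close>

definition "best_reply i A V \<longleftrightarrow>
  V \<in> strategies \<and> (\<forall>U\<in>strategies. J i (A(i := V)) \<le> J i (A(i := U)))"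

lemma best_reply_cost:
  assumes "A \<in> profiles" "best_reply i A V"
  shows "J i (A(i := V)) \<le> ennreal M"
proof -
  obtain r where "r \<in> strategies" "J i (A(i := r)) \<le> ennreal M" using bounded_reply[OF assms(1)] by blast
  thus ?thesis using assms(2) order_trans unfolding best_reply_def by blast
qed

text \<open>
  Either the expected total control is below the threshold \<open>K\<close>, or the coercivity
  estimate bounds it by the cost divided by \<open>\<kappa>\<close>.
\<close>

lemma strategy_bound:
  assumes A: "A \<in> profiles" and C: "J i A \<le> ennreal C" "0 \<le> C"
  shows "(\<integral>\<^sup>+\<omega>. ennreal (norm (A i T \<omega>)) \<partial>P) \<le> ennreal (max K (C / \<kappa>))"
proof (cases "ennreal K \<le> (\<integral>\<^sup>+\<omega>. ennreal (norm (A i T \<omega>)) \<partial>P)")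
  case True
  have le: "ennreal \<kappa> * (\<integral>\<^sup>+\<omega>. ennreal (norm (A i T \<omega>)) \<partial>P) \<le> ennreal C"
    using coercive[OF A True] C(1) by (rule order_trans)
  show ?thesis
  proof (cases "\<integral>\<^sup>+\<omega>. ennreal (norm (A i T \<omega>)) \<partial>P")
    case (real x)
    have "ennreal (\<kappa> * x) \<le> ennreal C" using le real \<kappa>_pos by (simp add: ennreal_mult)
    hence "\<kappa> * x \<le> C" using C(2) by simp
    hence "x \<le> C / \<kappa>" using \<kappa>_pos by (simp add: field_simps)
    thus ?thesis unfolding real by (intro ennreal_leI) simp
  next
    case top
    thus ?thesis using le \<kappa>_pos by (simp add: ennreal_mult_top top_unique)
  qed
next
  case False
  hence "(\<integral>\<^sup>+\<omega>. ennreal (norm (A i T \<omega>)) \<partial>P) \<le> ennreal K" by simp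
  also have "\<dots> \<le> ennreal (max K (C / \<kappa>))" by (intro ennreal_leI) simp
  finally show ?thesis .
qed

text \<open>
  Submodularity provides the compactness. Let \<open>V n\<close> be a minimizing sequence
  whose excess over the infimum \<open>I\<close> is at most \<open>(1/2)^n\<close>. Two
  strategies with costs at most \<open>I + a\<close> and \<open>I + b\<close> have a
  supremum with cost at least \<open>I\<close>, so their infimum costs at most
  \<open>I + a + b\<close>. Hence \<open>inf {V m, V (m+1), ...}\<close> exceeds
  \<open>I\<close> by at most \<open>2 (1/2)^m\<close>. These infima increase with
  \<open>m\<close> and have bounded expectations, so they converge to a strategy, namely the
  right envelope of the lower limit of the \<open>V n\<close>, and lower semicontinuity makes
  it a minimizer.
\<close>

lemma best_reply_exists:
  assumes A: "A \<in> profiles"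
  shows "\<exists>V. best_reply i A V"
proof -
  define I where "I = (INF U\<in>strategies. J i (A(i := U)))"
  have I_le: "I \<le> J i (A(i := U))" if "U \<in> strategies" for U
    unfolding I_def using that by (rule INF_lower)
  have "I \<le> ennreal M" using bounded_reply[OF A, of i] I_le order_trans by blast
  hence I_fin: "I < \<infinity>" by (auto intro: le_less_trans)
  have "\<exists>V\<in>strategies. J i (A(i := V)) \<le> I + ennreal ((1 / 2) ^ n)" for n
  proof -
    have "I < I + ennreal ((1 / 2) ^ n)" using I_fin by (simp add: ennreal_add_left_cancel_less)
    then obtain V where "V \<in> strategies" "J i (A(i := V)) < I + ennreal ((1 / 2) ^ n)"
      unfolding I_def INF_less_iff by blast
    thus ?thesis by (auto intro: less_imp_le)
  qed
  then obtain V where V: "\<And>n. V n \<in> strategies" "\<And>n. J i (A(i := V n)) \<le> I + ennreal ((1 / 2) ^ n)"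
    by metis
  \<comment> \<open>\<open>Y m k\<close> is the infimum of \<open>V m\<close>, ...,
    \<open>V (m + k)\<close>.\<close>
  define Y where "Y m = rec_nat (V m) (\<lambda>k Z t \<omega>. inf (Z t \<omega>) (V (m + Suc k) t \<omega>))" for m
  have Y0: "Y m 0 = V m" and YS: "Y m (Suc k) = (\<lambda>t \<omega>. inf (Y m k t \<omega>) (V (m + Suc k) t \<omega>))" for m k
    by (simp_all add: Y_def)
  have Y: "Y m k \<in> strategies" for m k
    by (induction k) (simp_all add: Y0 YS V(1) admissible_inf)
  \<comment> \<open>The constant is the geometric sum \<open>(1/2)^m + ... + (1/2)^(m + k)\<close>.\<close>
  have Y_cost: "J i (A(i := Y m k)) \<le> I + ennreal (2 * (1 / 2) ^ m - (1 / 2) ^ (m + k))" for m k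
  proof (induction k)
    case 0
    have "2 * (1 / 2) ^ m - (1 / 2) ^ (m + 0) = (1 / 2 :: real) ^ m" by simp
    thus ?case unfolding Y0 by (simp only: V(2))
  next
    case (Suc k)
    let ?a = "2 * (1 / 2) ^ m - (1 / 2) ^ (m + k) :: real" and ?b = "(1 / 2) ^ (m + Suc k) :: real"
    have "(1 / 2) ^ (m + k) \<le> (1 / 2 :: real) ^ m" by (intro power_decreasing) auto
    hence a: "0 \<le> ?a" using zero_le_power[of "1 / 2 :: real" m] by linarith
    let ?V = "V (m + Suc k)"
    have "I + J i (A(i := Y m (Suc k))) \<le>
        J i (A(i := \<lambda>t \<omega>. sup (Y m k t \<omega>) (?V t \<omega>))) + J i (A(i := Y m (Suc k)))"
      by (intro add_right_mono I_le admissible_sup Y V)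
    also have "\<dots> \<le> J i (A(i := ?V)) + J i (A(i := Y m k))"
      unfolding YS by (rule J_cross_submodular) (simp_all add: A Y V proc_le_def)
    also have "\<dots> \<le> (I + ennreal ?b) + (I + ennreal ?a)"
      by (intro add_mono V(2) Suc)
    also have "\<dots> = I + (I + ennreal (?a + ?b))"
    proof -
      have "ennreal (?a + ?b) = ennreal ?b + ennreal ?a"
        using a by (subst add.commute, intro ennreal_plus) auto
      thus ?thesis by (simp only: ac_simps)
    qed
    finally have le: "J i (A(i := Y m (Suc k))) \<le> I + ennreal (?a + ?b)"
      by (rule ennreal_cancel(2)[OF I_fin])
    have "?a + ?b = 2 * (1 / 2) ^ m - (1 / 2) ^ (m + Suc k)" by simp
    thus ?case using le by (simp only:)
  qed
  define Z where "Z m t \<omega> = (\<chi> l. INF k. Y m k t \<omega> $ l)" for m t \<omega>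
  have Z: "Z m \<in> strategies" for m unfolding Z_def by (rule admissible_INF[OF Y])
  have bdd: "bdd_below (range (\<lambda>k. Y m k t \<omega> $ l))" if "\<omega> \<in> space P" "t \<in> {0..T}" for m t \<omega> l
    using admissible_nonneg[OF Y that] by (intro bdd_belowI2[of _ 0]) auto
  have Z_lim: "(\<lambda>k. Y m k t \<omega>) \<longlonglongrightarrow> Z m t \<omega>" if "\<omega> \<in> space P" "t \<in> {0..T}" for m t \<omega>
  proof (rule vec_tendstoI)
    fix l
    have "decseq (\<lambda>k. Y m k t \<omega> $ l)" by (simp add: decseq_Suc_iff YS inf_vec_def)
    thus "(\<lambda>k. Y m k t \<omega> $ l) \<longlonglongrightarrow> Z m t \<omega> $ l"
      unfolding Z_def using bdd[OF that] by (simp add: LIMSEQ_decseq_INF)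
  qed
  have Z_cost: "J i (A(i := Z m)) \<le> I + ennreal (2 * (1 / 2) ^ m)" for m
  proof -
    have "J i (A(i := Z m)) \<le> liminf (\<lambda>k. J i (A(i := Y m k)))"
    proof (rule J_lower_semicontinuous[OF A Z Y])
      show "AE \<omega> in P. (\<lambda>k. Y m k T \<omega>) \<longlonglongrightarrow> Z m T \<omega> \<and>
          (\<exists>E. countable E \<and> (\<forall>t\<in>{0..T} - E. (\<lambda>k. Y m k t \<omega>) \<longlonglongrightarrow> Z m t \<omega>))"
        using Z_lim T_pos by (intro AE_I2 conjI exI[of _ "{}"]) auto
    qed
    also have "\<dots> \<le> I + ennreal (2 * (1 / 2) ^ m)"
    proof (rule Liminf_le)
      show "eventually (\<lambda>k. J i (A(i := Y m k)) \<le> I + ennreal (2 * (1 / 2) ^ m)) sequentially"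
      proof (intro always_eventually allI)
        fix k show "J i (A(i := Y m k)) \<le> I + ennreal (2 * (1 / 2) ^ m)"
          by (rule order_trans[OF Y_cost]) (intro add_left_mono ennreal_leI, simp)
      qed
    qed simp
    finally show ?thesis .
  qed
  have Y_shift: "Y m (Suc k) t \<omega> \<le> Y (Suc m) k t \<omega>" for m k t \<omega>
  proof (induction k)
    case (Suc k)
    have "Y m (Suc (Suc k)) t \<omega> = inf (Y m (Suc k) t \<omega>) (V (m + Suc (Suc k)) t \<omega>)" by (simp only: YS)
    also have "\<dots> \<le> inf (Y (Suc m) k t \<omega>) (V (m + Suc (Suc k)) t \<omega>)" by (intro inf_mono Suc order_refl)
    also have "\<dots> = Y (Suc m) (Suc k) t \<omega>" by (simp add: YS)
    finally show ?case .
  qed (simp add: Y0 YS)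
  have Z_inc: "Z m t \<omega> \<le> Z (Suc m) t \<omega>" if "\<omega> \<in> space P" "t \<in> {0..T}" for m t \<omega>
    unfolding less_eq_vec_def
  proof
    fix l
    have "(INF k. Y m k t \<omega> $ l) \<le> Y (Suc m) k t \<omega> $ l" for k
    proof -
      have "(INF k. Y m k t \<omega> $ l) \<le> Y m (Suc k) t \<omega> $ l" using bdd[OF that] by (intro cINF_lower) auto
      also have "\<dots> \<le> Y (Suc m) k t \<omega> $ l" using Y_shift by (simp add: less_eq_vec_def)
      finally show ?thesis .
    qed
    thus "Z m t \<omega> $ l \<le> Z (Suc m) t \<omega> $ l" unfolding Z_def by (simp add: cINF_greatest)
  qed
  have "\<exists>W\<in>strategies. AE \<omega> in P. (\<forall>m. \<forall>t\<in>{0..T}. Z m t \<omega> \<le> W t \<omega>) \<and>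
    (\<lambda>m. Z m T \<omega>) \<longlonglongrightarrow> W T \<omega> \<and>
    (\<exists>E. countable E \<and> (\<forall>t\<in>{0..T} - E. (\<lambda>m. Z m t \<omega>) \<longlonglongrightarrow> W t \<omega>))"
  proof (rule increasing_limit[OF Z])
    show "AE \<omega> in P. \<forall>m. \<forall>t\<in>{0..T}. Z m t \<omega> \<le> Z (Suc m) t \<omega>"
      using Z_inc by (intro AE_I2 allI ballI)
    fix m
    have "J i (A(i := Z m)) \<le> I + ennreal (2 * (1 / 2) ^ m)" by (rule Z_cost)
    also have "\<dots> \<le> ennreal M + ennreal 2"
      using \<open>I \<le> ennreal M\<close> by (intro add_mono ennreal_leI) (simp_all add: power_le_one)
    also have "\<dots> = ennreal (M + 2)" using M_pos by (intro ennreal_plus[symmetric]) auto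
    finally have "J i (A(i := Z m)) \<le> ennreal (M + 2)" .
    from strategy_bound[OF profiles_update[OF A Z] this]
    show "(\<integral>\<^sup>+\<omega>. ennreal (norm (Z m T \<omega>)) \<partial>P) \<le> ennreal (max K ((M + 2) / \<kappa>))"
      using M_pos by simp
  qed
  then obtain W where W: "W \<in> strategies" "AE \<omega> in P. (\<lambda>m. Z m T \<omega>) \<longlonglongrightarrow> W T \<omega> \<and>
    (\<exists>E. countable E \<and> (\<forall>t\<in>{0..T} - E. (\<lambda>m. Z m t \<omega>) \<longlonglongrightarrow> W t \<omega>))"
    by (auto elim: eventually_mono)
  have "J i (A(i := W)) \<le> liminf (\<lambda>m. J i (A(i := Z m)))"
    by (rule J_lower_semicontinuous[OF A W(1) Z W(2)])
  also have "\<dots> \<le> liminf (\<lambda>m. I + ennreal (2 * (1 / 2) ^ m))"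
    using Z_cost by (intro Liminf_mono always_eventually) auto
  also have "\<dots> = I + ennreal (2 * 0)"
    by (intro lim_imp_Liminf tendsto_add tendsto_const tendsto_ennrealI tendsto_mult
        LIMSEQ_realpow_zero) auto
  also have "\<dots> = I" by simp
  finally have "J i (A(i := W)) \<le> I" .
  hence "best_reply i A W" unfolding best_reply_def using W(1) I_le order_trans by blast
  thus ?thesis by blast
qed

text \<open>
  By strict convexity the midpoint of two minimizers would be strictly better, unless they
  agree at \<open>T\<close> and at almost every time; by right-continuity they then agree at
  all times.
\<close>

lemma best_reply_unique:
  assumes A: "A \<in> profiles" and U: "best_reply i A U" and V: "best_reply i A V"
  shows "AE \<omega> in P. \<forall>t\<in>{0..T}. U t \<omega> = V t \<omega>"
proof -
  have Us: "U \<in> strategies" and Vs: "V \<in> strategies" using U V by (auto simp: best_reply_def)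
  define W where "W t \<omega> = (1 / 2) *\<^sub>R (U t \<omega> + V t \<omega>)" for t \<omega>
  have Ws: "W \<in> strategies" unfolding W_def by (rule admissible_midpoint[OF Us Vs])
  let ?W = "A(i := W)" and ?U = "A(i := U)" and ?V = "A(i := V)"
  note p = profiles_update[OF A Ws] profiles_update[OF A Us] profiles_update[OF A Vs]
  have mid: "2 * \<phi> (L t \<omega>) (state ?W t \<omega>) \<le> \<phi> (L t \<omega>) (state ?U t \<omega>) + \<phi> (L t \<omega>) (state ?V t \<omega>)"
    "2 * \<phi> (L t \<omega>) (state ?W t \<omega>) = \<phi> (L t \<omega>) (state ?U t \<omega>) + \<phi> (L t \<omega>) (state ?V t \<omega>)
      \<Longrightarrow> U t \<omega> = V t \<omega>"
    if "\<phi> \<in> {h i, g i}" for \<phi> t \<omega>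
    using strictly_convex_midpoint[OF convex[OF that], of "L t \<omega>" "state A t \<omega>" "U t \<omega>" "V t \<omega>"]
    unfolding state_update W_def by blast+
  have h: "h i (L t \<omega>) (state ?W t \<omega>) + h i (L t \<omega>) (state ?W t \<omega>) \<le>
      h i (L t \<omega>) (state ?U t \<omega>) + h i (L t \<omega>) (state ?V t \<omega>)" for t \<omega>
    using mid(1)[of "h i" t \<omega>] by simp
  have g: "g i (L t \<omega>) (state ?W t \<omega>) + g i (L t \<omega>) (state ?W t \<omega>) \<le>
      g i (L t \<omega>) (state ?U t \<omega>) + g i (L t \<omega>) (state ?V t \<omega>)" for t \<omega>
    using mid(1)[of "g i" t \<omega>] by simp
  have eq: "?W i t \<omega> + ?W i t \<omega> = ?U i t \<omega> + ?V i t \<omega>" for t \<omega>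
    by (simp add: W_def scaleR_left_distrib[symmetric])
  let ?c = "\<lambda>\<omega>. pathwise_cost i ?W \<omega> + pathwise_cost i ?W \<omega>"
  let ?d = "\<lambda>\<omega>. pathwise_cost i ?U \<omega> + pathwise_cost i ?V \<omega>"
  note m[measurable] = pathwise_cost_measurable[OF p(1), of i] pathwise_cost_measurable[OF p(2), of i]
    pathwise_cost_measurable[OF p(3), of i]
  have le: "?c \<omega> \<le> ?d \<omega>" if "\<omega> \<in> space P" for \<omega>
    by (rule pathwise_cost_pair_le[OF p(1,1,2,3) that h g eq])
  have "(\<integral>\<^sup>+\<omega>. ?d \<omega> \<partial>P) \<le> (\<integral>\<^sup>+\<omega>. ?c \<omega> \<partial>P)"
    unfolding J_add[OF p(1,1), symmetric] J_add[OF p(2,3), symmetric]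
    using U V Ws by (intro add_mono) (auto simp: best_reply_def)
  moreover have fin: "(\<integral>\<^sup>+\<omega>. ?c \<omega> \<partial>P) < \<infinity>"
  proof -
    have "(\<integral>\<^sup>+\<omega>. ?c \<omega> \<partial>P) \<le> (\<integral>\<^sup>+\<omega>. ?d \<omega> \<partial>P)" by (rule nn_integral_mono) (rule le)
    also have "\<dots> \<le> ennreal M + ennreal M"
      unfolding J_add[OF p(2,3), symmetric] by (intro add_mono best_reply_cost[OF A] U V)
    also have "\<dots> < \<infinity>" by simp
    finally show ?thesis .
  qed
  ultimately have "AE \<omega> in P. ?c \<omega> = ?d \<omega>"
    by (intro nn_integral_eq_imp_AE_eq AE_I2 le) auto
  moreover have "AE \<omega> in P. ?c \<omega> \<noteq> \<infinity>"
    using fin by (intro nn_integral_noteq_infinite) auto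
  ultimately show ?thesis
    using AE_space
  proof eventually_elim
    case (elim \<omega>)
    have "?c \<omega> < \<infinity>" using elim(2) by (simp add: less_top)
    from pathwise_cost_pair_eq[OF p(1,1,2,3) elim(3) h g eq elim(1) this]
    have gT: "g i (L T \<omega>) (state ?W T \<omega>) + g i (L T \<omega>) (state ?W T \<omega>) =
         g i (L T \<omega>) (state ?U T \<omega>) + g i (L T \<omega>) (state ?V T \<omega>)"
      and ht: "AE t in lborel. t \<in> {0..T} \<longrightarrow> h i (L t \<omega>) (state ?W t \<omega>) + h i (L t \<omega>) (state ?W t \<omega>) =
         h i (L t \<omega>) (state ?U t \<omega>) + h i (L t \<omega>) (state ?V t \<omega>)" by blast+
    have UT: "U T \<omega> = V T \<omega>" using mid(2)[of "g i" T \<omega>] gT by simp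
    define D where "D = {t\<in>{0..T}. U t \<omega> = V t \<omega>}"
    have AE_D: "AE t in lborel. t \<in> {0..T} \<longrightarrow> t \<in> D"
      using ht
    proof eventually_elim
      case (elim t)
      show ?case using mid(2)[of "h i" t \<omega>] elim by (simp add: D_def)
    qed
    have dense: "\<exists>r\<in>D. a < r \<and> r < b" if ab: "0 \<le> a" "a < b" "b \<le> T" for a b
    proof (rule ccontr)
      assume "\<not> ?thesis"
      hence "AE t in lborel. t \<notin> {a<..<b}"
        using AE_D ab by (auto elim!: eventually_mono)
      hence "{a<..<b} \<in> null_sets lborel" by (subst AE_iff_null_sets) auto
      thus False using ab by (simp add: null_sets_def)
    qed
    show ?case
    proof
      fix t assume t: "t \<in> {0..T}"
      show "U t \<omega> = V t \<omega>"
        unfolding vec_eq_iff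
      proof
        fix l
        note rc = admissible_rc[OF Us elim(3), of l] admissible_rc[OF Vs elim(3), of l]
        show "U t \<omega> $ l = V t \<omega> $ l"
          using rc_le_from_dense[OF rc dense _ _ t] rc_le_from_dense[OF rc(2,1) dense _ _ t] UT
          by (intro antisym) (auto simp: D_def)
      qed
    qed
  qed
qed

text \<open>
  The best reply is unique up to indistinguishability, so the choice affects no statement that
  respects it.
\<close>

definition "reply A i = (SOME V. best_reply i A V)" for A :: "('w, 'd, 'n) profile"

lemma reply_best: "A \<in> profiles \<Longrightarrow> best_reply i A (reply A i)"
  unfolding reply_def by (rule someI_ex[of "best_reply i A"]) (rule best_reply_exists)

lemma reply_strategy: "A \<in> profiles \<Longrightarrow> reply A i \<in> strategies"
  using reply_best by (simp add: best_reply_def)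

lemma reply_profile: "A \<in> profiles \<Longrightarrow> reply A \<in> profiles"
  using reply_strategy by (simp add: admissible_profiles_def)

text \<open>
  Let \<open>?V\<close> and \<open>?U\<close> reply to \<open>A\<close> and \<open>B\<close>.
  Cross-submodularity weighs the costs of their supremum against \<open>B\<close> and of their
  infimum against \<open>A\<close>; since \<open>?V\<close> is at least as good as the
  infimum, the supremum is at least as good as \<open>?U\<close>. By uniqueness the supremum
  is \<open>?U\<close>, which therefore dominates \<open>?V\<close>.
\<close>

lemma reply_mono:
  assumes A: "A \<in> profiles" and B: "B \<in> profiles" and le: "profile_le P T A B"
  shows "profile_le P T (reply A) (reply B)"
  unfolding profile_le_def
proof
  fix i
  let ?V = "reply A i" and ?U = "reply B i"
  let ?S = "\<lambda>t \<omega>. sup (?V t \<omega>) (?U t \<omega>)" and ?I = "\<lambda>t \<omega>. inf (?V t \<omega>) (?U t \<omega>)"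
  have st: "?V \<in> strategies" "?U \<in> strategies" using reply_strategy A B by auto
  have S: "?S \<in> strategies" and I: "?I \<in> strategies" by (intro admissible_sup admissible_inf st)+
  have cross: "J i (B(i := ?S)) + J i (A(i := ?I)) \<le> J i (B(i := ?U)) + J i (A(i := ?V))"
    using le by (intro J_cross_submodular A B st) (simp add: profile_le_def)
  have V_opt: "J i (A(i := ?V)) \<le> J i (A(i := ?I))"
    using reply_best[OF A, of i] I by (simp add: best_reply_def)
  have V_fin: "J i (A(i := ?V)) < \<infinity>"
    using best_reply_cost[OF A reply_best[OF A]] by (rule le_less_trans) simp
  have "J i (A(i := ?V)) + J i (B(i := ?S)) \<le> J i (A(i := ?V)) + J i (B(i := ?U))"
    using order_trans[OF add_left_mono[OF V_opt] cross] by (simp add: add.commute)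
  hence "J i (B(i := ?S)) \<le> J i (B(i := ?U))" by (rule ennreal_cancel(2)[OF V_fin])
  hence "best_reply i B ?S"
    using reply_best[OF B, of i] S order_trans unfolding best_reply_def by blast
  from best_reply_unique[OF B this reply_best[OF B]]
  show "proc_le P T ?V ?U"
    unfolding proc_le_def
  proof eventually_elim
    case (elim \<omega>)
    show ?case
    proof
      fix t assume "t \<in> {0..T}"
      hence "?U t \<omega> = sup (?V t \<omega>) (?U t \<omega>)" using elim by simp
      thus "?V t \<omega> \<le> ?U t \<omega>" by (metis sup_ge1)
    qed
  qed
qed

section \<open>Nash equilibria as fixed points\<close>

lemma proc_le_refl: "proc_le P T V V"
  by (simp add: proc_le_def)

lemma proc_le_trans: "proc_le P T U V \<Longrightarrow> proc_le P T V W \<Longrightarrow> proc_le P T U W"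
  unfolding proc_le_def by (erule (1) eventually_elim2) (meson order_trans)

lemma profile_le_refl: "profile_le P T A A"
  by (simp add: profile_le_def proc_le_refl)

lemma profile_le_trans: "profile_le P T A B \<Longrightarrow> profile_le P T B C \<Longrightarrow> profile_le P T A C"
  using proc_le_trans by (simp add: profile_le_def) blast

lemma proc_le_antisym:
  "proc_le P T U V \<Longrightarrow> proc_le P T V U \<Longrightarrow> AE \<omega> in P. \<forall>t\<in>{0..T}. U t \<omega> = V t \<omega>"
  unfolding proc_le_def by (erule (1) eventually_elim2) (meson order_antisym)

lemma J_cong:
  assumes "AE \<omega> in P. \<forall>j. \<forall>t\<in>{0..T}. A j t \<omega> = B j t \<omega>"
  shows "J i A = J i B"
  unfolding J_eq
proof (rule nn_integral_cong_AE)
  show "AE \<omega> in P. pathwise_cost i A \<omega> = pathwise_cost i B \<omega>"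
    using assms
  proof eventually_elim
    case (elim \<omega>)
    have st: "state A t \<omega> = state B t \<omega>" if "t \<in> {0..T}" for t
      using elim that by (simp add: state_def)
    have "running i A \<omega> t = running i B \<omega> t" for t
      using st by (cases "t \<in> {0..T}") (simp_all add: running_def)
    moreover have "A i (max 0 (min t T)) \<omega> = B i (max 0 (min t T)) \<omega>" for t
      using elim T_pos by simp
    moreover have "A i 0 \<omega> = B i 0 \<omega>" using elim T_pos by simp
    ultimately show ?case
      using st[of T] T_pos
      by (simp add: pathwise_cost_def running_cost_def final_cost_def control_cost_def stieltjes_def)
  qed
qed

definition "equilibria = {A \<in> profiles. \<forall>i. J i A < \<infinity> \<and> (\<forall>V\<in>strategies. J i A \<le> J i (A(i := V)))}"

lemma equilibria_fixed_points:
  "equilibria = {A \<in> profiles. profile_le P T A (reply A) \<and> profile_le P T (reply A) A}"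
proof (rule Set.set_eqI, rule iffI)
  fix A assume A: "A \<in> equilibria"
  hence Ap: "A \<in> profiles" by (simp add: equilibria_def)
  have "best_reply i A (A i)" for i
    using A profilesD[OF Ap] by (simp add: equilibria_def best_reply_def)
  from best_reply_unique[OF Ap this reply_best[OF Ap]]
  have ae: "AE \<omega> in P. \<forall>t\<in>{0..T}. A i t \<omega> = reply A i t \<omega>" for i .
  have "proc_le P T (A i) (reply A i) \<and> proc_le P T (reply A i) (A i)" for i
    unfolding proc_le_def using ae[of i] by (auto elim!: eventually_mono)
  thus "A \<in> {A \<in> profiles. profile_le P T A (reply A) \<and> profile_le P T (reply A) A}"
    using Ap by (simp add: profile_le_def)
next
  fix A assume A: "A \<in> {A \<in> profiles. profile_le P T A (reply A) \<and> profile_le P T (reply A) A}"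
  hence Ap: "A \<in> profiles" by simp
  have same: "J i A = J i (A(i := reply A i))" for i
  proof (rule J_cong)
    have "AE \<omega> in P. \<forall>t\<in>{0..T}. A i t \<omega> = reply A i t \<omega>"
      using A by (intro proc_le_antisym) (simp_all add: profile_le_def)
    thus "AE \<omega> in P. \<forall>j. \<forall>t\<in>{0..T}. A j t \<omega> = (A(i := reply A i)) j t \<omega>"
      by eventually_elim simp
  qed
  have "J i A < \<infinity> \<and> (\<forall>V\<in>strategies. J i A \<le> J i (A(i := V)))" for i
  proof
    show "J i A < \<infinity>" unfolding same[of i]
      using best_reply_cost[OF Ap reply_best[OF Ap]] by (rule le_less_trans) simp
    show "\<forall>V\<in>strategies. J i A \<le> J i (A(i := V))"
      unfolding same[of i] using reply_best[OF Ap, of i] by (simp add: best_reply_def)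
  qed
  thus "A \<in> equilibria" using Ap by (simp add: equilibria_def)
qed

lemma profiles_glb:
  assumes S: "S \<subseteq> profiles" "S \<noteq> {}"
  shows "\<exists>m\<in>profiles. (\<forall>A\<in>S. profile_le P T m A) \<and>
    (\<forall>B\<in>profiles. (\<forall>A\<in>S. profile_le P T B A) \<longrightarrow> profile_le P T B m)"
proof -
  have "\<forall>i. \<exists>m\<in>strategies. (\<forall>s\<in>(\<lambda>A. A i) ` S. proc_le P T m s) \<and>
      (\<forall>y\<in>strategies. (\<forall>s\<in>(\<lambda>A. A i) ` S. proc_le P T y s) \<longrightarrow> proc_le P T y m)"
    using S profilesD by (intro allI admissible_glb) auto
  from choice[OF this[unfolded Bex_def]] obtain m where m: "\<forall>i. m i \<in> strategies \<and>
      (\<forall>s\<in>(\<lambda>A. A i) ` S. proc_le P T (m i) s) \<and>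
      (\<forall>y\<in>strategies. (\<forall>s\<in>(\<lambda>A. A i) ` S. proc_le P T y s) \<longrightarrow> proc_le P T y (m i))" ..
  have "m \<in> profiles" using m by (simp add: admissible_profiles_def)
  moreover have "profile_le P T m A" if "A \<in> S" for A using m that by (simp add: profile_le_def)
  moreover have "profile_le P T B m" if "B \<in> profiles" "\<forall>A\<in>S. profile_le P T B A" for B
    using m that profilesD[OF that(1)] by (simp add: profile_le_def)
  ultimately show ?thesis by blast
qed

text \<open>
  The replies have bounded expectations because their costs are bounded by one constant; a
  profile below its reply inherits the bound.
\<close>

lemma improvable_bounded:
  assumes A: "A \<in> profiles" "profile_le P T A (reply A)"
  shows "(\<integral>\<^sup>+\<omega>. ennreal (norm (A i T \<omega>)) \<partial>P) \<le> ennreal (max K (M / \<kappa>))"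
proof -
  have "AE \<omega> in P. \<forall>t\<in>{0..T}. A i t \<omega> \<le> reply A i t \<omega>"
    using A(2) by (simp add: profile_le_def proc_le_def)
  hence "AE \<omega> in P. ennreal (norm (A i T \<omega>)) \<le> ennreal (norm (reply A i T \<omega>))"
    using AE_space
  proof eventually_elim
    case (elim \<omega>)
    have "0 \<le> A i T \<omega> $ l" for l
      using T_pos by (intro admissible_nonneg[OF profilesD[OF A(1)] elim(2)]) simp
    moreover have "A i T \<omega> $ l \<le> reply A i T \<omega> $ l" for l
      using elim(1) T_pos by (simp add: less_eq_vec_def)
    ultimately have "norm (A i T \<omega>) \<le> norm (reply A i T \<omega>)"
      by (intro norm_le_componentwise_cart) (metis abs_of_nonneg order_trans real_norm_def)
    thus ?case by (rule ennreal_leI)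
  qed
  hence "(\<integral>\<^sup>+\<omega>. ennreal (norm (A i T \<omega>)) \<partial>P) \<le> (\<integral>\<^sup>+\<omega>. ennreal (norm (reply A i T \<omega>)) \<partial>P)"
    by (rule nn_integral_mono_AE)
  also have "\<dots> \<le> ennreal (max K (M / \<kappa>))"
    using strategy_bound[OF profiles_update[OF A(1) reply_strategy[OF A(1)]]
      best_reply_cost[OF A(1) reply_best[OF A(1)]], of i] M_pos by simp
  finally show ?thesis .
qed

text \<open>
  The profiles below their replies are closed under binary suprema, since the reply map is
  increasing, and they have uniformly bounded expectations. So each coordinate of them is a
  directed family with an upper bound, although the set of all profiles has no largest
  element.
\<close>

lemma improvable_upper_bound:
  "\<exists>U\<in>profiles. \<forall>A\<in>profiles. profile_le P T A (reply A) \<longrightarrow> profile_le P T A U"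
proof -
  define Q where "Q = {A \<in> profiles. profile_le P T A (reply A)}"
  have Q_sup: "(\<lambda>j t \<omega>. sup (A j t \<omega>) (B j t \<omega>)) \<in> Q" if "A \<in> Q" "B \<in> Q" for A B
  proof -
    let ?C = "\<lambda>j t \<omega>. sup (A j t \<omega>) (B j t \<omega>)"
    have AB: "A \<in> profiles" "B \<in> profiles" using that by (auto simp: Q_def)
    have C: "?C \<in> profiles"
      unfolding admissible_profiles_def using profilesD[OF AB(1)] profilesD[OF AB(2)] admissible_sup by blast
    have "profile_le P T A ?C" "profile_le P T B ?C" by (simp_all add: profile_le_def proc_le_def)
    hence "profile_le P T (reply A) (reply ?C)" "profile_le P T (reply B) (reply ?C)"
      using reply_mono AB C by blast+
    hence "profile_le P T A (reply ?C)" "profile_le P T B (reply ?C)"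
      using that profile_le_trans unfolding Q_def by blast+
    hence le: "proc_le P T (A i) (reply ?C i)" "proc_le P T (B i) (reply ?C i)" for i
      by (simp_all add: profile_le_def)
    have "proc_le P T (?C i) (reply ?C i)" for i
      using le[of i] unfolding proc_le_def by eventually_elim simp
    thus ?thesis using C by (simp add: Q_def profile_le_def)
  qed
  have "(\<lambda>j t \<omega>. 0) \<in> profiles" using admissible_zero by (simp add: admissible_profiles_def)
  moreover have "profile_le P T (\<lambda>j t \<omega>. 0) B" if "B \<in> profiles" for B
    unfolding profile_le_def proc_le_def
    using profilesD[OF that] by (auto simp: admissible_def intro!: AE_I2)
  ultimately have Q0: "(\<lambda>j t \<omega>. 0) \<in> Q" using reply_profile by (simp add: Q_def)
  have "\<forall>i. \<exists>W. W \<in> strategies \<and> (\<forall>V\<in>(\<lambda>A. A i) ` Q. proc_le P T V W)"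
  proof
    fix i
    have "\<exists>W\<in>strategies. \<forall>V\<in>(\<lambda>A. A i) ` Q. proc_le P T V W"
    proof (rule directed_upper_bound)
      show "(\<lambda>A. A i) ` Q \<subseteq> strategies" using profilesD by (auto simp: Q_def)
      show "(\<lambda>A. A i) ` Q \<noteq> {}" using Q0 by blast
      show "(\<lambda>t \<omega>. sup (U t \<omega>) (V t \<omega>)) \<in> (\<lambda>A. A i) ` Q"
        if UV: "U \<in> (\<lambda>A. A i) ` Q" "V \<in> (\<lambda>A. A i) ` Q" for U V
      proof -
        obtain A B where "A \<in> Q" "U = A i" "B \<in> Q" "V = B i" using UV by blast
        thus ?thesis using Q_sup[of A B] by (intro image_eqI[of _ _ "\<lambda>j t \<omega>. sup (A j t \<omega>) (B j t \<omega>)"]) simp_all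
      qed
      show "(\<integral>\<^sup>+\<omega>. ennreal (norm (V T \<omega>)) \<partial>P) \<le> ennreal (max K (M / \<kappa>))"
        if "V \<in> (\<lambda>A. A i) ` Q" for V
        using that improvable_bounded unfolding Q_def by blast
    qed
    thus "\<exists>W. W \<in> strategies \<and> (\<forall>V\<in>(\<lambda>A. A i) ` Q. proc_le P T V W)" by blast
  qed
  from choice[OF this] obtain W where W: "\<forall>i. W i \<in> strategies \<and> (\<forall>V\<in>(\<lambda>A. A i) ` Q. proc_le P T V (W i))" ..
  have "W \<in> profiles" using W by (simp add: admissible_profiles_def)
  moreover have "profile_le P T A W" if "A \<in> profiles" "profile_le P T A (reply A)" for A
    using W that by (simp add: profile_le_def Q_def)
  ultimately show ?thesis by blast
qed

lemma equilibria_lub: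
  assumes "B \<subseteq> equilibria"
  shows "\<exists>x. lub_in (profile_le P T) equilibria B x"
proof -
  obtain U where U: "U \<in> profiles" "\<And>A. A \<in> profiles \<Longrightarrow> profile_le P T A (reply A) \<Longrightarrow> profile_le P T A U"
    using improvable_upper_bound by blast
  show ?thesis
    unfolding equilibria_fixed_points
  proof (rule fixed_points_have_lubs[where u = U])
    show "B \<subseteq> {A \<in> profiles. profile_le P T A (reply A) \<and> profile_le P T (reply A) A}"
      using assms unfolding equilibria_fixed_points .
    show "\<exists>m\<in>profiles. (\<forall>b\<in>S. profile_le P T m b) \<and>
        (\<forall>y\<in>profiles. (\<forall>b\<in>S. profile_le P T y b) \<longrightarrow> profile_le P T y m)"
      if "S \<subseteq> profiles" "S \<noteq> {}" for S using that by (rule profiles_glb)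
    show "profile_le P T A C" if "profile_le P T A B" "profile_le P T B C" for A B C :: "('w, 'd, 'n) profile"
      using that by (rule profile_le_trans)
  qed (fact profile_le_refl reply_profile reply_mono U)+
qed

lemma equilibria_complete_lattice:
  "equilibria \<noteq> {} \<and> complete_lattice (profile_order P T F equilibria)"
proof
  obtain A where "lub_in (profile_le P T) equilibria {} A" using equilibria_lub[of "{}"] by auto
  thus "equilibria \<noteq> {}" by (auto simp: lub_in_def)
  have ind: "indistinguishable P T F =
      {(A, B). A \<in> profiles \<and> B \<in> profiles \<and> profile_le P T A B \<and> profile_le P T B A}"
  proof -
    have "(AE \<omega> in P. \<forall>t\<in>{0..T}. U t \<omega> = V t \<omega>) \<longleftrightarrow> proc_le P T U V \<and> proc_le P T V U"
      for U V :: "('w, 'd) proc"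
    proof
      assume "AE \<omega> in P. \<forall>t\<in>{0..T}. U t \<omega> = V t \<omega>"
      thus "proc_le P T U V \<and> proc_le P T V U"
        unfolding proc_le_def by (auto elim!: eventually_mono)
    qed (use proc_le_antisym in blast)
    thus ?thesis unfolding indistinguishable_def profile_le_def by auto
  qed
  show "complete_lattice (profile_order P T F equilibria)"
    unfolding profile_order_def
  proof (rule quotient_complete_lattice[where X = profiles])
    show "indistinguishable P T F =
      {(A, B). A \<in> profiles \<and> B \<in> profiles \<and> profile_le P T A B \<and> profile_le P T B A}" by (rule ind)
    show "equilibria \<subseteq> profiles" by (auto simp: equilibria_def)
    show "profile_le P T A C" if "profile_le P T A B" "profile_le P T B C" for A B C :: "('w, 'd, 'n) profile"
      using that by (rule profile_le_trans)
  qed (fact profile_le_refl equilibria_lub)+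
qed

end

theorem theorem2p3:
  fixes P :: "'w measure"
    and T :: real
    and L :: "('w, 'k::finite) proc"
    and f :: "('w, 'd::finite, 'n::finite) profile"
    and h g :: "'n \<Rightarrow> real ^ 'k \<Rightarrow> (real ^ 'd) ^ 'n \<Rightarrow> real"
    and K \<kappa> M :: real
  assumes "prob_space P" and "complete_measure P"
    and "T > 0" and "CARD('n) \<ge> 2"
    and L_meas: "\<And>t. t \<in> {0..T} \<Longrightarrow> L t \<in> borel_measurable P"
    and L_cadlag: "\<And>\<omega>. \<omega> \<in> space P \<Longrightarrow> cadlag_on T (\<lambda>t. L t \<omega>)"
    and f_meas: "\<And>i t. t \<in> {0..T} \<Longrightarrow> f i t \<in> borel_measurable P"
    and f_nonneg: "\<And>i t \<omega>. t \<in> {0..T} \<Longrightarrow> \<omega> \<in> space P \<Longrightarrow> 0 \<le> f i t \<omega>"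
    and f_semimartingale:
      "\<And>i l. continuous_semimartingale P T (game_filtration P T L f) (\<lambda>t \<omega>. f i t \<omega> $ l)"
    and h_meas: "\<And>i. (\<lambda>(l, a). h i l a) \<in> borel_measurable borel"
    and g_meas: "\<And>i. (\<lambda>(l, a). g i l a) \<in> borel_measurable borel"
    and h_nonneg: "\<And>i l a. 0 \<le> h i l a"
    and g_nonneg: "\<And>i l a. 0 \<le> g i l a"
    and lsc: "\<And>i \<phi> l a. \<phi> \<in> {h i, g i} \<Longrightarrow> lower_semicont (\<lambda>v. \<phi> l (replace_block a i v))"
    and convex: "\<And>i \<phi> l a. \<phi> \<in> {h i, g i} \<Longrightarrow> strictly_convex (\<lambda>v. \<phi> l (replace_block a i v))"
    and decr_diff: "\<And>i \<phi> l. \<phi> \<in> {h i, g i} \<Longrightarrow> decreasing_differences i (\<phi> l)"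
    and submod: "\<And>i \<phi> l. \<phi> \<in> {h i, g i} \<Longrightarrow> submodular_in i (\<phi> l)"
    and "K > 0" and "\<kappa> > 0"
    and coercive:
      "\<And>i A. A \<in> admissible_profiles P T (game_filtration P T L f) \<Longrightarrow>
        (\<integral>\<^sup>+\<omega>. ennreal (norm (A i T \<omega>)) \<partial>P) \<ge> ennreal K \<Longrightarrow>
        cost P T L f h g i A \<ge> ennreal \<kappa> * (\<integral>\<^sup>+\<omega>. ennreal (norm (A i T \<omega>)) \<partial>P)"
    and "M > 0"
    and bounded_reply:
      "\<And>i A. A \<in> admissible_profiles P T (game_filtration P T L f) \<Longrightarrow>
        \<exists>r \<in> admissible P T (game_filtration P T L f).
          cost P T L f h g i (A(i := r)) \<le> ennreal M"
  shows "nash_equilibria P T L f h g \<noteq> {} \<and>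
    complete_lattice
      (profile_order P T (game_filtration P T L f) (nash_equilibria P T L f h g))"
proof -
  have Z: "(\<lambda>\<omega>. (L t \<omega>, \<chi> j. f j t \<omega>)) \<in> borel_measurable P" if "t \<in> {0..T}" for t
  proof (rule borel_measurable_Pair)
    show "L t \<in> borel_measurable P" by (rule L_meas[OF that])
    show "(\<lambda>\<omega>. \<chi> j. f j t \<omega>) \<in> borel_measurable P"
      by (rule vec_borel_measurable_iff[THEN iffD2]) (use f_meas[OF that] in simp)
  qed
  interpret usual_filtration P T "game_filtration P T L f"
    unfolding game_filtration_def using \<open>prob_space P\<close> \<open>T > 0\<close> Z by (rule rc_filtration_usual)
  have f_cont: "continuous_on {0..T} (\<lambda>t. f i t \<omega> $ l)" if "\<omega> \<in> space P" for i l \<omega>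
    using f_semimartingale[of i l] that by (simp add: continuous_semimartingale_def)
  interpret follower_game P T "game_filtration P T L f" L f h g K \<kappa> M
    by unfold_locales
      (fact L_meas L_cadlag f_meas f_nonneg f_cont h_meas g_meas h_nonneg g_nonneg lsc convex
        decr_diff submod \<open>\<kappa> > 0\<close> coercive \<open>M > 0\<close> bounded_reply)+
  have "nash_equilibria P T L f h g = equilibria"
    by (simp add: nash_equilibria_def equilibria_def)
  thus ?thesis using equilibria_complete_lattice by simp
qed

end
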